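(* The directional transience of the walk is determined by the sign of $\kappa_1=\sum_{i=-L}^{R} i\alpha_i$ in the following way: 1. If $\kappa_1>0$, then $\lim_{n\to\infty}X_n=\infty$, $\mathbb{P}_{\mathcal G}^0$-a.s. 2. If $\kappa_1<0$, then $\lim_{n\to\infty}X_n=-\infty$, $\mathbb{P}_{\mathcal G}^0$-a.s. 3. If $\kappa_1=0$, then $-\infty=\liminf_{n\to\infty}X_n<\limsup_{n\to\infty}X_n=\infty$, $\mathbb{P}_{\mathcal G}^0$-a.s.
   Context: Dirichlet model. Let $L,R$ be positive integers and let $(\alpha_i)_{i=-L}^R$ be non-negative real numbers with $\alpha_{-L}>0$ and $\alpha_R>0$, such that the gcd of all $i$ with $\alpha_i>0$ is $1$. An environment on $\mathbb Z$ is a function $\omega:\mathbb Z\times\mathbb Z\to[0,1]$ with $\sum_{y}\omega(x,y)=1$ for all $x$; $\Omega_{\mathbb Z}$ is the space of environments (a product of spaces of probability measures on $\mathbb Z$, with its Borel sigma-field). For an environment $\omega$, $P_\omega^x$ is the law of the Markov chain $(X_n)_{n\ge 0}$ on $\mathbb Z$ with $X_0=x$ and transition probabilities $\omega$ (quenched law). $P_{\mathcal G}$ is the probability measure on $\Omega_{\mathbb Z}$ under which the transition probability vectors at different sites are independent and, for each $x\in\mathbb Z$, $(\omega(x,x+i))_{-L\le i\le R,\ \alpha_i>0}$ has the Dirichlet distribution with parameters $(\alpha_i)_{\alpha_i>0}$ (all other transition probabilities at $x$ being $0$). The annealed law is $\mathbb P_{\mathcal G}^x(\cdot)=E_{\mathcal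 G}[P_\omega^x(\cdot)]$, where $E_{\mathcal G}$ is expectation under $P_{\mathcal G}$. *)

theory Defs
  imports "HOL-Probability.Probability"
begin

section \<open>Random walks in environments on \<open>\<int>\<close>\<close>

text \<open>
  An environment is a point of the product, over all sites \<open>x\<close>, of the measurable space
  \<^const>\<open>prob_algebra\<close> of probability measures on \<open>\<int>\<close> (whose sigma-algebra is generated by the
  evaluations, i.e. the Borel one); \<open>measure (\<omega> x) {y}\<close> is the transition probability \<open>\<omega>(x, y)\<close>.
\<close>

definition environments :: "(int \<Rightarrow> int measure) measure" where
  "environments = PiM UNIV (\<lambda>_. prob_algebra (count_space UNIV))"

definition trajectories :: "(nat \<Rightarrow> int) measure" where
  "trajectories = PiM UNIV (\<lambda>_. count_space UNIV)"

definition step_kernel ::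
  "(int \<Rightarrow> int measure) \<Rightarrow> int \<Rightarrow> nat \<Rightarrow> (nat \<Rightarrow> int) \<Rightarrow> int measure" where
  "step_kernel \<omega> x n h = (if n = 0 then return (count_space UNIV) x else \<omega> (h (n - 1)))"

text \<open>
  \<^term>\<open>projective_family.lim UNIV (Ionescu_Tulcea.CI P M) M\<close> is the measure on infinite
  trajectories obtained from the kernels \<open>P\<close> by the Ionescu-Tulcea theorem; inside the locale
  \<^locale>\<open>Ionescu_Tulcea\<close> it is called \<open>PF.lim\<close>. Lemma \<open>quenched_law_cylinder\<close> below gives its
  finite-dimensional distributions.
\<close>

definition quenched_law :: "(int \<Rightarrow> int measure) \<Rightarrow> int \<Rightarrow> (nat \<Rightarrow> int) measure" where
  "quenched_law \<omega> x =
     projective_family.lim UNIV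
       (Ionescu_Tulcea.CI (step_kernel \<omega> x) (\<lambda>_. count_space UNIV)) (\<lambda>_. count_space UNIV)"

definition annealed_law ::
  "(int \<Rightarrow> int measure) measure \<Rightarrow> int \<Rightarrow> (nat \<Rightarrow> int) measure" where
  "annealed_law E x = E \<bind> (\<lambda>\<omega>. quenched_law \<omega> x)"

section \<open>The Dirichlet distribution\<close>

definition open_simplex :: "'i set \<Rightarrow> ('i \<Rightarrow> real) set" where
  "open_simplex I = {p \<in> I \<rightarrow>\<^sub>E {0<..}. sum p I = 1}"

text \<open>
  Lebesgue measure on the simplex is taken in all coordinates but the last one, which is then
  recovered as one minus the sum of the others.
\<close>

definition open_corner :: "'i set \<Rightarrow> ('i \<Rightarrow> real) set" where
  "open_corner J = {u \<in> J \<rightarrow>\<^sub>E {0<..}. sum u J < 1}"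

definition fill_last :: "'i::linorder set \<Rightarrow> ('i \<Rightarrow> real) \<Rightarrow> 'i \<Rightarrow> real" where
  "fill_last I u = u(Max I := 1 - sum u (I - {Max I}))"

definition dirichlet_density :: "'i set \<Rightarrow> ('i \<Rightarrow> real) \<Rightarrow> ('i \<Rightarrow> real) \<Rightarrow> real" where
  "dirichlet_density I a p =
     Gamma (sum a I) / (\<Prod>i\<in>I. Gamma (a i)) * (\<Prod>i\<in>I. p i powr (a i - 1))"

definition dirichlet :: "'i::linorder set \<Rightarrow> ('i \<Rightarrow> real) \<Rightarrow> ('i \<Rightarrow> real) measure" where
  "dirichlet I a =
     distr
       (density
         (restrict_space (PiM (I - {Max I}) (\<lambda>_. lborel)) (open_corner (I - {Max I})))
         (\<lambda>u. ennreal (dirichlet_density I a (fill_last I u))))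
       (restrict_space (PiM I (\<lambda>_. borel)) (open_simplex I))
       (fill_last I)"

section \<open>Dirichlet environments\<close>

definition jump_range :: "nat \<Rightarrow> nat \<Rightarrow> (int \<Rightarrow> real) \<Rightarrow> int set" where
  "jump_range L R \<alpha> = {i \<in> {- int L..int R}. \<alpha> i > 0}"

text \<open>The measure on \<open>\<int>\<close> that gives mass \<open>p i\<close> to \<open>x + i\<close>, for \<open>i \<in> I\<close>.\<close>

definition jump_measure :: "int set \<Rightarrow> int \<Rightarrow> (int \<Rightarrow> real) \<Rightarrow> int measure" where
  "jump_measure I x p = distr (point_measure I (\<lambda>i. ennreal (p i))) (count_space UNIV) (\<lambda>i. x + i)"

definition dirichlet_environment ::
  "nat \<Rightarrow> nat \<Rightarrow> (int \<Rightarrow> real) \<Rightarrow> (int \<Rightarrow> int measure) measure" where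
  "dirichlet_environment L R \<alpha> =
     PiM UNIV (\<lambda>x. distr (dirichlet (jump_range L R \<alpha>) \<alpha>) (prob_algebra (count_space UNIV))
                     (jump_measure (jump_range L R \<alpha>) x))"

definition kappa1 :: "nat \<Rightarrow> nat \<Rightarrow> (int \<Rightarrow> real) \<Rightarrow> real" where
  "kappa1 L R \<alpha> = (\<Sum>i = - int L..int R. real_of_int i * \<alpha> i)"

section \<open>The laws are well defined\<close>


lemma Ionescu_Tulcea_step_kernel:
  assumes "\<omega> \<in> space environments"
  shows "Ionescu_Tulcea (step_kernel \<omega> x) (\<lambda>_. count_space UNIV)"
proof (rule Ionescu_Tulcea.intro)
  have \<omega>: "\<omega> y \<in> space (prob_algebra (count_space UNIV))" for y
    using assms by (auto simp: environments_def space_PiM)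
  show "step_kernel \<omega> x i \<in> PiM {0..<i} (\<lambda>_. count_space UNIV) \<rightarrow>\<^sub>M subprob_algebra (count_space UNIV)" for i
  proof (cases "i = 0")
    case True
    then show ?thesis
      by (auto simp: step_kernel_def[abs_def] space_subprob_algebra prob_space_return
               intro!: prob_space_imp_subprob_space)
  next
    case False
    have "\<omega> \<in> count_space UNIV \<rightarrow>\<^sub>M subprob_algebra (count_space UNIV)"
      using \<omega> by (auto simp: space_prob_algebra space_subprob_algebra prob_space_imp_subprob_space)
    from measurable_compose[OF measurable_component_singleton[of "i - 1" "{0..<i}"] this] False
    show ?thesis by (auto simp: step_kernel_def[abs_def])
  qed
  show "prob_space (step_kernel \<omega> x i h)"
    if "h \<in> space (PiM {0..<i} (\<lambda>_. count_space UNIV))" for i h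
    using \<omega> by (auto simp: step_kernel_def space_prob_algebra prob_space_return)
qed

lemma
  assumes "\<omega> \<in> space environments"
  shows prob_space_quenched_law: "prob_space (quenched_law \<omega> x)"
    and sets_quenched_law: "sets (quenched_law \<omega> x) = sets trajectories"
proof -
  interpret Ionescu_Tulcea "step_kernel \<omega> x" "\<lambda>_. count_space UNIV"
    by (rule Ionescu_Tulcea_step_kernel[OF assms])
  show "prob_space (quenched_law \<omega> x)"
    proof
    have *: "PF.emb UNIV {} (space (PiM {} (\<lambda>_. count_space UNIV))) = UNIV"
      by (auto simp: prod_emb_def space_PiM)
    have "emeasure (PF.lim) (PF.emb UNIV {} (space (PiM {} (\<lambda>_. count_space UNIV)))) =
        emeasure (CI {}) (space (PiM {} (\<lambda>_. count_space UNIV)))"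
      by (rule lim) auto
    also have "\<dots> = 1"
      using prob_space.emeasure_space_1[OF PF.prob_space_P[of "{}"]] by (simp add: PF.space_P)
    finally show "emeasure (quenched_law \<omega> x) (space (quenched_law \<omega> x)) = 1"
      by (simp only: quenched_law_def * PF.space_lim) (simp add: space_PiM)
  qed
  show "sets (quenched_law \<omega> x) = sets trajectories"
    unfolding quenched_law_def trajectories_def by simp
qed

lemma quenched_law_prefix:
  assumes \<omega>: "\<omega> \<in> space environments"
  shows "emeasure (quenched_law \<omega> x) {X. \<forall>k<n. X k = p k} =
           (\<Prod>k<n. emeasure (step_kernel \<omega> x k p) {p k})"
proof -
  interpret Ionescu_Tulcea "step_kernel \<omega> x" "\<lambda>_. count_space UNIV"
    by (rule Ionescu_Tulcea_step_kernel[OF \<omega>])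
  let ?M = "\<lambda>_::nat. count_space (UNIV::int set)"
  have sing: "{restrict p {0..<m}} \<in> sets (PiM {0..<m} ?M)" for m
  proof -
    have "{restrict p {0..<m}} = PiE {0..<m} (\<lambda>k. {p k})"
      by (auto simp: PiE_iff fun_eq_iff extensional_def)
    then show ?thesis by (auto intro!: sets_PiM_I_finite)
  qed
  have und: "(\<lambda>_. undefined) \<in> space (PiM {0..<0} ?M)" by (simp add: space_PiM)
  have C: "emeasure (C 0 m (\<lambda>_. undefined)) {restrict p {0..<m}} =
          (\<Prod>k<m. emeasure (step_kernel \<omega> x k p) {p k})" for m
  proof (induction m)
    case 0
    have "restrict p {0..<0} = (\<lambda>_. undefined)" by (auto simp: restrict_def)
    then show ?case using sing[of 0] by simp
  next
    case (Suc m)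
    have sp: "space (C 0 m (\<lambda>_. undefined)) = space (PiM {0..<m} ?M)"
      using space_C[OF und, of m] by simp
    have se: "sets (C 0 m (\<lambda>_. undefined)) = sets (PiM {0..<m} ?M)"
      using sets_C[OF und, of m] by simp
    have eP_m: "emeasure (eP m h) {restrict p {0..<Suc m}} =
        emeasure (step_kernel \<omega> x m p) {p m} * indicator {restrict p {0..<m}} h"
      if h: "h \<in> space (PiM {0..<m} ?M)" for h
    proof -
      have "fun_upd h m -` {restrict p {0..<Suc m}} \<inter> space (?M m) =
            (if h = restrict p {0..<m} then {p m} else {})"
        using h
        apply (auto simp: space_PiM fun_eq_iff PiE_iff extensional_def restrict_def split: if_splits)
        by (metis less_SucE less_Suc_eq order_less_irrefl)+
      moreover have "step_kernel \<omega> x m (restrict p {0..<m}) = step_kernel \<omega> x m p"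
        by (simp add: step_kernel_def)
      ultimately show ?thesis
        by (subst emeasure_eP[OF h sing]) auto
    qed
    have "emeasure (C 0 (Suc m) (\<lambda>_. undefined)) {restrict p {0..<Suc m}} =
       (\<integral>\<^sup>+h. emeasure (eP m h) {restrict p {0..<Suc m}} \<partial>C 0 m (\<lambda>_. undefined))"
      using sing[of "Suc m"] sp measurable_eP[of m]
      by (simp, intro emeasure_bind[where N = "PiM {0..<Suc m} ?M"])
        (auto simp: sp measurable_cong_sets[OF se refl] space_PiM_empty_iff)
    also have "\<dots> = (\<integral>\<^sup>+h. emeasure (step_kernel \<omega> x m p) {p m} * indicator {restrict p {0..<m}} h \<partial>C 0 m (\<lambda>_. undefined))"
      by (intro nn_integral_cong eP_m) (simp add: sp)
    also have "\<dots> = emeasure (step_kernel \<omega> x m p) {p m} * emeasure (C 0 m (\<lambda>_. undefined)) {restrict p {0..<m}}"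
      using sing[of m] by (intro nn_integral_cmult_indicator) (simp add: se)
    finally show ?case by (simp only: Suc.IH prod.lessThan_Suc mult.commute)
  qed
  have eq: "{X. \<forall>k<n. X k = p k} = PF.emb UNIV {0..<n} {restrict p {0..<n}}"
    by (auto simp: prod_emb_def space_PiM fun_eq_iff restrict_def) (metis )+
  have "emeasure (quenched_law \<omega> x) {X. \<forall>k<n. X k = p k} = emeasure (CI {0..<n}) {restrict p {0..<n}}"
    unfolding quenched_law_def eq by (rule lim) (auto simp: sing)
  also have "\<dots> = C 0 n (\<lambda>_. undefined) (PF.emb {0..<n} {0..<n} {restrict p {0..<n}})"
    by (rule emeasure_CI) (auto simp: sing)
  also have "PF.emb {0..<n} {0..<n} {restrict p {0..<n}} = {restrict p {0..<n}}"
    by (intro prod_emb_id) (auto)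
  finally show ?thesis by (simp only: C)
qed

lemma quenched_law_cylinder:
  assumes \<omega>: "\<omega> \<in> space environments"
  shows "measure (quenched_law \<omega> x) {X. \<forall>k\<le>n. X k = p k} =
           (if p 0 = x then 1 else 0) * (\<Prod>k<n. measure (\<omega> (p k)) {p (Suc k)})"
proof -
  have *: "emeasure (step_kernel \<omega> x k p) A = ennreal (measure (step_kernel \<omega> x k p) A)" for k A
  proof -
    have "prob_space (step_kernel \<omega> x k p)"
      using \<omega> by (auto simp: step_kernel_def environments_def space_PiM space_prob_algebra prob_space_return)
    then show ?thesis
      by (intro finite_measure.emeasure_eq_measure prob_space.finite_measure)
  qed
  have "{X. \<forall>k\<le>n. X k = p k} = {X. \<forall>k<Suc n. X k = p k}" by (auto simp: less_Suc_eq_le)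
  then have "emeasure (quenched_law \<omega> x) {X. \<forall>k\<le>n. X k = p k} =
      ennreal (\<Prod>k<Suc n. measure (step_kernel \<omega> x k p) {p k})"
    by (simp only: quenched_law_prefix[OF \<omega>] * prod_ennreal measure_nonneg)
  then have "measure (quenched_law \<omega> x) {X. \<forall>k\<le>n. X k = p k} =
      (\<Prod>k<Suc n. measure (step_kernel \<omega> x k p) {p k})"
    by (intro measure_eq_emeasure_eq_ennreal prod_nonneg) auto
  then show ?thesis
    by (simp add: prod.lessThan_Suc_shift step_kernel_def measure_return indicator_def
        del: prod.lessThan_Suc)
qed

lemma sets_trajectories_prefix:
  "sets trajectories = sigma_sets UNIV (insert {} (range (\<lambda>xs. {X. \<forall>k<length xs. X k = xs ! k})))"
  (is "_ = sigma_sets UNIV ?G")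
proof
  have "sets trajectories = sigma_sets UNIV {{f. f i \<in> A} |i A. True}"
    unfolding trajectories_def by (simp add: sets_PiM_single)
  also have "\<dots> \<subseteq> sigma_sets UNIV ?G"
  proof (rule sigma_sets_mono, safe)
    fix i :: nat and A :: "int set"
    have "{f. f i \<in> A} = (\<Union>xs\<in>{xs. length xs = Suc i \<and> xs ! i \<in> A}. {X. \<forall>k<length xs. X k = xs ! k})"
    proof safe
      fix f :: "nat \<Rightarrow> int" assume "f i \<in> A"
      then show "f \<in> (\<Union>xs\<in>{xs. length xs = Suc i \<and> xs ! i \<in> A}. {X. \<forall>k<length xs. X k = xs ! k})"
        by (intro UN_I[of "map f [0..<Suc i]"]) (auto simp del: upt_Suc)
    qed auto
    moreover have "(\<Union>xs\<in>{xs. length xs = Suc i \<and> xs ! i \<in> A}. {X. \<forall>k<length xs. X k = xs ! k}) \<in> sigma_sets UNIV ?G"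
      by (rule sigma_sets_UNION)
        (blast intro: countableI_type countable_image sigma_sets.Basic)+
    ultimately show "{f. f i \<in> A} \<in> sigma_sets UNIV ?G" by simp
  qed
  finally show "sets trajectories \<subseteq> sigma_sets UNIV ?G" .
  have "{X. \<forall>k<length xs. X k = xs ! k} \<in> sets trajectories" for xs
  proof -
    have "{X \<in> space trajectories. \<forall>k<length xs. X k = xs ! k} \<in> sets trajectories"
      unfolding trajectories_def by measurable
    then show ?thesis by (simp add: trajectories_def space_PiM)
  qed
  then show "sigma_sets UNIV ?G \<subseteq> sets trajectories"
    using sets.sigma_sets_subset[of ?G trajectories] by (auto simp: trajectories_def space_PiM)
qed

lemma measurable_quenched_law:
  "(\<lambda>\<omega>. quenched_law \<omega> x) \<in> environments \<rightarrow>\<^sub>M prob_algebra trajectories"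
proof (rule measurable_prob_algebra_generated[OF sets_trajectories_prefix])
  show "Int_stable (insert {} (range (\<lambda>xs. {X::nat \<Rightarrow> int. \<forall>k<length xs. X k = xs ! k})))"
    (is "Int_stable ?G")
  proof -
    let ?c = "\<lambda>xs. {X::nat \<Rightarrow> int. \<forall>k<length xs. X k = xs ! k}"
    have *: "?c xs \<inter> ?c ys \<in> ?G" if "length xs \<le> length ys" for xs ys
    proof (cases "\<forall>k<length xs. xs ! k = ys ! k")
      case True
      then have "?c xs \<inter> ?c ys = ?c ys" using that by force
      then show ?thesis by simp
    next
      case False
      then have "?c xs \<inter> ?c ys = {}" using that by force
      then show ?thesis by simp
    qed
    have "?c xs \<inter> ?c ys \<in> ?G" for xs ys
      using *[of xs ys] *[of ys xs] by (cases "length xs \<le> length ys") (auto simp: Int_commute)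
    then show ?thesis by (auto simp: Int_stable_def)
  qed
  fix A assume "A \<in> insert {} (range (\<lambda>xs. {X::nat \<Rightarrow> int. \<forall>k<length xs. X k = xs ! k}))"
  then consider "A = {}" | xs where "A = {X. \<forall>k<length xs. X k = xs ! k}" by auto
  then show "(\<lambda>\<omega>. emeasure (quenched_law \<omega> x) A) \<in> borel_measurable environments"
  proof cases
    case 2
    have "(\<lambda>\<omega>. \<Prod>k<length xs. emeasure (step_kernel \<omega> x k (\<lambda>k. xs ! k)) {xs ! k})
        \<in> borel_measurable environments"
    proof (rule borel_measurable_prod_ennreal)
      fix k
      have "(\<lambda>\<omega>. emeasure (\<omega> y) B) \<in> borel_measurable environments" for y B
      proof -
        have "(\<lambda>\<omega>. \<omega> y) \<in> environments \<rightarrow>\<^sub>M subprob_algebra (count_space UNIV)"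
          unfolding environments_def
          by (intro measurable_prob_algebraD measurable_component_singleton) simp
        from measurable_compose[OF this measurable_emeasure_subprob_algebra[of B]]
        show ?thesis by simp
      qed
      then show "(\<lambda>\<omega>. emeasure (step_kernel \<omega> x k (\<lambda>k. xs ! k)) {xs ! k})
          \<in> borel_measurable environments"
        by (cases "k = 0") (auto simp: step_kernel_def)
    qed
    then show ?thesis
      by (subst measurable_cong[OF quenched_law_prefix[of _ x "length xs" "\<lambda>k. xs ! k", folded 2]])
        (auto simp: 2)
  qed simp
qed (auto simp: prob_space_quenched_law sets_quenched_law)

lemma annealed_law_eq:
  assumes "E \<in> space (prob_algebra environments)" "A \<in> sets trajectories"
  shows "measure (annealed_law E x) A = (\<integral>\<omega>. measure (quenched_law \<omega> x) A \<partial>E)"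
proof -
  have E: "sets E = sets environments" using assms(1) by (simp add: space_prob_algebra)
  have *: "(\<lambda>\<omega>. quenched_law \<omega> x) \<in> E \<rightarrow>\<^sub>M subprob_algebra trajectories"
    using measurable_prob_algebraD[OF measurable_quenched_law, of x] by (simp add: measurable_cong_sets[OF E refl])
  have "subprob_space E"
    using assms(1) by (auto simp: space_prob_algebra intro: prob_space_imp_subprob_space)
  from subprob_space.measure_bind[OF this * assms(2)]
  show ?thesis by (simp add: annealed_law_def)
qed
lemma nn_integral_Beta_scaled:
  fixes a b s :: real
  assumes "a > 0" "b > 0" "s > 0"
  shows "(\<integral>\<^sup>+x. ennreal (x powr (a - 1) * (s - x) powr (b - 1)) * indicator {0<..<s} x \<partial>lborel) =
           ennreal (s powr (a + b - 1) * Beta a b)"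
proof -
  let ?g = "\<lambda>t::real. t powr (a - 1) * (1 - t) powr (b - 1)"
  have "((\<lambda>t. ?g t) has_integral Beta a b) {0<..<1}"
    using has_integral_Beta_real[OF assms(1,2)] by (simp add: has_integral_Icc_iff_Ioo)
  then have 1: "(\<integral>\<^sup>+t. ennreal (indicator {0<..<1} t * ?g t) \<partial>lborel) = ennreal (Beta a b)"
    by (intro nn_integral_has_integral_lebesgue) auto
  have "(\<integral>\<^sup>+x. ennreal (x powr (a - 1) * (s - x) powr (b - 1)) * indicator {0<..<s} x \<partial>lborel) =
     \<bar>s\<bar> * (\<integral>\<^sup>+t. ennreal ((0 + s * t) powr (a - 1) * (s - (0 + s * t)) powr (b - 1)) * indicator {0<..<s} (0 + s * t) \<partial>lborel)"
    using assms by (intro nn_integral_real_affine) auto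
  also have "\<dots> = ennreal s * (\<integral>\<^sup>+t. ennreal (s powr (a + b - 2)) * ennreal (indicator {0<..<1} t * ?g t) \<partial>lborel)"
  proof -
    have "ennreal ((0 + s * t) powr (a - 1) * (s - (0 + s * t)) powr (b - 1)) * indicator {0<..<s} (0 + s * t)
       = ennreal (s powr (a + b - 2)) * ennreal (indicator {0<..<1} t * ?g t)" for t
    proof (cases "t \<in> {0<..<1}")
      case True
      then have e: "s - s * t = s * (1 - t)" and "0 < s * t" "s * t < s" using assms by (auto simp: algebra_simps)
      moreover have "s powr (a - 1) * s powr (b - 1) = s powr (a + b - 2)"
        by (simp add: powr_add[symmetric])
      ultimately show ?thesis using True assms
        by (simp only: e add_0 powr_mult) (simp add: powr_mult ennreal_mult[symmetric] mult_ac)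
    next
      case False
      then have "s * t \<notin> {0<..<s}" using assms by (auto simp: zero_less_mult_iff)
      then show ?thesis using False by simp
    qed
    then show ?thesis using assms by simp
  qed
  also have "\<dots> = ennreal s * (ennreal (s powr (a + b - 2)) * ennreal (Beta a b))"
    by (subst nn_integral_cmult) (auto simp: 1)
  also have "\<dots> = ennreal (s powr (a + b - 1) * Beta a b)"
  proof -
    have "s * s powr (a + b - 2) = s powr (a + b - 1)"
      using assms by (simp add: powr_mult_base)
    then show ?thesis using assms
      by (simp add: ennreal_mult'[symmetric] mult.assoc[symmetric] ennreal_mult[symmetric])
  qed
  finally show ?thesis .
qed

lemma measurable_positive_sum_less:
  fixes s :: real
  assumes "finite J"
  shows "Measurable.pred (PiM J (\<lambda>_. lborel)) (\<lambda>u. (\<forall>i\<in>J. 0 < u i) \<and> sum u J < s)"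
proof -
  have c: "(\<lambda>u. u i) \<in> borel_measurable (PiM J (\<lambda>_. lborel :: real measure))" if "i \<in> J" for i
    using measurable_component_singleton[OF that, of "\<lambda>_. lborel"] by simp
  have "(\<lambda>u. sum u J) \<in> borel_measurable (PiM J (\<lambda>_. lborel :: real measure))"
    using c by (intro borel_measurable_sum)
  then show ?thesis
    using assms by (intro pred_intros_logic pred_intros_finite borel_measurable_pred_less c) auto
qed

lemma measurable_powr_product:
  fixes s b :: real
  shows "(\<lambda>u. ennreal ((\<Prod>i\<in>J. u i powr (a i - 1)) * (s - sum u J) powr (b - 1)))
       \<in> borel_measurable (PiM J (\<lambda>_. lborel))"
proof -
  have c[measurable]: "(\<lambda>u. u i) \<in> borel_measurable (PiM J (\<lambda>_. lborel :: real measure))" if "i \<in> J" for i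
    using measurable_component_singleton[OF that, of "\<lambda>_. lborel"] by simp
  have [measurable]: "(\<lambda>u. sum u J) \<in> borel_measurable (PiM J (\<lambda>_. lborel :: real measure))"
    using c by (intro borel_measurable_sum)
  have [measurable]: "(\<lambda>u. \<Prod>i\<in>J. u i powr (a i - 1)) \<in> borel_measurable (PiM J (\<lambda>_. lborel :: real measure))"
    by (intro borel_measurable_prod) measurable
  show ?thesis by measurable
qed

lemma nn_integral_dirichlet:
  fixes a :: "'i \<Rightarrow> real"
  assumes "finite J" "\<And>i. i \<in> J \<Longrightarrow> a i > 0" "b > 0" "s > 0"
  shows "(\<integral>\<^sup>+u. ennreal ((\<Prod>i\<in>J. u i powr (a i - 1)) * (s - sum u J) powr (b - 1)) *
             indicator {u. (\<forall>i\<in>J. 0 < u i) \<and> sum u J < s} u \<partial>PiM J (\<lambda>_. lborel)) =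
         ennreal (s powr (sum a J + b - 1) * ((\<Prod>i\<in>J. Gamma (a i)) * Gamma b / Gamma (sum a J + b)))"
  using assms
proof (induction J arbitrary: s rule: finite_induct)
  case empty
  then have "Gamma b > 0" by (auto intro: Gamma_real_pos)
  then have "Gamma b \<noteq> 0" by simp
  with empty show ?case by (simp add: PiM_empty nn_integral_count_space_finite)
next
  case (insert j J)
  interpret product_sigma_finite "\<lambda>_::'i. lborel :: real measure"
    by (simp add: product_sigma_finite_def sigma_finite_lborel)
  define f where "f u = ennreal ((\<Prod>i\<in>insert j J. u i powr (a i - 1)) * (s - sum u (insert j J)) powr (b - 1)) *
             indicator {u. (\<forall>i\<in>insert j J. 0 < u i) \<and> sum u (insert j J) < s} u" for u
  define A where "A = sum a J + b"
  define K where "K = (\<Prod>i\<in>J. Gamma (a i)) * Gamma b / Gamma A"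
  have A: "A > 0" unfolding A_def using insert by (intro add_nonneg_pos sum_nonneg) (auto intro: less_imp_le)
  have K: "K \<ge> 0" unfolding K_def using insert A
    by (intro divide_nonneg_nonneg mult_nonneg_nonneg prod_nonneg) (auto intro!: less_imp_le Gamma_real_pos)
  have GA: "Gamma A \<noteq> 0" using Gamma_real_pos[OF A] by simp
  have meas: "f \<in> borel_measurable (PiM (insert j J) (\<lambda>_. lborel))"
  proof -
    have [measurable]: "Measurable.pred (PiM (insert j J) (\<lambda>_. lborel)) (\<lambda>u. (\<forall>i\<in>insert j J. 0 < u i) \<and> sum u (insert j J) < s)"
        using insert(1) by (intro measurable_positive_sum_less) simp
    have "(\<lambda>u. ennreal ((\<Prod>i\<in>insert j J. u i powr (a i - 1)) * (s - sum u (insert j J)) powr (b - 1)))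
       \<in> borel_measurable (PiM (insert j J) (\<lambda>_. lborel))"
      by (rule measurable_powr_product)
    then show ?thesis unfolding f_def
      by (intro borel_measurable_times_ennreal borel_measurable_indicator') (measurable)
  qed
  have upd: "(\<Prod>i\<in>J. (x(j := y)) i powr (a i - 1)) = (\<Prod>i\<in>J. x i powr (a i - 1))"
    "sum (x(j := y)) J = sum x J" "(\<forall>i\<in>J. 0 < (x(j := y)) i) \<longleftrightarrow> (\<forall>i\<in>J. 0 < x i)" for x :: "'i \<Rightarrow> real" and y
    using insert(2) by (auto intro!: prod.cong sum.cong)
  have inner: "(\<integral>\<^sup>+x. f (x(j := y)) \<partial>PiM J (\<lambda>_. lborel)) =
      ennreal (y powr (a j - 1) * (s - y) powr (A - 1)) * indicator {0<..<s} y * ennreal K" for y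
  proof (cases "y \<in> {0<..<s}")
    case True
    let ?h = "\<lambda>x. ennreal ((\<Prod>i\<in>J. x i powr (a i - 1)) * (s - y - sum x J) powr (b - 1)) *
             indicator {u. (\<forall>i\<in>J. 0 < u i) \<and> sum u J < s - y} x"
    have "f (x(j := y)) = ennreal (y powr (a j - 1)) * ?h x" for x
    proof -
      have "(x(j:=y) \<in> {u. (\<forall>i\<in>insert j J. 0 < u i) \<and> sum u (insert j J) < s}) \<longleftrightarrow>
          x \<in> {u. (\<forall>i\<in>J. 0 < u i) \<and> sum u J < s - y}"
        using insert(1,2) True upd[of x y] by (simp del: fun_upd_apply) (auto)
      moreover have "(\<Prod>i\<in>insert j J. (x(j := y)) i powr (a i - 1)) * (s - sum (x(j := y)) (insert j J)) powr (b - 1)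
         = y powr (a j - 1) * ((\<Prod>i\<in>J. x i powr (a i - 1)) * (s - y - sum x J) powr (b - 1))"
        using insert(1,2) upd[of x y] by (simp del: fun_upd_apply) (simp add: diff_diff_eq)
      ultimately show ?thesis
        unfolding f_def by (simp only: indicator_def) (simp add: ennreal_mult' mult.assoc)
    qed
    then have "(\<integral>\<^sup>+x. f (x(j := y)) \<partial>PiM J (\<lambda>_. lborel)) = (\<integral>\<^sup>+x. ennreal (y powr (a j - 1)) * ?h x \<partial>PiM J (\<lambda>_. lborel))"
      by simp
    also have "\<dots> = ennreal (y powr (a j - 1)) * (\<integral>\<^sup>+x. ?h x \<partial>PiM J (\<lambda>_. lborel))"
    proof (rule nn_integral_cmult)
      have [measurable]: "Measurable.pred (PiM J (\<lambda>_. lborel)) (\<lambda>u. (\<forall>i\<in>J. 0 < u i) \<and> sum u J < s - y)"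
        using insert(1) by (intro measurable_positive_sum_less) simp
      have "(\<lambda>u. ennreal ((\<Prod>i\<in>J. u i powr (a i - 1)) * (s - y - sum u J) powr (b - 1)))
         \<in> borel_measurable (PiM J (\<lambda>_. lborel))"
        by (rule measurable_powr_product)
      then show "?h \<in> borel_measurable (PiM J (\<lambda>_. lborel))"
        by (intro borel_measurable_times_ennreal borel_measurable_indicator') (measurable)
    qed
    also have "(\<integral>\<^sup>+x. ?h x \<partial>PiM J (\<lambda>_. lborel)) = ennreal ((s - y) powr (A - 1) * K)"
      using insert.IH[of "s - y"] insert.prems True by (simp add: A_def K_def)
    finally have "(\<integral>\<^sup>+x. f (x(j := y)) \<partial>PiM J (\<lambda>_. lborel)) = ennreal (y powr (a j - 1)) * ennreal ((s - y) powr (A - 1) * K)" .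
    then show ?thesis using True K by (simp only: ennreal_mult' mult.assoc powr_ge_zero indicator_simps mult_1_left)
  next
    case False
    have "f (x(j := y)) = 0" for x
    proof -
      have "\<not> ((\<forall>i\<in>insert j J. 0 < (x(j:=y)) i) \<and> sum (x(j:=y)) (insert j J) < s)"
      proof
        assume *: "(\<forall>i\<in>insert j J. 0 < (x(j:=y)) i) \<and> sum (x(j:=y)) (insert j J) < s"
        then have "0 < y" by auto
        moreover have "sum (x(j:=y)) J \<ge> 0" using * by (intro sum_nonneg) (auto intro: less_imp_le)
        moreover have "y + sum (x(j:=y)) J < s" using * insert(1,2) by simp
        ultimately show False using False by auto
      qed
      then show ?thesis unfolding f_def by (simp only: indicator_def mem_Collect_eq if_False mult_zero_right) simp
    qed
    then show ?thesis using False by simp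
  qed
  have "(\<integral>\<^sup>+u. f u \<partial>PiM (insert j J) (\<lambda>_. lborel)) = (\<integral>\<^sup>+y. (\<integral>\<^sup>+x. f (x(j := y)) \<partial>PiM J (\<lambda>_. lborel)) \<partial>lborel)"
    using insert(1,2) meas by (rule product_nn_integral_insert_rev)
  also have "\<dots> = (\<integral>\<^sup>+y. ennreal (y powr (a j - 1) * (s - y) powr (A - 1)) * indicator {0<..<s} y * ennreal K \<partial>lborel)"
    by (simp only: inner)
  also have "\<dots> = (\<integral>\<^sup>+y. ennreal (y powr (a j - 1) * (s - y) powr (A - 1)) * indicator {0<..<s} y \<partial>lborel) * ennreal K"
    by (rule nn_integral_multc) measurable
  also have "\<dots> = ennreal (s powr (a j + A - 1) * Beta (a j) A) * ennreal K"
    using insert.prems A by (subst nn_integral_Beta_scaled) auto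
  also have "\<dots> = ennreal (s powr (a j + A - 1) * (Beta (a j) A * K))"
    using K by (simp add: ennreal_mult''[symmetric] mult.assoc)
  also have "Beta (a j) A * K = (\<Prod>i\<in>insert j J. Gamma (a i)) * Gamma b / Gamma (a j + A)"
    using GA insert(1,2) by (simp add: Beta_def K_def)
  also have "a j + A = sum a (insert j J) + b"
    using insert(1,2) by (simp add: A_def)
  finally show ?case unfolding f_def .
qed

lemma measurable_fill_last:
  assumes "finite I" "I \<noteq> {}"
  shows "fill_last I \<in> restrict_space (PiM (I - {Max I}) (\<lambda>_. lborel)) (open_corner (I - {Max I})) \<rightarrow>\<^sub>M
           restrict_space (PiM I (\<lambda>_. borel)) (open_simplex I)"
proof (rule measurable_restrict_space2)
  let ?m = "Max I" and ?J = "I - {Max I}"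
  have m: "?m \<in> I" using assms by simp
  have "fill_last I u \<in> open_simplex I" if "u \<in> open_corner ?J" for u
  proof -
    have s: "sum (fill_last I u) I = fill_last I u ?m + sum (fill_last I u) ?J"
      using assms(1) m by (rule sum.remove)
    have "sum (fill_last I u) ?J = sum u ?J" by (intro sum.cong) (auto simp: fill_last_def)
    then have "sum (fill_last I u) I = 1" using s by (simp add: fill_last_def)
    moreover have "fill_last I u \<in> I \<rightarrow>\<^sub>E {0<..}"
      using that m by (auto simp: open_corner_def fill_last_def PiE_iff extensional_def)
    ultimately show ?thesis by (simp add: open_simplex_def)
  qed
  then show "fill_last I \<in> space (restrict_space (PiM ?J (\<lambda>_. lborel)) (open_corner ?J)) \<rightarrow> open_simplex I"
    by (auto simp: space_restrict_space)
  have "(\<lambda>u. u(?m := 1 - sum u ?J)) \<in> PiM ?J (\<lambda>_. lborel) \<rightarrow>\<^sub>M PiM I (\<lambda>_. borel :: real measure)"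
  proof (rule measurable_fun_upd[where J="?J" and M="\<lambda>_. borel" and i="?m"])
    show "I = ?J \<union> {?m}" using m by auto
    show "(\<lambda>u. u) \<in> PiM ?J (\<lambda>_. lborel) \<rightarrow>\<^sub>M PiM ?J (\<lambda>_. borel :: real measure)"
      by (rule measurable_ident_sets) (intro sets_PiM_cong, auto)
    show "(\<lambda>u. 1 - sum u ?J) \<in> PiM ?J (\<lambda>_. lborel) \<rightarrow>\<^sub>M (borel :: real measure)"
    proof (intro borel_measurable_diff borel_measurable_sum borel_measurable_const)
      fix i assume "i \<in> ?J"
      from measurable_component_singleton[OF this, of "\<lambda>_. lborel"]
      show "(\<lambda>u. u i) \<in> borel_measurable (PiM ?J (\<lambda>_. lborel :: real measure))" by simp
    qed
  qed
  then show "fill_last I \<in> restrict_space (PiM ?J (\<lambda>_. lborel)) (open_corner ?J) \<rightarrow>\<^sub>M PiM I (\<lambda>_. borel)"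
    unfolding fill_last_def[abs_def] by (rule measurable_restrict_space1)
qed

lemma prob_space_dirichlet:
  fixes I :: "'i::linorder set"
  assumes I: "finite I" "I \<noteq> {}" and a: "\<And>i. i \<in> I \<Longrightarrow> a i > 0"
  shows "prob_space (dirichlet I a)"
proof -
  let ?m = "Max I" and ?J = "I - {Max I}"
  let ?R = "restrict_space (PiM ?J (\<lambda>_. lborel)) (open_corner ?J)"
  have m: "?m \<in> I" using I by simp
  note [measurable] = measurable_fill_last[OF I]
  have fin: "finite ?J" using I by simp
  have aJ: "\<And>i. i \<in> ?J \<Longrightarrow> a i > 0" using a by simp
  have corner: "open_corner ?J \<inter> space (PiM ?J (\<lambda>_. lborel)) \<in> sets (PiM ?J (\<lambda>_. lborel))"
  proof -
    have [measurable]: "Measurable.pred (PiM ?J (\<lambda>_. lborel)) (\<lambda>u. (\<forall>i\<in>?J. 0 < u i) \<and> sum u ?J < (1::real))"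
        using fin by (rule measurable_positive_sum_less)
    have "open_corner ?J \<inter> space (PiM ?J (\<lambda>_. lborel)) =
        {u \<in> space (PiM ?J (\<lambda>_. lborel)). (\<forall>i\<in>?J. 0 < u i) \<and> sum u ?J < 1}"
      by (auto simp: open_corner_def space_PiM PiE_iff extensional_def)
    then show ?thesis by simp
  qed
  define c where "c = Gamma (sum a I) / (\<Prod>i\<in>I. Gamma (a i))"
  have pos: "Gamma (sum a I) > 0" "(\<Prod>i\<in>I. Gamma (a i)) > 0"
    using I a by (auto intro!: Gamma_real_pos sum_pos prod_pos)
  have c: "c > 0" using pos by (simp add: c_def)
  have dens: "dirichlet_density I a (fill_last I u) =
      c * ((\<Prod>i\<in>?J. u i powr (a i - 1)) * (1 - sum u ?J) powr (a ?m - 1))" for u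
  proof -
    have "(\<Prod>i\<in>I. fill_last I u i powr (a i - 1)) =
       fill_last I u ?m powr (a ?m - 1) * (\<Prod>i\<in>?J. fill_last I u i powr (a i - 1))"
      using I(1) m by (rule prod.remove)
    also have "(\<Prod>i\<in>?J. fill_last I u i powr (a i - 1)) = (\<Prod>i\<in>?J. u i powr (a i - 1))"
      by (intro prod.cong) (auto simp: fill_last_def)
    finally show ?thesis by (simp add: dirichlet_density_def c_def fill_last_def)
  qed
  have meas0: "(\<lambda>u. ennreal ((\<Prod>i\<in>?J. u i powr (a i - 1)) * (1 - sum u ?J) powr (a ?m - 1)))
       \<in> borel_measurable (PiM ?J (\<lambda>_. lborel))"
    by (rule measurable_powr_product)
  have meas: "(\<lambda>u. ennreal (dirichlet_density I a (fill_last I u))) \<in> borel_measurable ?R"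
    unfolding dens using c
    by (intro measurable_restrict_space1) (simp add: ennreal_mult' meas0)
  have "(\<integral>\<^sup>+u. ennreal (dirichlet_density I a (fill_last I u)) \<partial>?R) =
     (\<integral>\<^sup>+u. ennreal c * (ennreal ((\<Prod>i\<in>?J. u i powr (a i - 1)) * (1 - sum u ?J) powr (a ?m - 1)) *
             indicator {u. (\<forall>i\<in>?J. 0 < u i) \<and> sum u ?J < 1} u) \<partial>PiM ?J (\<lambda>_. lborel))"
    unfolding nn_integral_restrict_space[OF corner]
    using c by (intro nn_integral_cong)
      (auto simp: dens ennreal_mult' indicator_def open_corner_def space_PiM PiE_iff mult.assoc)
  also have "\<dots> = ennreal c * (\<integral>\<^sup>+u. ennreal ((\<Prod>i\<in>?J. u i powr (a i - 1)) * (1 - sum u ?J) powr (a ?m - 1)) *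
             indicator {u. (\<forall>i\<in>?J. 0 < u i) \<and> sum u ?J < 1} u \<partial>PiM ?J (\<lambda>_. lborel))"
  proof (rule nn_integral_cmult)
    have [measurable]: "Measurable.pred (PiM ?J (\<lambda>_. lborel)) (\<lambda>u. (\<forall>i\<in>?J. 0 < u i) \<and> sum u ?J < (1::real))"
        using fin by (rule measurable_positive_sum_less)
    show "(\<lambda>u. ennreal ((\<Prod>i\<in>?J. u i powr (a i - 1)) * (1 - sum u ?J) powr (a ?m - 1)) *
             indicator {u. (\<forall>i\<in>?J. 0 < u i) \<and> sum u ?J < 1} u) \<in> borel_measurable (PiM ?J (\<lambda>_. lborel))"
      by (intro borel_measurable_times_ennreal borel_measurable_indicator' meas0) (measurable)
  qed
  also have "\<dots> = ennreal c * ennreal (1 powr (sum a ?J + a ?m - 1) *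
      ((\<Prod>i\<in>?J. Gamma (a i)) * Gamma (a ?m) / Gamma (sum a ?J + a ?m)))"
    using fin aJ a[OF m] by (subst nn_integral_dirichlet) auto
  also have "\<dots> = ennreal c * ennreal ((\<Prod>i\<in>I. Gamma (a i)) / Gamma (sum a I))"
    using I m by (simp add: sum.remove[of I ?m] prod.remove[of I ?m] add.commute mult.commute)
  also have "\<dots> = 1"
    using pos c by (subst ennreal_mult'[symmetric]) (auto simp: c_def)
  finally have one: "(\<integral>\<^sup>+u. ennreal (dirichlet_density I a (fill_last I u)) \<partial>?R) = 1" .
  have "prob_space (density ?R (\<lambda>u. ennreal (dirichlet_density I a (fill_last I u))))"
  proof
    show "emeasure (density ?R (\<lambda>u. ennreal (dirichlet_density I a (fill_last I u))))
       (space (density ?R (\<lambda>u. ennreal (dirichlet_density I a (fill_last I u))))) = 1"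
      using meas by (subst emeasure_density)
        (auto simp: one[symmetric] intro!: nn_integral_cong)
  qed
  then show ?thesis
    unfolding dirichlet_def by (rule prob_space.prob_space_distr) simp
qed

lemma emeasure_jump_measure:
  assumes "finite I"
  shows "emeasure (jump_measure I x p) A = (\<Sum>i\<in>{i\<in>I. x + i \<in> A}. ennreal (p i))"
proof -
  have "emeasure (jump_measure I x p) A = emeasure (point_measure I (\<lambda>i. ennreal (p i))) ((\<lambda>i. x + i) -` A \<inter> I)"
    unfolding jump_measure_def by (subst emeasure_distr) (auto simp: space_point_measure sets_point_measure)
  also have "(\<lambda>i. x + i) -` A \<inter> I = {i\<in>I. x + i \<in> A}" by auto
  finally show ?thesis using assms by (simp add: emeasure_point_measure_finite)
qed

lemma measure_jump_measure:
  assumes "finite I" "p \<in> open_simplex I"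
  shows "measure (jump_measure I x p) {x + i} = (if i \<in> I then p i else 0)"
proof -
  have "{j\<in>I. x + j \<in> {x + i}} = (if i \<in> I then {i} else {})" by auto
  then have "emeasure (jump_measure I x p) {x + i} = ennreal (if i \<in> I then p i else 0)"
    by (simp add: emeasure_jump_measure[OF assms(1)])
  then show ?thesis
    using assms(2) by (auto simp: measure_def open_simplex_def PiE_iff intro!: enn2real_ennreal less_imp_le)
qed

lemma measurable_jump_measure:
  assumes "finite I"
  shows "jump_measure I x \<in> restrict_space (PiM I (\<lambda>_. borel)) (open_simplex I) \<rightarrow>\<^sub>M
           prob_algebra (count_space UNIV)"
proof (rule measurable_prob_algebra_generated[where G = "Pow UNIV" and \<Omega> = UNIV])
  show "sets (count_space UNIV) = sigma_sets UNIV (Pow (UNIV :: int set))"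
    using sigma_algebra.sigma_sets_eq[OF sigma_algebra_Pow, of "UNIV :: int set"] by simp
  fix p assume "p \<in> space (restrict_space (PiM I (\<lambda>_. borel)) (open_simplex I))"
  then have p: "p \<in> open_simplex I" by (simp add: space_restrict_space)
  show "prob_space (jump_measure I x p)"
  proof
    have "(\<Sum>i\<in>I. ennreal (p i)) = ennreal (\<Sum>i\<in>I. p i)"
      using p by (intro sum_ennreal) (auto simp: open_simplex_def PiE_iff intro: less_imp_le)
    then show "emeasure (jump_measure I x p) (space (jump_measure I x p)) = 1"
      using p by (simp add: emeasure_jump_measure[OF assms] jump_measure_def[THEN arg_cong[of _ _ space]] open_simplex_def)
  qed
next
  fix A :: "int set"
  have "(\<lambda>p. \<Sum>i\<in>{i\<in>I. x + i \<in> A}. ennreal (p i)) \<in> borel_measurable (PiM I (\<lambda>_. borel))"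
    by (intro borel_measurable_sum measurable_compose[OF _ measurable_ennreal]) 
      (auto intro!: measurable_component_singleton)
  then show "(\<lambda>p. emeasure (jump_measure I x p) A) \<in>
      borel_measurable (restrict_space (PiM I (\<lambda>_. borel)) (open_simplex I))"
    unfolding emeasure_jump_measure[OF assms] by (rule measurable_restrict_space1)
qed (auto simp: Int_stable_def jump_measure_def)

lemma dirichlet_environment_in_prob_algebra:
  assumes "\<alpha> (- int L) > 0"
  shows "dirichlet_environment L R \<alpha> \<in> space (prob_algebra environments)"
proof -
  let ?I = "jump_range L R \<alpha>"
  have I: "finite ?I" "?I \<noteq> {}" "\<And>i. i \<in> ?I \<Longrightarrow> \<alpha> i > 0"
    using assms by (auto simp: jump_range_def intro: finite_subset[of _ "{- int L..int R}"])
  have "prob_space (distr (dirichlet ?I \<alpha>) (prob_algebra (count_space UNIV)) (jump_measure ?I x))" for x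
  proof (rule prob_space.prob_space_distr[OF prob_space_dirichlet[OF I]])
    have "sets (dirichlet ?I \<alpha>) = sets (restrict_space (PiM ?I (\<lambda>_. borel)) (open_simplex ?I))"
      by (simp add: dirichlet_def)
    from measurable_cong_sets[OF this refl] measurable_jump_measure[OF I(1), of x]
    show "jump_measure ?I x \<in> dirichlet ?I \<alpha> \<rightarrow>\<^sub>M prob_algebra (count_space UNIV)" by blast
  qed
  then have "prob_space (dirichlet_environment L R \<alpha>)"
    unfolding dirichlet_environment_def by (rule prob_space_PiM)
  moreover have "sets (dirichlet_environment L R \<alpha>) = sets environments"
    unfolding dirichlet_environment_def environments_def by (intro sets_PiM_cong) auto
  ultimately show ?thesis by (simp add: space_prob_algebra)
qed

end

theory Submission
  imports Defs
begin

text \<open>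
  Throughout, \<open>s\<close> is \<open>1\<close> or \<open>-1\<close>, and statements about \<open>s X\<close> treat both directions at once. The proof
  combines a dichotomy that holds in every stationary, elliptic environment with independent sites
  and bounded jumps, and an exact identity for Dirichlet environments.

  \<^bold>\<open>Dichotomy\<close> (\<open>side_dichotomy\<close>). Either \<open>s X\<close> tends to infinity almost surely, or \<open>s X\<close> is almost
  surely unbounded below. The event that, from some site, the walk can stay forever on the \<open>s\<close>-side
  of its starting point has probability \<open>0\<close> or \<open>1\<close> by Kolmogorov's law (\<open>minimum_zero_one\<close>). If the
  probability is \<open>0\<close>, then \<open>s X\<close> never has a minimum. If it is \<open>1\<close>, then almost every environment
  gives positive probability \<open>f\<close> to the event that \<open>s X\<close> is bounded below. A walk for which it is
  not meets every window of sites at distance \<open>N\<close> behind the origin; by stationarity \<open>f\<close> is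
  typically not small there, so if \<open>f < 1\<close> had positive probability, the walk would reach distance \<open>N\<close>
  behind the origin and still be bounded with a probability that does not vanish as \<open>N\<close> grows. This
  is absurd, so \<open>f = 1\<close> (\<open>bounded_side_certain\<close>). As the walk does not stay in a finite interval,
  \<open>s X\<close> is then unbounded above, and a similar argument with windows ahead of the origin shows that
  \<open>s X\<close> tends to infinity (\<open>bounded_side_imp_transient\<close>).

  \<^bold>\<open>Identity\<close> (\<open>escape_balance\<close>). By independence and the moments of the Dirichlet distribution, the
  annealed probability of a path is a product of rising factorials that depends only on how often
  each edge and each site is used. Let the walk enter the half-line \<open>s x \<ge> 1\<close> from each outer
  site by each possible jump \<open>i\<close>, with weight \<open>\<alpha>\<^sub>i\<close>. The paths that leave the half-line again are in bijection,
  by reversal of time combined with \<open>x \<mapsto> -x\<close>, with those of the opposite half-line, and the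
  bijection preserves the annealed weight including the first and the last jump
  (\<open>flux_hitting_reflect\<close>). The entering flux is \<open>\<Sum> \<alpha>\<^sub>i max 0 (s i)\<close>, so the fluxes of walks that
  never leave the positive and the negative half-line differ by exactly \<open>\<kappa>\<^sub>1\<close>.

  \<^bold>\<open>Conclusion.\<close> If \<open>s \<kappa>\<^sub>1 > 0\<close>, the flux that escapes in direction \<open>s\<close> is positive, which excludes
  the second alternative of the dichotomy. If \<open>\<kappa>\<^sub>1 = 0\<close>, the two escaping fluxes are equal; they cannot
  both be positive, since the walk would tend to both infinities, so both vanish and the second
  alternative holds in both directions.
\<close>

section \<open>Trajectories and the first step of the walk\<close>

lemma space_trajectories [simp]: "space trajectories = UNIV"
  by (simp add: trajectories_def space_PiM)

lemma measurable_coordinate [measurable]: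
  "(\<lambda>X. X n) \<in> trajectories \<rightarrow>\<^sub>M count_space UNIV"
  unfolding trajectories_def by measurable

lemma measurable_case_nat_trajectory [measurable]: "case_nat x \<in> trajectories \<rightarrow>\<^sub>M trajectories"
proof -
  have "case_nat x \<in> trajectories \<rightarrow>\<^sub>M PiM UNIV (\<lambda>_. count_space UNIV)"
  proof (rule measurable_PiM_single')
    fix i :: nat
    show "(\<lambda>X. case_nat x X i) \<in> trajectories \<rightarrow>\<^sub>M count_space UNIV"
      by (cases i) simp_all
  qed simp
  then show ?thesis by (simp add: trajectories_def)
qed

lemma sets_trajectoriesI: "Measurable.pred trajectories P \<Longrightarrow> {X. P X} \<in> sets trajectories"
  by (simp add: pred_def)

lemma Int_stable_prefixes:
  "Int_stable (insert {} (range (\<lambda>xs. {X::nat \<Rightarrow> int. \<forall>k<length xs. X k = xs ! k})))"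
    (is "Int_stable ?G")
proof -
  let ?c = "\<lambda>xs. {X::nat \<Rightarrow> int. \<forall>k<length xs. X k = xs ! k}"
  have *: "?c xs \<inter> ?c ys \<in> ?G" if "length xs \<le> length ys" for xs ys
  proof (cases "\<forall>k<length xs. xs ! k = ys ! k")
    case True
    then have "?c xs \<inter> ?c ys = ?c ys" using that by force
    then show ?thesis by simp
  next
    case False
    then have "?c xs \<inter> ?c ys = {}" using that by force
    then show ?thesis by simp
  qed
  have "?c xs \<inter> ?c ys \<in> ?G" for xs ys
    using *[of xs ys] *[of ys xs] by (cases "length xs \<le> length ys") (auto simp: Int_commute)
  then show ?thesis by (auto simp: Int_stable_def)
qed

text \<open>
  The prefix events are stable under intersection and generate the sigma-algebra.
\<close>

lemma trajectory_measure_eqI: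
  assumes "prob_space M" "sets M = sets trajectories" "sets N = sets trajectories"
    and "\<And>xs. emeasure M {X. \<forall>k<length xs. X k = xs ! k} = emeasure N {X. \<forall>k<length xs. X k = xs ! k}"
  shows "M = N"
proof (rule measure_eqI_generator_eq[OF Int_stable_prefixes, where A = "\<lambda>_. UNIV" and \<Omega> = UNIV])
  interpret prob_space M by fact
  show "emeasure M UNIV \<noteq> \<infinity>" by simp
  show "range (\<lambda>_::nat. UNIV) \<subseteq> insert {} (range (\<lambda>xs. {X::nat \<Rightarrow> int. \<forall>k<length xs. X k = xs ! k}))"
    by (auto intro!: image_eqI[where x = "[]"])
qed (use assms sets_trajectories_prefix in auto)

lemma prefix_set [measurable]: "{X. \<forall>k<length xs. X k = xs ! k} \<in> sets trajectories"
  by (rule sets_trajectoriesI) measurable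

lemma environment_site:
  assumes "\<omega> \<in> space environments"
  shows "prob_space (\<omega> x)" "sets (\<omega> x) = UNIV" "space (\<omega> x) = UNIV" 
    "\<omega> x \<in> space (prob_algebra (count_space UNIV))"
proof -
  show 1: "\<omega> x \<in> space (prob_algebra (count_space UNIV))"
    using assms by (auto simp: environments_def space_PiM)
  then show "prob_space (\<omega> x)" "sets (\<omega> x) = UNIV"  by (auto simp: space_prob_algebra)
  then show "space (\<omega> x) = UNIV" by (metis sets_eq_imp_space_eq sets_count_space Pow_UNIV space_count_space)
qed

lemma walk_prob_space:
  assumes "\<omega> \<in> space environments"
  shows "space (quenched_law \<omega> x) = UNIV" "measure (quenched_law \<omega> x) UNIV = 1"
  using prob_space.prob_space[OF prob_space_quenched_law[OF assms]]
    sets_eq_imp_space_eq[OF sets_quenched_law[OF assms]] by simp_all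

text \<open>
  The Markov property at time one. It suffices for the whole development: properties at later times
  are obtained by induction on time, peeling off the first step.
\<close>

lemma quenched_law_step_nn_integral:
  assumes \<omega>: "\<omega> \<in> space environments" and A: "A \<in> sets trajectories"
  shows "emeasure (quenched_law \<omega> x) A =
    (\<integral>\<^sup>+y. emeasure (quenched_law \<omega> y) {X. case_nat x X \<in> A} \<partial>\<omega> x)"
proof -
  let ?K = "\<lambda>y. distr (quenched_law \<omega> y) trajectories (case_nat x)"
  have K: "?K \<in> count_space UNIV \<rightarrow>\<^sub>M prob_algebra trajectories"
    using prob_space_quenched_law[OF \<omega>] sets_quenched_law[OF \<omega>]
    by (auto simp: space_prob_algebra intro!: prob_space.prob_space_distr
        simp: measurable_cong_sets[OF sets_quenched_law[OF \<omega>] refl])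
  note site = environment_site[OF \<omega>]
  have one: "emeasure (quenched_law \<omega> y) UNIV = 1" for y
    using prob_space.emeasure_space_1[OF prob_space_quenched_law[OF \<omega>, of y]]
    by (simp add: walk_prob_space[OF \<omega>])
  have em: "emeasure (\<omega> x \<bind> ?K) A = (\<integral>\<^sup>+y. emeasure (quenched_law \<omega> y) {X. case_nat x X \<in> A} \<partial>\<omega> x)"
    if A: "A \<in> sets trajectories" for A
  proof -
    have "emeasure (\<omega> x \<bind> ?K) A = (\<integral>\<^sup>+y. emeasure (?K y) A \<partial>\<omega> x)"
      by (rule emeasure_bind_prob_algebra[OF site(4) K A])
    also have "\<dots> = (\<integral>\<^sup>+y. emeasure (quenched_law \<omega> y) {X. case_nat x X \<in> A} \<partial>\<omega> x)"
      using A by (intro nn_integral_cong, subst emeasure_distr)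
        (auto simp: measurable_cong_sets[OF sets_quenched_law[OF \<omega>] refl] vimage_def walk_prob_space[OF \<omega>])
    finally show ?thesis .
  qed
  have "quenched_law \<omega> x = \<omega> x \<bind> ?K"
  proof (rule trajectory_measure_eqI[OF prob_space_quenched_law[OF \<omega>] sets_quenched_law[OF \<omega>]])
    show "sets (\<omega> x \<bind> ?K) = sets trajectories"
      by (rule sets_bind) (auto simp: site)
    fix xs :: "int list"
    have "emeasure (quenched_law \<omega> x) {X. \<forall>k<length xs. X k = xs ! k} =
      (\<integral>\<^sup>+y. emeasure (quenched_law \<omega> y) {X. \<forall>k<length xs. case_nat x X k = xs ! k} \<partial>\<omega> x)"
    proof (cases xs)
      case Nil
      then show ?thesis
        using one prob_space.emeasure_space_1[OF site(1)] by (simp add: Nil site)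
    next
      case (Cons z zs)
      have eq: "{X. \<forall>k<length xs. case_nat x X k = xs ! k} =
          (if z = x then {X. \<forall>k<length zs. X k = zs ! k} else {})"
        by (auto simp: Cons less_Suc_eq_0_disj)
      show ?thesis
      proof (cases "z = x")
        case False
        have "emeasure (quenched_law \<omega> x) {X. \<forall>k<length xs. X k = xs ! k} = 0"
          unfolding quenched_law_prefix[OF \<omega>, of _ _ "\<lambda>k. xs ! k"]
          using False by (simp add: Cons prod.lessThan_Suc_shift step_kernel_def del: prod.lessThan_Suc)
        then show ?thesis using False by (simp only: eq) simp
      next
        case True
        show ?thesis
        proof (cases zs)
          case Nil
          have "emeasure (quenched_law \<omega> x) {X. \<forall>k<length xs. X k = xs ! k} = 1"
            unfolding quenched_law_prefix[OF \<omega>, of _ _ "\<lambda>k. xs ! k"]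
            using True by (simp add: Nil \<open>xs = z # zs\<close> step_kernel_def)
          then show ?thesis using True Nil one
            prob_space.emeasure_space_1[OF site(1)] by (simp only: eq) (simp add: site)
        next
          case (Cons u us)
          define c where "c = (\<Prod>k<length us. emeasure (\<omega> (zs ! k)) {zs ! Suc k})"
          have q: "emeasure (quenched_law \<omega> y) {X. \<forall>k<length zs. X k = zs ! k} = indicator {u} y * c" for y
            unfolding quenched_law_prefix[OF \<omega>, of _ _ "\<lambda>k. zs ! k"]
            by (simp add: Cons prod.lessThan_Suc_shift step_kernel_def c_def indicator_def del: prod.lessThan_Suc)
          have "(\<integral>\<^sup>+y. indicator {u} y * c \<partial>\<omega> x) = emeasure (\<omega> x) {u} * c"
            by (subst nn_integral_multc) (auto simp: site measurable_cong_sets[OF site(2)[THEN trans, of "sets (count_space UNIV)"] refl])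
          moreover have "emeasure (quenched_law \<omega> x) {X. \<forall>k<length xs. X k = xs ! k} = emeasure (\<omega> x) {u} * c"
            unfolding quenched_law_prefix[OF \<omega>, of _ _ "\<lambda>k. xs ! k"]
            using True by (simp add: \<open>xs = z # zs\<close> Cons prod.lessThan_Suc_shift step_kernel_def c_def del: prod.lessThan_Suc)
          ultimately show ?thesis by (simp only: eq True simp_thms if_True q)
        qed
      qed
    qed
    then show "emeasure (quenched_law \<omega> x) {X. \<forall>k<length xs. X k = xs ! k} =
        emeasure (\<omega> x \<bind> ?K) {X. \<forall>k<length xs. X k = xs ! k}"
      by (simp add: em[OF prefix_set])
  qed
  then show ?thesis by (simp add: em[OF A])
qed


definition elliptic :: "int set \<Rightarrow> (int \<Rightarrow> int measure) \<Rightarrow> bool" where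
  "elliptic I \<omega> \<longleftrightarrow> \<omega> \<in> space environments \<and>
     (\<forall>x. (\<forall>i\<in>I. measure (\<omega> x) {x + i} > 0) \<and> (\<Sum>i\<in>I. measure (\<omega> x) {x + i}) = 1)"

lemma ellipticD:
  assumes "elliptic I \<omega>"
  shows "\<omega> \<in> space environments" "i \<in> I \<Longrightarrow> measure (\<omega> x) {x + i} > 0"
    "(\<Sum>i\<in>I. measure (\<omega> x) {x + i}) = 1"
  using assms by (auto simp: elliptic_def)

lemma quenched_law_step:
  assumes \<omega>: "elliptic I \<omega>" and I: "finite I" and A: "A \<in> sets trajectories"
  shows "measure (quenched_law \<omega> x) A =
    (\<Sum>i\<in>I. measure (\<omega> x) {x + i} * measure (quenched_law \<omega> (x + i)) {X. case_nat x X \<in> A})"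
proof -
  note \<omega>' = ellipticD(1)[OF \<omega>]
  note site = environment_site[OF \<omega>']
  interpret prob_space "\<omega> x" by (rule site)
  let ?S = "(\<lambda>i. x + i) ` I"
  let ?f = "\<lambda>y. measure (quenched_law \<omega> y) {X. case_nat x X \<in> A}"
  have meas: "f \<in> borel_measurable (\<omega> x)" for f :: "int \<Rightarrow> ennreal"
    by (subst measurable_cong_sets[of _ "count_space UNIV" _ borel]) (simp_all add: site)
  have em: "emeasure (quenched_law \<omega> x) A = (\<integral>\<^sup>+y. ennreal (?f y) \<partial>\<omega> x)"
    unfolding quenched_law_step_nn_integral[OF \<omega>' A]
    by (intro nn_integral_cong finite_measure.emeasure_eq_measure prob_space.finite_measure
        prob_space_quenched_law[OF \<omega>'])
  have fin: "finite ?S" using I by simp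
  have "prob ?S = (\<Sum>i\<in>I. prob {x + i})"
  proof -
    have "prob ?S = (\<Sum>y\<in>?S. prob {y})"
      using fin by (intro finite_measure_eq_sum_singleton) (auto simp: site)
    then show ?thesis by (simp add: sum.reindex inj_on_def)
  qed
  then have "AE y in \<omega> x. y \<in> ?S"
    using ellipticD(3)[OF \<omega>] prob_eq_1[of ?S] by (simp add: site)
  then have "(\<integral>\<^sup>+y. ennreal (?f y) \<partial>\<omega> x) = (\<integral>\<^sup>+y. (\<Sum>z\<in>?S. ennreal (?f z) * indicator {z} y) \<partial>\<omega> x)"
    using fin by (intro nn_integral_cong_AE) (auto elim!: eventually_mono simp: indicator_def if_distrib sum.delta cong: if_cong)
  also have "\<dots> = (\<Sum>z\<in>?S. ennreal (?f z) * emeasure (\<omega> x) {z})"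
    by (subst nn_integral_sum) (auto simp: nn_integral_cmult_indicator site meas)
  also have "\<dots> = (\<Sum>i\<in>I. ennreal (?f (x + i)) * emeasure (\<omega> x) {x + i})"
    by (simp add: sum.reindex inj_on_def)
  also have "\<dots> = ennreal (\<Sum>i\<in>I. prob {x + i} * ?f (x + i))"
    by (simp add: emeasure_eq_measure ennreal_mult''[symmetric] mult.commute sum_ennreal)
  finally show ?thesis using em
    by (intro measure_eq_emeasure_eq_ennreal) (auto intro!: sum_nonneg)
qed

lemma AE_start:
  assumes \<omega>: "\<omega> \<in> space environments"
  shows "AE X in quenched_law \<omega> x. X 0 = x"
proof -
  interpret prob_space "quenched_law \<omega> x" by (rule prob_space_quenched_law[OF \<omega>])
  have "prob {X. \<forall>k\<le>0. X k = (\<lambda>_. x) k} = 1"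
    by (subst quenched_law_cylinder[OF \<omega>]) simp
  then have "prob {X. X 0 = x} = 1" by simp
  then show ?thesis
    using prob_eq_1[of "{X. X 0 = x}"] sets_trajectoriesI[of "\<lambda>X. X 0 = x"] by (simp add: sets_quenched_law[OF \<omega>])
qed

section \<open>Irreducible elliptic environments\<close>

text \<open>
  Insensitivity to a new first step makes the probability of such an event a harmonic function of
  the starting point.
\<close>

definition shift_invariant :: "(nat \<Rightarrow> int) set \<Rightarrow> bool" where
  "shift_invariant A \<longleftrightarrow> A \<in> sets trajectories \<and> (\<forall>x X. case_nat x X \<in> A \<longleftrightarrow> X \<in> A)"

lemma ex_le_Suc: "(\<exists>k\<le>Suc n. Q k) \<longleftrightarrow> Q 0 \<or> (\<exists>k\<le>n. Q (Suc k))"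
  by (simp only: less_Suc_eq_le[symmetric] Ex_less_Suc2)

lemma all_ge_Suc: "(\<forall>n\<ge>Suc m. Q n) \<longleftrightarrow> (\<forall>n\<ge>m. Q (Suc n))"
  by (metis Suc_le_D Suc_le_mono)

locale jump_set =
  fixes I :: "int set" and B :: int
  assumes finite_jumps: "finite I"
    and jump_bound: "i \<in> I \<Longrightarrow> \<bar>i\<bar> \<le> B"
    and jump_pos: "\<exists>i\<in>I. i > 0" and jump_neg: "\<exists>i\<in>I. i < 0"
    and jump_Gcd: "Gcd I = 1"
begin

text \<open>
  Jumps of both signs turn the additive semigroup they generate into a group, and the subgroups of
  the integers are generated by a gcd.
\<close>

lemma generates_int:
  fixes S :: "int set"
  assumes "I \<subseteq> S" and add: "\<And>a b. a \<in> S \<Longrightarrow> b \<in> S \<Longrightarrow> a + b \<in> S"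
  shows "S = UNIV"
proof -
  have mult: "int (Suc k) * d \<in> S" if "d \<in> S" for k d
  proof (induction k)
    case (Suc k)
    then have "d + int (Suc k) * d \<in> S" using that add by blast
    then show ?case by (simp add: algebra_simps)
  qed (use that in simp)
  have mult': "k * d \<in> S" if "d \<in> S" "k > 0" for k d
    using mult[OF that(1), of "nat (k - 1)"] that(2) by (simp add: algebra_simps)
  obtain p q where p: "p \<in> S" "p > 0" and q: "q \<in> S" "q < 0"
    using jump_pos jump_neg assms(1) by blast
  have zero: "0 \<in> S"
    using add[OF mult'[OF p(1), of "-q"] mult'[OF q(1), of p]] p q by simp
  have mult0: "k * d \<in> S" if "d \<in> S" "k \<ge> 0" for k d
    using mult'[OF that(1), of k] zero that(2) by (cases "k = 0") auto
  have minus: "- d \<in> S" if d: "d \<in> S" for d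
  proof (cases "d \<ge> 0")
    case True
    \<comment> \<open>the inverse of \<open>d\<close> as a non-negative combination of \<open>d\<close> and of a generator of opposite sign\<close>
    have "(- q - 1) * d + d * q \<in> S" using q True by (intro add mult0 d q) auto
    then show ?thesis by (simp add: algebra_simps)
  next
    case False
    have "(p - 1) * d + (- d) * p \<in> S" using p False by (intro add mult0 d p) auto
    then show ?thesis by (simp add: algebra_simps)
  qed
  have multZ: "k * d \<in> S" if "d \<in> S" for k d
  proof (cases "k \<ge> 0")
    case False
    then have "(- k) * d \<in> S" using mult0[OF that, of "- k"] by simp
    from minus[OF this] show ?thesis by simp
  qed (use mult0[OF that] in simp)
  define g where "g = (LEAST n::nat. n > 0 \<and> int n \<in> S)"
  have g: "g > 0 \<and> int g \<in> S"
    unfolding g_def using p by (intro LeastI[of "\<lambda>n. n > 0 \<and> int n \<in> S" "nat p"]) simp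
  have least: "n > 0 \<Longrightarrow> int n \<in> S \<Longrightarrow> g \<le> n" for n
    unfolding g_def using Least_le[of "\<lambda>n. n > 0 \<and> int n \<in> S" n] by simp
  have "int g dvd d" if "d \<in> S" for d
  proof -
    have "d + (- (d div int g)) * int g \<in> S"
      by (rule add[OF that multZ]) (rule conjunct2[OF g])
    moreover have "d + (- (d div int g)) * int g = d mod int g"
      using div_mult_mod_eq[of d "int g"] by linarith
    ultimately have *: "d mod int g \<in> S" by (simp only:)
    have "0 \<le> d mod int g" "d mod int g < int g" using g by simp_all
    moreover have "\<not> d mod int g > 0"
    proof
      assume pos: "d mod int g > 0"
      then have "g \<le> nat (d mod int g)" using * by (intro least) simp_all
      then show False using pos \<open>d mod int g < int g\<close> by linarith
    qed
    ultimately show ?thesis by (simp add: dvd_eq_mod_eq_0)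
  qed
  then have "int g dvd Gcd I" using assms(1) by (intro Gcd_greatest) auto
  then have "g = 1" using jump_Gcd by simp
  then have "1 \<in> S" using g by simp
  from multZ[OF this] have "k \<in> S" for k by simp
  then show ?thesis by blast
qed

lemma invariant_step:
  assumes "elliptic I \<omega>" "shift_invariant A"
  shows "measure (quenched_law \<omega> x) A =
    (\<Sum>i\<in>I. measure (\<omega> x) {x + i} * measure (quenched_law \<omega> (x + i)) A)"
  using quenched_law_step[OF assms(1) finite_jumps, of A x] assms(2) by (simp add: shift_invariant_def)

text \<open>
  Irreducibility in the form needed below: positivity of a harmonic function spreads backwards along
  each jump, and the jumps generate all integers.
\<close>

lemma invariant_pos_everywhere:
  assumes "elliptic I \<omega>" "shift_invariant A" "measure (quenched_law \<omega> y) A > 0"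
  shows "measure (quenched_law \<omega> x) A > 0"
proof -
  define S where "S = {d. \<forall>x. measure (quenched_law \<omega> (x + d)) A > 0 \<longrightarrow> measure (quenched_law \<omega> x) A > 0}"
  have "S = UNIV"
  proof (rule generates_int)
    show "I \<subseteq> S"
    proof
      fix i assume i: "i \<in> I"
      have "0 < measure (quenched_law \<omega> x) A" if "0 < measure (quenched_law \<omega> (x + i)) A" for x
      proof -
        have "0 < measure (\<omega> x) {x + i} * measure (quenched_law \<omega> (x + i)) A"
          using ellipticD(2)[OF assms(1) i] that by simp
        also have "\<dots> \<le> measure (quenched_law \<omega> x) A"
          unfolding invariant_step[OF assms(1,2), of x] using finite_jumps i
          by (intro member_le_sum[of i I "\<lambda>i. measure (\<omega> x) {x + i} * measure (quenched_law \<omega> (x + i)) A"]) auto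
        finally show ?thesis .
      qed
      then show "i \<in> S" by (simp add: S_def)
    qed
    fix a b assume a: "a \<in> S" and b: "b \<in> S"
    have "0 < measure (quenched_law \<omega> x) A" if "0 < measure (quenched_law \<omega> (x + (a + b))) A" for x
    proof -
      have "0 < measure (quenched_law \<omega> (x + a + b)) A" using that by (simp only: add.assoc)
      then have "0 < measure (quenched_law \<omega> (x + a)) A" using b by (simp add: S_def)
      then show ?thesis using a by (simp add: S_def)
    qed
    then show "a + b \<in> S" by (simp add: S_def)
  qed
  then have "y - x \<in> S" by simp
  then show ?thesis using assms(3) by (simp add: S_def)
qed

lemma AE_step:
  assumes \<omega>: "elliptic I \<omega>" and P: "Measurable.pred trajectories P"
    and step: "\<And>i. i \<in> I \<Longrightarrow> AE X in quenched_law \<omega> (x + i). P (case_nat x X)"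
  shows "AE X in quenched_law \<omega> x. P X"
proof -
  note \<omega>' = ellipticD(1)[OF \<omega>]
  have iff: "(AE X in quenched_law \<omega> y. Q X) \<longleftrightarrow> measure (quenched_law \<omega> y) {X. \<not> Q X} = 0"
    if "Measurable.pred trajectories Q" for Q y
  proof -
    interpret prob_space "quenched_law \<omega> y" by (rule prob_space_quenched_law[OF \<omega>'])
    have "{X. \<not> Q X} \<in> events"
      using sets_trajectoriesI[of "\<lambda>X. \<not> Q X"] that by (simp add: sets_quenched_law[OF \<omega>'])
    then show ?thesis using prob_eq_0[of "{X. \<not> Q X}"] by simp
  qed
  have "measure (quenched_law \<omega> (x + i)) {X. \<not> P (case_nat x X)} = 0" if "i \<in> I" for i
    using step[OF that] iff[of "\<lambda>X. P (case_nat x X)"] measurable_compose[OF measurable_case_nat_trajectory P] by simp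
  moreover have "{X. \<not> P X} \<in> sets trajectories" using P by (intro sets_trajectoriesI) simp
  ultimately show ?thesis
    using iff[OF P] quenched_law_step[OF \<omega> finite_jumps, of "{X. \<not> P X}" x] by simp
qed

text \<open>
  Maximum principle: the probability of staying in \<open>{a..b}\<close> is harmonic inside the interval and zero
  outside, so a positive maximum would propagate along a jump to the right until it leaves the
  interval.
\<close>

lemma leaves_interval:
  assumes \<omega>: "elliptic I \<omega>"
  shows "measure (quenched_law \<omega> x) {X. \<forall>n. a \<le> X n \<and> X n \<le> b} = 0"
proof (rule ccontr)
  define u where "u y = measure (quenched_law \<omega> y) {X. \<forall>n. a \<le> X n \<and> X n \<le> b}" for y
  have meas: "{X. \<forall>n. a \<le> X n \<and> X n \<le> b} \<in> sets trajectories"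
    by (rule sets_trajectoriesI) measurable
  have step: "u y = (if a \<le> y \<and> y \<le> b then (\<Sum>i\<in>I. measure (\<omega> y) {y + i} * u (y + i)) else 0)" for y
  proof -
    have "(\<forall>n. a \<le> case_nat y X n \<and> case_nat y X n \<le> b) \<longleftrightarrow> a \<le> y \<and> y \<le> b \<and> (\<forall>n. a \<le> X n \<and> X n \<le> b)" for X
      by (auto split: nat.splits)
    then have "{X. case_nat y X \<in> {X. \<forall>n. a \<le> X n \<and> X n \<le> b}} =
       (if a \<le> y \<and> y \<le> b then {X. \<forall>n. a \<le> X n \<and> X n \<le> b} else {})" by auto
    then show ?thesis using quenched_law_step[OF \<omega> finite_jumps meas, of y] by (simp add: u_def)
  qed
  assume "measure (quenched_law \<omega> x) {X. \<forall>n. a \<le> X n \<and> X n \<le> b} \<noteq> 0"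
  then have x: "u x > 0" unfolding u_def zero_less_measure_iff .
  then have x_in: "x \<in> {a..b}" using step[of x] by (auto split: if_splits)
  define M where "M = Max (u ` {a..b})"
  have M_ge: "u y \<le> M" for y
  proof (cases "y \<in> {a..b}")
    case False
    then have "u y = 0" using step[of y] by auto
    also have "0 \<le> u x" using x by simp
    also have "\<dots> \<le> M" unfolding M_def using x_in by (intro Max_ge) auto
    finally show ?thesis .
  qed (auto simp: M_def intro!: Max_ge)
  have M: "M > 0" using M_ge[of x] x by linarith
  obtain p where p: "p \<in> I" "p > 0" using jump_pos by blast
  \<comment> \<open>all values are at most \<open>M\<close>, so an average equal to \<open>M\<close> with positive weights forces equality\<close>
  have up: "u (y + p) = M" if y: "u y = M" for y
  proof -
    have *: "M = (\<Sum>i\<in>I. measure (\<omega> y) {y + i} * u (y + i))"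
      using step[of y] y M by (auto split: if_splits)
    have "(\<Sum>i\<in>I. measure (\<omega> y) {y + i} * (M - u (y + i))) = 0"
      unfolding right_diff_distrib sum_subtractf sum_distrib_right[symmetric] *[symmetric]
        ellipticD(3)[OF \<omega>] by simp
    then have "measure (\<omega> y) {y + p} * (M - u (y + p)) = 0"
      using p(1) M_ge finite_jumps by (subst (asm) sum_nonneg_eq_0_iff) auto
    then show ?thesis using ellipticD(2)[OF \<omega> p(1), of y] by simp
  qed
  have "M \<in> u ` {a..b}" unfolding M_def using x_in by (intro Max_in) auto
  then obtain z where z: "z \<in> {a..b}" "u z = M" by auto
  have "u (z + int k * p) = M" for k
  proof (induction k)
    case (Suc k)
    have "z + int (Suc k) * p = z + int k * p + p" by (simp add: algebra_simps)
    then show ?case using up[OF Suc.IH] by (simp only:)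
  qed (use z in simp)
  then have "u (z + int (nat (b - z + 1)) * p) = M" .
  moreover have "z + int (nat (b - z + 1)) * p > b"
  proof -
    have "(b - z + 1) * 1 \<le> (b - z + 1) * p" using z p by (intro mult_left_mono) auto
    moreover have "int (nat (b - z + 1)) = b - z + 1" using z(1) by simp
    ultimately show ?thesis by simp
  qed
  ultimately show False using step[of "z + int (nat (b - z + 1)) * p"] M by auto
qed

lemma AE_unbounded:
  assumes \<omega>: "elliptic I \<omega>"
  shows "AE X in quenched_law \<omega> x. \<forall>a b. \<exists>n. X n < a \<or> X n > b"
proof -
  note \<omega>' = ellipticD(1)[OF \<omega>]
  interpret prob_space "quenched_law \<omega> x" by (rule prob_space_quenched_law[OF \<omega>'])
  have "AE X in quenched_law \<omega> x. \<exists>n. X n < a \<or> X n > b" for a b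
  proof -
    have "{X. \<forall>n. a \<le> X n \<and> X n \<le> b} \<in> events"
      unfolding sets_quenched_law[OF \<omega>'] by (rule sets_trajectoriesI) measurable
    then have "AE X in quenched_law \<omega> x. X \<notin> {X. \<forall>n. a \<le> X n \<and> X n \<le> b}"
      using leaves_interval[OF \<omega>] prob_eq_0 by blast
    then show ?thesis by eventually_elim (auto simp: not_le)
  qed
  then show ?thesis by (simp add: AE_all_countable)
qed

text \<open>
  A form of the strong Markov property. Since jumps have size at most \<open>B\<close>, the walk enters the
  half-line \<open>s z \<ge> N\<close> through the window \<open>N \<le> s z < N + B\<close>, from where the event has probability at
  least \<open>m\<close>.
\<close>

lemma hitting_lower_bound:
  assumes \<omega>: "elliptic I \<omega>" and A: "shift_invariant A" and s: "\<bar>s\<bar> = 1" and m: "m \<ge> 0"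
    and window: "\<And>z. N \<le> s * z \<Longrightarrow> s * z < N + B \<Longrightarrow> m \<le> measure (quenched_law \<omega> z) A"
    and x: "s * x < N + B"
  shows "m * measure (quenched_law \<omega> x) {X. \<exists>k. s * X k \<ge> N} \<le>
         measure (quenched_law \<omega> x) (A \<inter> {X. \<exists>k. s * X k \<ge> N})"
proof -
  note \<omega>' = ellipticD(1)[OF \<omega>]
  define H where "H n = {X. \<exists>k\<le>n. s * X k \<ge> N}" for n :: nat
  have H: "H n \<in> sets trajectories" for n
    unfolding H_def by (rule sets_trajectoriesI) measurable
  have mem_H: "N \<le> s * X 0 \<Longrightarrow> X \<in> H n" "X \<in> H 0 \<Longrightarrow> N \<le> s * X 0" for X n
    by (auto simp: H_def)
  have A': "A \<in> sets trajectories" using A by (simp add: shift_invariant_def)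
  have bd: "s * (x + i) < N + B" if "s * x < N" "i \<in> I" for x i
    using jump_bound[OF that(2)] that(1) s by (auto simp: abs_if algebra_simps split: if_splits)
  have *: "m * measure (quenched_law \<omega> x) (H n) \<le> measure (quenched_law \<omega> x) (A \<inter> H n)"
    if "s * x < N + B" for n x
    using that
  proof (induction n arbitrary: x)
    case (0 x)
    interpret prob_space "quenched_law \<omega> x" by (rule prob_space_quenched_law[OF \<omega>'])
    have st: "AE X in quenched_law \<omega> x. X 0 = x" by (rule AE_start[OF \<omega>'])
    show ?case
    proof (cases "N \<le> s * x")
      case True
      have "prob (A \<inter> H 0) = prob A"
        by (rule measure_eq_AE) (use st True A' H in \<open>auto simp: sets_quenched_law[OF \<omega>'] dest: mem_H elim!: eventually_mono\<close>)
      moreover have "m * prob (H 0) \<le> m * 1" using m by (intro mult_left_mono) auto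
      ultimately show ?thesis using window[OF True 0] by linarith
    next
      case False
      have "prob (H 0) = prob {}"
        by (rule measure_eq_AE) (use st False H in \<open>auto simp: sets_quenched_law[OF \<omega>'] dest: mem_H elim!: eventually_mono\<close>)
      then show ?thesis by simp
    qed
  next
    case (Suc n x)
    show ?case
    proof (cases "N \<le> s * x")
      case True
      interpret prob_space "quenched_law \<omega> x" by (rule prob_space_quenched_law[OF \<omega>'])
      have st: "AE X in quenched_law \<omega> x. X 0 = x" by (rule AE_start[OF \<omega>'])
      have "prob (A \<inter> H (Suc n)) = prob A"
        by (rule measure_eq_AE) (use st True A' H in \<open>auto simp: sets_quenched_law[OF \<omega>'] dest: mem_H elim!: eventually_mono\<close>)
      moreover have "m * prob (H (Suc n)) \<le> m * 1" using m by (intro mult_left_mono) auto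
      ultimately show ?thesis using window[OF True Suc.prems] by linarith
    next
      case False
      have "(\<exists>k\<le>Suc n. N \<le> s * case_nat x X k) \<longleftrightarrow> (\<exists>k\<le>n. N \<le> s * X k)" for X
        using False by (simp only: ex_le_Suc nat.case) blast
      then have e: "{X. case_nat x X \<in> H (Suc n)} = H n" "{X. case_nat x X \<in> A \<inter> H (Suc n)} = A \<inter> H n"
        using A by (auto simp: H_def shift_invariant_def)
      have "m * measure (quenched_law \<omega> x) (H (Suc n)) = 
        (\<Sum>i\<in>I. measure (\<omega> x) {x + i} * (m * measure (quenched_law \<omega> (x + i)) (H n)))"
        unfolding quenched_law_step[OF \<omega> finite_jumps H] e by (simp add: sum_distrib_left mult_ac)
      also have "\<dots> \<le> (\<Sum>i\<in>I. measure (\<omega> x) {x + i} * (measure (quenched_law \<omega> (x + i)) (A \<inter> H n)))"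
        using False bd by (intro sum_mono mult_left_mono Suc.IH) auto
      also have "\<dots> = measure (quenched_law \<omega> x) (A \<inter> H (Suc n))"
        by (subst quenched_law_step[OF \<omega> finite_jumps]) (use A' H in \<open>auto simp: e[simplified]\<close>)
      finally show ?thesis .
    qed
  qed
  interpret prob_space "quenched_law \<omega> x" by (rule prob_space_quenched_law[OF \<omega>'])
  have U: "{X. \<exists>k. s * X k \<ge> N} = (\<Union>n. H n)" "A \<inter> {X. \<exists>k. s * X k \<ge> N} = (\<Union>n. A \<inter> H n)"
    by (auto simp: H_def)
  have inc: "incseq H" by (auto simp: incseq_def H_def intro: order_trans)
  have "(\<lambda>n. prob (H n)) \<longlonglongrightarrow> prob (\<Union>n. H n)"
    using H inc by (intro finite_Lim_measure_incseq) (auto simp: sets_quenched_law[OF \<omega>'])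
  moreover have "(\<lambda>n. prob (A \<inter> H n)) \<longlonglongrightarrow> prob (\<Union>n. A \<inter> H n)"
    using H A' inc by (intro finite_Lim_measure_incseq) (auto simp: sets_quenched_law[OF \<omega>'] incseq_def)
  ultimately show ?thesis unfolding U
    by (intro LIMSEQ_le[OF tendsto_mult_left]) (use *[OF x] in auto)
qed

text \<open>
  An integer sequence that is bounded below attains its minimum, and from the time at which it does
  so it stays above its current position.
\<close>

lemma no_minimum_imp_unbounded:
  assumes \<omega>: "elliptic I \<omega>"
    and no_min: "\<And>z. measure (quenched_law \<omega> z) {X. \<forall>n. s * X n \<ge> s * z} = 0"
    and s: "\<bar>s\<bar> = 1"
  shows "AE X in quenched_law \<omega> y. \<not> (\<exists>K. \<forall>n. s * X n \<ge> K)"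
proof -
  note \<omega>' = ellipticD(1)[OF \<omega>]
  have AE_min: "AE X in quenched_law \<omega> y. \<not> (\<forall>n. s * X n \<ge> s * y)" for y
  proof -
    interpret prob_space "quenched_law \<omega> y" by (rule prob_space_quenched_law[OF \<omega>'])
    have "{X. \<forall>n. s * X n \<ge> s * y} \<in> events"
      unfolding sets_quenched_law[OF \<omega>'] by (rule sets_trajectoriesI) measurable
    then show ?thesis using no_min[of y] prob_eq_0 by auto
  qed
  have visit: "AE X in quenched_law \<omega> y. \<not> (X m = z \<and> (\<forall>n\<ge>m. s * X n \<ge> s * z))" for m y z
  proof (induction m arbitrary: y)
    case (0 y)
    show ?case using AE_min[of y] AE_start[OF \<omega>', of y] by eventually_elim auto
  next
    case (Suc m y)
    show ?case
    proof (rule AE_step[OF \<omega>])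
      show "Measurable.pred trajectories (\<lambda>X. \<not> (X (Suc m) = z \<and> (\<forall>n\<ge>Suc m. s * X n \<ge> s * z)))"
        by measurable
      fix i assume "i \<in> I"
      show "AE X in quenched_law \<omega> (y + i).
        \<not> (case_nat y X (Suc m) = z \<and> (\<forall>n\<ge>Suc m. s * case_nat y X n \<ge> s * z))"
        using Suc.IH[of "y + i"] by eventually_elim (simp only: all_ge_Suc nat.case simp_thms)
    qed
  qed
  then have all: "AE X in quenched_law \<omega> y. \<forall>m z. \<not> (X m = z \<and> (\<forall>n\<ge>m. s * X n \<ge> s * z))"
    by (simp only: AE_all_countable) blast
  show ?thesis using all
  proof eventually_elim
    fix X assume X: "\<forall>m z. \<not> (X m = z \<and> (\<forall>n\<ge>m. s * X n \<ge> s * z))"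
    show "\<not> (\<exists>K. \<forall>n. s * X n \<ge> K)"
    proof
      assume "\<exists>K. \<forall>n. s * X n \<ge> K"
      then obtain K where K: "\<And>n. s * X n \<ge> K" by blast
      obtain m where m: "\<And>n. nat (s * X m - K) \<le> nat (s * X n - K)"
        using ex_has_least_nat[of "\<lambda>_. True" _ "\<lambda>n. nat (s * X n - K)"] by auto
      have "s * X m \<le> s * X n" for n using m[of n] K[of n] K[of m] by linarith
      then show False using X by blast
    qed
  qed
qed

end

section \<open>Stationary environments with independent sites\<close>

definition shift_environment :: "int \<Rightarrow> (int \<Rightarrow> int measure) \<Rightarrow> int \<Rightarrow> int measure" where
  "shift_environment d \<omega> = (\<lambda>x. distr (\<omega> (x + d)) (count_space UNIV) (\<lambda>y. y - d))"

lemma measurable_distr_prob_algebra: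
  assumes "f \<in> M \<rightarrow>\<^sub>M N"
  shows "(\<lambda>\<mu>. distr \<mu> N f) \<in> prob_algebra M \<rightarrow>\<^sub>M prob_algebra N"
  unfolding prob_algebra_def[of N]
proof (rule measurable_restrict_space2)
  show "(\<lambda>\<mu>. distr \<mu> N f) \<in> space (prob_algebra M) \<rightarrow> {M. prob_space M}"
    using assms by (auto simp: space_prob_algebra intro!: prob_space.prob_space_distr
      cong: measurable_cong_sets)
  show "(\<lambda>\<mu>. distr \<mu> N f) \<in> prob_algebra M \<rightarrow>\<^sub>M subprob_algebra N"
    using measurable_distr[OF assms] unfolding prob_algebra_def by (rule measurable_restrict_space1)
qed

lemma measurable_emeasure_prob_algebra [measurable]:
  "(\<lambda>\<mu>. emeasure \<mu> A) \<in> borel_measurable (prob_algebra (count_space (UNIV :: int set)))"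
  using measurable_emeasure_subprob_algebra[of A "count_space (UNIV :: int set)"]
  unfolding prob_algebra_def by (intro measurable_restrict_space1) simp

lemma measurable_measure_prob_algebra [measurable]:
  "(\<lambda>\<mu>. measure \<mu> A) \<in> borel_measurable (prob_algebra (count_space (UNIV :: int set)))"
  unfolding measure_def by measurable

lemma measurable_site [measurable]: "(\<lambda>\<omega>. \<omega> x) \<in> environments \<rightarrow>\<^sub>M prob_algebra (count_space UNIV)"
  unfolding environments_def by measurable

lemma measurable_environmentI:
  assumes "\<And>x. (\<lambda>\<omega>. F \<omega> x) \<in> M \<rightarrow>\<^sub>M prob_algebra (count_space UNIV)"
  shows "F \<in> M \<rightarrow>\<^sub>M environments"
  unfolding environments_def
  by (rule measurable_PiM_single') (use assms in \<open>auto simp: space_PiM dest: measurable_space\<close>)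

lemma measurable_shift_environment [measurable]: "shift_environment d \<in> environments \<rightarrow>\<^sub>M environments"
proof (rule measurable_environmentI)
  fix x
  show "(\<lambda>\<omega>. shift_environment d \<omega> x) \<in> environments \<rightarrow>\<^sub>M prob_algebra (count_space UNIV)"
    unfolding shift_environment_def
    by (rule measurable_compose[OF measurable_site measurable_distr_prob_algebra]) simp
qed

lemma measurable_walk_prob:
  assumes "A \<in> sets trajectories"
  shows "(\<lambda>\<omega>. measure (quenched_law \<omega> x) A) \<in> borel_measurable environments"
  using measurable_compose[OF measurable_prob_algebraD[OF measurable_quenched_law]
      measurable_measure_subprob_algebra[OF assms]] .

lemma measurable_shift_trajectory [measurable]:
  "(\<lambda>X n. X n + (d::int)) \<in> trajectories \<rightarrow>\<^sub>M trajectories"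
proof -
  have "(\<lambda>X n. X n + d) \<in> trajectories \<rightarrow>\<^sub>M PiM UNIV (\<lambda>_. count_space UNIV)"
    by (rule measurable_PiM_single') simp_all
  then show ?thesis by (simp add: trajectories_def)
qed

lemma quenched_law_shift_environment:
  assumes \<omega>: "\<omega> \<in> space environments"
  shows "quenched_law (shift_environment d \<omega>) x =
    distr (quenched_law \<omega> (x + d)) trajectories (\<lambda>X n. X n + (- d))"
proof -
  have \<omega>': "shift_environment d \<omega> \<in> space environments"
    using measurable_space[OF measurable_shift_environment \<omega>] .
  note [simp] = measurable_cong_sets[OF sets_quenched_law[OF \<omega>] refl]
  show ?thesis
  proof (rule trajectory_measure_eqI[OF prob_space_quenched_law[OF \<omega>'] sets_quenched_law[OF \<omega>']])
    fix xs
    let ?p = "\<lambda>k. xs ! k + d"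
    have "emeasure (distr (quenched_law \<omega> (x + d)) trajectories (\<lambda>X n. X n + (- d)))
        {X. \<forall>k<length xs. X k = xs ! k} = emeasure (quenched_law \<omega> (x + d)) {X. \<forall>k<length xs. X k = ?p k}"
      using measurable_shift_trajectory[of "- d"]
      by (subst emeasure_distr) (auto simp: walk_prob_space[OF \<omega>] vimage_def algebra_simps)
    also have "\<dots> = (\<Prod>k<length xs. emeasure (step_kernel \<omega> (x + d) k ?p) {?p k})"
      by (rule quenched_law_prefix[OF \<omega>])
    also have "\<dots> = (\<Prod>k<length xs. emeasure (step_kernel (shift_environment d \<omega>) x k ((!) xs)) {xs ! k})"
    proof (rule prod.cong[OF refl])
      fix k
      have "(\<lambda>y. y - d) -` {z} = {z + d}" for z by auto
      then have "emeasure (distr (\<omega> u) (count_space UNIV) (\<lambda>y. y - d)) {z} = emeasure (\<omega> u) {z + d}" for u z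
        by (subst emeasure_distr) (auto simp: environment_site[OF \<omega>] intro!: measurableI)
      then show "emeasure (step_kernel \<omega> (x + d) k ?p) {?p k} =
          emeasure (step_kernel (shift_environment d \<omega>) x k ((!) xs)) {xs ! k}"
        by (simp add: step_kernel_def shift_environment_def indicator_def)
    qed
    also have "\<dots> = emeasure (quenched_law (shift_environment d \<omega>) x) {X. \<forall>k<length xs. X k = xs ! k}"
      by (rule quenched_law_prefix[OF \<omega>', symmetric])
    finally show "emeasure (quenched_law (shift_environment d \<omega>) x) {X. \<forall>k<length xs. X k = xs ! k} =
       emeasure (distr (quenched_law \<omega> (x + d)) trajectories (\<lambda>X n. X n + (- d))) {X. \<forall>k<length xs. X k = xs ! k}" ..
  qed simp
qed

text \<open>
  Sites that the walk is not allowed to visit do not influence the probability. Hence the chance to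
  stay beyond a site is a function of the environment beyond that site.
\<close>

lemma staying_prob_cong:
  fixes s K :: int
  assumes \<omega>: "\<omega> \<in> space environments" "\<omega>' \<in> space environments"
    and eq: "\<And>y. s * y \<ge> K \<Longrightarrow> \<omega> y = \<omega>' y"
  shows "measure (quenched_law \<omega> x) {X. \<forall>n. s * X n \<ge> K} = measure (quenched_law \<omega>' x) {X. \<forall>n. s * X n \<ge> K}"
proof -
  define A where "A n = {X. \<forall>k\<le>n. s * X k \<ge> K}" for n :: nat
  have A: "A n \<in> sets trajectories" for n
    unfolding A_def by (rule sets_trajectoriesI) measurable
  have q: "prob_space (quenched_law \<omega> x)" "prob_space (quenched_law \<omega>' x)" for x
    by (simp_all add: prob_space_quenched_law \<omega>)
  have *: "emeasure (quenched_law \<omega> x) (A n) = emeasure (quenched_law \<omega>' x) (A n)" for n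
  proof (induction n arbitrary: x)
    case (0 x)
    have "emeasure (quenched_law \<omega> x) (A 0) = (if s * x \<ge> K then 1 else 0)"
      if "\<omega> \<in> space environments" for \<omega>
    proof -
      have "emeasure (quenched_law \<omega> x) (A 0) = emeasure (quenched_law \<omega> x) (if s * x \<ge> K then UNIV else {})"
        using A[of 0] sets.top[of trajectories]
        by (intro emeasure_eq_AE eventually_mono[OF AE_start[OF that, of x]])
          (auto simp: A_def sets_quenched_law[OF that])
      then show ?thesis
        using prob_space.emeasure_space_1[OF prob_space_quenched_law[OF that, of x]]
        by (simp add: walk_prob_space[OF that])
    qed
    then show ?case using \<omega> by simp
  next
    case (Suc n x)
    have "(\<forall>k\<le>Suc n. s * case_nat x X k \<ge> K) \<longleftrightarrow> s * x \<ge> K \<and> (\<forall>k\<le>n. s * X k \<ge> K)" for X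
      by (simp only: less_Suc_eq_le[symmetric] All_less_Suc2 nat.case)
    then have "{X. case_nat x X \<in> A (Suc n)} = (if s * x \<ge> K then A n else {})"
      by (auto simp: A_def)
    then show ?case
      using eq[of x] Suc.IH quenched_law_step_nn_integral[OF \<omega>(1) A, of x "Suc n"]
        quenched_law_step_nn_integral[OF \<omega>(2) A, of x "Suc n"] by auto
  qed
  have "(\<lambda>n. measure (quenched_law \<omega> x) (A n)) \<longlonglongrightarrow> measure (quenched_law \<omega> x) (\<Inter>n. A n)"
    if "\<omega> \<in> space environments" for \<omega>
    using A by (intro finite_measure.finite_Lim_measure_decseq prob_space.finite_measure
        prob_space_quenched_law[OF that]) (auto simp: sets_quenched_law[OF that] decseq_def A_def)
  from this[OF \<omega>(1)] this[OF \<omega>(2)]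
  have "measure (quenched_law \<omega> x) (\<Inter>n. A n) = measure (quenched_law \<omega>' x) (\<Inter>n. A n)"
    by (intro LIMSEQ_unique) (auto simp: measure_def *)
  also have "(\<Inter>n. A n) = {X. \<forall>n. s * X n \<ge> K}" by (auto simp: A_def)
  finally show ?thesis .
qed


text \<open>
  The dichotomy holds for every law of the environment with these properties; nothing in it refers
  to the Dirichlet distribution.
\<close>

locale stationary_environment = jump_set I B + prob_space E
  for I B and E :: "(int \<Rightarrow> int measure) measure" +
  assumes sets_E [measurable_cong]: "sets E = sets environments"
    and AE_elliptic: "AE \<omega> in E. elliptic I \<omega>"
    and indep_sites: "indep_vars (\<lambda>_. prob_algebra (count_space UNIV)) (\<lambda>x \<omega>. \<omega> x) UNIV"
    and stationary: "distr E environments (shift_environment d) = E"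
begin

lemma space_E: "space E = space environments"
  by (rule sets_eq_imp_space_eq[OF sets_E])

lemma E_prob_algebra: "E \<in> space (prob_algebra environments)"
  using prob_space_axioms sets_E by (simp add: space_prob_algebra)

lemma walk_prob_measurable [measurable]:
  "A \<in> sets trajectories \<Longrightarrow> (\<lambda>\<omega>. measure (quenched_law \<omega> x) A) \<in> borel_measurable E"
  using measurable_walk_prob by (simp add: measurable_cong_sets[OF sets_E refl])

lemma walk_prob_le_1: "\<omega> \<in> space environments \<Longrightarrow> measure (quenched_law \<omega> x) A \<le> 1"
  by (rule prob_space.prob_le_1[OF prob_space_quenched_law])

lemma walk_prob_integrable:
  assumes "A \<in> sets trajectories"
  shows "integrable E (\<lambda>\<omega>. measure (quenched_law \<omega> x) A)"
  by (rule integrable_const_bound[where B = 1])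
    (auto simp: walk_prob_measurable assms space_E walk_prob_le_1)

lemma annealed_prob:
  "A \<in> sets trajectories \<Longrightarrow> measure (annealed_law E x) A = (\<integral>\<omega>. measure (quenched_law \<omega> x) A \<partial>E)"
  by (rule annealed_law_eq[OF E_prob_algebra])

lemma AE_annealed_iff:
  assumes "Measurable.pred trajectories P"
  shows "(AE X in annealed_law E x. P X) \<longleftrightarrow> (AE \<omega> in E. AE X in quenched_law \<omega> x. P X)"
  unfolding annealed_law_def
  using measurable_prob_algebraD[OF measurable_quenched_law, of x] assms
  by (intro AE_bind[where B = trajectories]) (simp_all add: measurable_cong_sets[OF sets_E refl])

lemma annealed_law_space:
  shows "prob_space (annealed_law E x)" "sets (annealed_law E x) = sets trajectories"
proof -
  have "(\<lambda>\<omega>. quenched_law \<omega> x) \<in> E \<rightarrow>\<^sub>M prob_algebra trajectories"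
    using measurable_quenched_law by (simp add: measurable_cong_sets[OF sets_E refl])
  then have "annealed_law E x \<in> space (prob_algebra trajectories)"
    unfolding annealed_law_def using prob_space_axioms
    by (intro measurable_space[OF measurable_bind_prob_space[of "\<lambda>_. E" "count_space UNIV" E]])
      (auto simp: space_prob_algebra)
  then show "prob_space (annealed_law E x)" "sets (annealed_law E x) = sets trajectories"
    by (auto simp: space_prob_algebra)
qed

lemma distr_walk_prob_shift:
  assumes A: "A \<in> sets trajectories"
  shows "distr E borel (\<lambda>\<omega>. measure (quenched_law \<omega> (x + d)) {X. (\<lambda>n. X n - d) \<in> A}) =
         distr E borel (\<lambda>\<omega>. measure (quenched_law \<omega> x) A)"
proof -
  have "distr E borel (\<lambda>\<omega>. measure (quenched_law \<omega> x) A) =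
      distr (distr E environments (shift_environment d)) borel (\<lambda>\<omega>. measure (quenched_law \<omega> x) A)"
    by (simp only: stationary)
  also have "\<dots> = distr E borel (\<lambda>\<omega>. measure (quenched_law (shift_environment d \<omega>) x) A)"
    by (subst distr_distr) (auto simp: measurable_walk_prob A o_def measurable_cong_sets[OF sets_E refl])
  also have "\<dots> = distr E borel (\<lambda>\<omega>. measure (quenched_law \<omega> (x + d)) {X. (\<lambda>n. X n - d) \<in> A})"
  proof (rule distr_cong[OF refl refl])
    fix \<omega> assume "\<omega> \<in> space E"
    then have \<omega>: "\<omega> \<in> space environments" by (simp add: space_E)
    show "measure (quenched_law (shift_environment d \<omega>) x) A =
        measure (quenched_law \<omega> (x + d)) {X. (\<lambda>n. X n - d) \<in> A}"
      unfolding quenched_law_shift_environment[OF \<omega>]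
      using A measurable_shift_trajectory[of "- d"]
      by (subst measure_distr)
        (auto simp: walk_prob_space[OF \<omega>] vimage_def measurable_cong_sets[OF sets_quenched_law[OF \<omega>] refl])
  qed
  finally show ?thesis ..
qed

lemma sets_shifted:
  "A \<in> sets trajectories \<Longrightarrow> {X. (\<lambda>n. X n - d) \<in> A} \<in> sets trajectories"
  using measurable_sets[OF measurable_shift_trajectory[of "- d"]] by (simp add: vimage_def)

lemma expectation_walk_prob_shift:
  assumes A: "A \<in> sets trajectories"
  shows "(\<integral>\<omega>. measure (quenched_law \<omega> (x + d)) {X. (\<lambda>n. X n - d) \<in> A} \<partial>E) =
         (\<integral>\<omega>. measure (quenched_law \<omega> x) A \<partial>E)"
  using arg_cong[OF distr_walk_prob_shift[OF A, of x d], of "\<lambda>M. \<integral>t. t \<partial>M"]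
  by (subst (asm) (1 2) integral_distr) (auto intro!: walk_prob_measurable sets_shifted A)

lemma prob_walk_prob_shift:
  assumes A: "A \<in> sets trajectories" and P: "{t. P t} \<in> sets borel"
  shows "prob {\<omega>\<in>space E. P (measure (quenched_law \<omega> (x + d)) {X. (\<lambda>n. X n - d) \<in> A})} =
         prob {\<omega>\<in>space E. P (measure (quenched_law \<omega> x) A)}"
  using arg_cong[OF distr_walk_prob_shift[OF A, of x d], of "\<lambda>M. measure M {t. P t}"] P
  by (subst (asm) (1 2) measure_distr)
    (auto intro!: walk_prob_measurable sets_shifted A simp: vimage_def Int_def conj_commute)

end

section \<open>The zero-one law for minima\<close>

lemma (in prob_space) indep_sets_reindex:
  assumes "indep_sets F UNIV" and g: "inj g"
  shows "indep_sets (\<lambda>n. F (g n)) UNIV"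
proof (rule indep_setsI)
  show "F (g i) \<subseteq> events" for i
    using assms(1) by (auto simp: indep_sets_def)
  fix A J
  assume J: "J \<noteq> {}" "finite J" and A: "\<forall>j\<in>J. A j \<in> F (g j)"
  have "prob (\<Inter>y\<in>g ` J. A (inv g y)) = (\<Prod>y\<in>g ` J. prob (A (inv g y)))"
    using J A g by (intro indep_setsD[OF assms(1)]) auto
  then show "prob (\<Inter>j\<in>J. A j) = (\<Prod>j\<in>J. prob (A j))"
    using g by (simp add: prod.reindex inj_on_subset[OF g])
qed

text \<open>
  The parameter \<open>s\<close> is meant to be \<open>1\<close> or \<open>-1\<close>; for \<open>-1\<close> the events below describe sequences that
  are bounded above and sequences that tend to minus infinity.
\<close>

definition bounded_side :: "int \<Rightarrow> (nat \<Rightarrow> int) set" where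
  "bounded_side s = {X. \<exists>K. \<forall>n. s * X n \<ge> K}"

definition eventually_above :: "int \<Rightarrow> int \<Rightarrow> (nat \<Rightarrow> int) set" where
  "eventually_above s K = {X. \<exists>m. \<forall>n\<ge>m. s * X n \<ge> K}"

definition stays_above :: "int \<Rightarrow> int \<Rightarrow> (nat \<Rightarrow> int) set" where
  "stays_above s K = {X. \<forall>n. s * X n \<ge> K}"

lemma sets_bounded_side [measurable]: "bounded_side s \<in> sets trajectories"
  unfolding bounded_side_def by (rule sets_trajectoriesI) measurable

lemma sets_eventually_above [measurable]: "eventually_above s K \<in> sets trajectories"
  unfolding eventually_above_def by (rule sets_trajectoriesI) measurable

lemma sets_stays_above [measurable]: "stays_above s K \<in> sets trajectories"
  unfolding stays_above_def by (rule sets_trajectoriesI) measurable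

lemma shift_invariant_bounded_side: "shift_invariant (bounded_side s)"
  unfolding shift_invariant_def
proof (intro conjI allI)
  fix x X
  show "case_nat x X \<in> bounded_side s \<longleftrightarrow> X \<in> bounded_side s"
  proof
    assume "case_nat x X \<in> bounded_side s"
    then obtain K where "\<forall>n. s * case_nat x X n \<ge> K" by (auto simp: bounded_side_def)
    then have "s * X n \<ge> K" for n by (auto dest: spec[of _ "Suc n"])
    then show "X \<in> bounded_side s" by (auto simp: bounded_side_def)
  next
    assume "X \<in> bounded_side s"
    then obtain K where "\<forall>n. s * X n \<ge> K" by (auto simp: bounded_side_def)
    then have "\<forall>n. s * case_nat x X n \<ge> min K (s * x)" by (auto simp: min_le_iff_disj split: nat.splits)
    then show "case_nat x X \<in> bounded_side s" unfolding bounded_side_def by blast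
  qed
qed (rule sets_bounded_side)

lemma shift_invariant_eventually_above: "shift_invariant (eventually_above s K)"
  unfolding shift_invariant_def
proof (intro conjI allI)
  fix x X
  show "case_nat x X \<in> eventually_above s K \<longleftrightarrow> X \<in> eventually_above s K"
  proof
    assume "case_nat x X \<in> eventually_above s K"
    then obtain m where "\<forall>n\<ge>m. s * case_nat x X n \<ge> K" by (auto simp: eventually_above_def)
    then have "s * X n \<ge> K" if "n \<ge> m" for n using that by (auto dest: spec[of _ "Suc n"])
    then show "X \<in> eventually_above s K" by (auto simp: eventually_above_def)
  next
    assume "X \<in> eventually_above s K"
    then obtain m where "\<forall>n\<ge>m. s * X n \<ge> K" by (auto simp: eventually_above_def)
    then have "\<forall>n\<ge>Suc m. s * case_nat x X n \<ge> K" by (simp add: all_ge_Suc)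
    then show "case_nat x X \<in> eventually_above s K" unfolding eventually_above_def by blast
  qed
qed (rule sets_eventually_above)

context stationary_environment
begin

lemma AE_E_environment: "AE \<omega> in E. \<omega> \<in> space environments"
  using AE_space[of E] by (simp add: space_E)

definition window :: "int \<Rightarrow> int \<Rightarrow> int set" where
  "window s N = {z. N \<le> s * z \<and> s * z < N + B}"

lemma B_pos: "B > 0"
  using jump_pos jump_bound by fastforce

lemma window_card:
  assumes "\<bar>s\<bar> = 1"
  shows "finite (window s N)" "card (window s N) = nat B"
proof -
  have "bij_betw (\<lambda>z. s * z) {N..<N + B} (window s N)"
    by (rule bij_betwI[where g = "\<lambda>z. s * z"])
      (use assms in \<open>auto simp: window_def abs_if split: if_splits\<close>)
  then show "finite (window s N)" "card (window s N) = nat B"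
    using bij_betw_finite bij_betw_same_card by fastforce+
qed

lemma prob_staying_pos_const:
  assumes s: "\<bar>s\<bar> = 1"
  shows "prob {\<omega>\<in>space E. measure (quenched_law \<omega> x) (stays_above s (s * x)) > 0} =
         prob {\<omega>\<in>space E. measure (quenched_law \<omega> 0) (stays_above s 0) > 0}"
proof -
  have "{X. (\<lambda>n. X n - x) \<in> stays_above s 0} = stays_above s (s * x)"
    by (auto simp: stays_above_def algebra_simps)
  then show ?thesis
    using prob_walk_prob_shift[OF sets_stays_above[of s 0], of "\<lambda>t. t > 0" 0 x] by simp
qed

text \<open>
  The event that staying beyond the starting point is possible from infinitely many sites in
  direction \<open>s\<close> is a tail event, because staying beyond \<open>x\<close> only involves the sites beyond \<open>x\<close>. If it
  is null, then so is each single event: by stationarity they all have the same probability, which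
  is a lower bound for the probability of infinitely many of them.
\<close>

lemma minimum_zero_one:
  assumes s: "\<bar>s\<bar> = 1"
  shows "(AE \<omega> in E. \<exists>x. measure (quenched_law \<omega> x) (stays_above s (s * x)) > 0) \<or>
         (\<forall>x. AE \<omega> in E. measure (quenched_law \<omega> x) (stays_above s (s * x)) = 0)"
proof -
  define q where "q n \<omega> = measure (quenched_law \<omega> (s * int n)) (stays_above s (int n))" for n \<omega>
  have ss: "s * (s * z) = z" for z using s by (auto simp: abs_if split: if_splits)
  define G where "G n = {\<omega>\<in>space E. q n \<omega> > 0}" for n
  define T where "T = (\<Inter>m. \<Union>n\<in>{m..}. G n)"
  define \<F> where "\<F> y = sigma_sets (space E)
    {(\<lambda>\<omega>. \<omega> y) -` C \<inter> space E | C. C \<in> sets (prob_algebra (count_space (UNIV :: int set)))}" for y :: int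
  let ?A = "\<lambda>n. \<F> (s * int n)"
  have q_meas [measurable]: "q n \<in> borel_measurable E" for n
    unfolding q_def by measurable
  have G [measurable]: "G n \<in> events" for n unfolding G_def by measurable
  have indep: "indep_sets ?A UNIV"
  proof (rule indep_sets_reindex[of \<F> "\<lambda>n. s * int n"])
    show "indep_sets \<F> UNIV"
      using indep_sites unfolding indep_vars_def \<F>_def by blast
    show "inj (\<lambda>n. s * int n)" using s by (auto simp: inj_def)
  qed
  have A_sub: "?A n \<subseteq> Pow (space E)" for n
  proof
    fix X assume "X \<in> ?A n"
    then have "X \<subseteq> space E" unfolding \<F>_def by (rule sigma_sets_into_sp[rotated]) blast
    then show "X \<in> Pow (space E)" by simp
  qed
  have tail: "G n \<in> sigma_sets (space E) (\<Union> (?A ` {m..}))" if nm: "n \<ge> m" for n m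
  proof -
    define F where "F = sigma (space E) (\<Union> (?A ` {m..}))"
    have sub: "\<Union> (?A ` {m..}) \<subseteq> Pow (space E)"
      using A_sub by blast
    have F: "space F = space E" "sets F = sigma_sets (space E) (\<Union> (?A ` {m..}))"
      unfolding F_def using sub by (simp_all add: space_measure_of sets_measure_of)
    \<comment> \<open>the environment with all sites before \<open>m\<close> made deterministic is a function of the coordinates from \<open>m\<close> on\<close>
    define r where "r \<omega> y = (if s * y \<ge> int m then \<omega> y else return (count_space UNIV) 0)"
      for \<omega> :: "int \<Rightarrow> int measure" and y :: int
    have r: "r \<in> F \<rightarrow>\<^sub>M environments"
    proof (rule measurable_environmentI)
      fix y
      show "(\<lambda>\<omega>. r \<omega> y) \<in> F \<rightarrow>\<^sub>M prob_algebra (count_space UNIV)"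
      proof (cases "s * y \<ge> int m")
        case True
        define k where "k = nat (s * y)"
        have y: "y = s * int k" and k: "k \<ge> m" using True ss[of y] by (auto simp: k_def)
        show ?thesis
        proof (rule measurableI)
          fix \<omega> assume "\<omega> \<in> space F"
          then show "r \<omega> y \<in> space (prob_algebra (count_space UNIV))"
            using environment_site(4)[of \<omega> y] True by (simp add: F space_E r_def)
        next
          fix C assume C: "C \<in> sets (prob_algebra (count_space (UNIV :: int set)))"
          have "(\<lambda>\<omega>. \<omega> (s * int k)) -` C \<inter> space E \<in> ?A k"
            using C unfolding \<F>_def by (intro sigma_sets.Basic) blast
          then have "(\<lambda>\<omega>. \<omega> (s * int k)) -` C \<inter> space E \<in> sets F"
            unfolding F using k by (intro sigma_sets.Basic) blast
          moreover have "(\<lambda>\<omega>. r \<omega> y) -` C \<inter> space F = (\<lambda>\<omega>. \<omega> (s * int k)) -` C \<inter> space E"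
            using True by (auto simp: F r_def y)
          ultimately show "(\<lambda>\<omega>. r \<omega> y) -` C \<inter> space F \<in> sets F" by simp
        qed
      next
        case False
        then show ?thesis
          by (auto simp: r_def space_prob_algebra prob_space_return intro!: measurable_const)
      qed
    qed
    have "(\<lambda>\<omega>. measure (quenched_law (r \<omega>) (s * int n)) (stays_above s (int n))) \<in> borel_measurable F"
      by (rule measurable_compose[OF r measurable_walk_prob]) measurable
    then have "{\<omega>\<in>space F. measure (quenched_law (r \<omega>) (s * int n)) (stays_above s (int n)) > 0} \<in> sets F"
      by measurable
    moreover have "q n \<omega> = measure (quenched_law (r \<omega>) (s * int n)) (stays_above s (int n))"
      if "\<omega> \<in> space E" for \<omega>
      unfolding q_def stays_above_def
    proof (rule staying_prob_cong)
      show "\<omega> \<in> space environments" using that by (simp add: space_E)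
      show "r \<omega> \<in> space environments" using measurable_space[OF r] that by (simp add: F)
      show "\<omega> y = r \<omega> y" if "s * y \<ge> int n" for y using that nm by (simp add: r_def)
    qed
    ultimately have "G n \<in> sets F" by (simp add: G_def F cong: conj_cong)
    then show ?thesis by (simp add: F)
  qed
  have T_tail: "T \<in> tail_events ?A"
    unfolding tail_events_def
  proof
    fix m
    interpret S: sigma_algebra "space E" "sigma_sets (space E) (\<Union> (?A ` {m..}))"
      using A_sub by (intro sigma_algebra_sigma_sets) blast
    have "T = (\<Inter>k. \<Union>n\<in>{max k m..}. G n)"
    proof
      show "T \<subseteq> (\<Inter>k. \<Union>n\<in>{max k m..}. G n)" unfolding T_def by blast
      show "(\<Inter>k. \<Union>n\<in>{max k m..}. G n) \<subseteq> T" unfolding T_def by fastforce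
    qed
    also have "\<dots> \<in> sigma_sets (space E) (\<Union> (?A ` {m..}))"
    proof (rule S.countable_INT')
      have "G n \<in> sigma_sets (space E) (\<Union> (?A ` {m..}))" if "n \<in> {max k m..}" for n k
        using that by (intro tail) simp
      then show "range (\<lambda>k. \<Union>n\<in>{max k m..}. G n) \<subseteq> sigma_sets (space E) (\<Union> (?A ` {m..}))"
        by (intro image_subsetI S.countable_UN') auto
    qed simp_all
    finally show "T \<in> sigma_sets (space E) (\<Union> (?A ` {m..}))" .
  qed
  have "prob T = 0 \<or> prob T = 1"
    by (rule kolmogorov_0_1_law[OF _ indep T_tail])
      (auto simp: \<F>_def intro!: sigma_algebra_sigma_sets)
  then show ?thesis
  proof
    assume "prob T = 1"
    then have "AE \<omega> in E. \<omega> \<in> T" by (rule AE_prob_1)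
    then have "AE \<omega> in E. \<exists>x. measure (quenched_law \<omega> x) (stays_above s (s * x)) > 0"
    proof eventually_elim
      case (elim \<omega>)
      then obtain n where "\<omega> \<in> G n" by (auto simp: T_def)
      then show ?case by (intro exI[of _ "s * int n"]) (simp add: G_def q_def ss)
    qed
    then show ?thesis ..
  next
    assume T0: "prob T = 0"
    define \<epsilon> where "\<epsilon> = prob {\<omega>\<in>space E. measure (quenched_law \<omega> 0) (stays_above s 0) > 0}"
    have \<epsilon>: "prob (G n) = \<epsilon>" for n
      using prob_staying_pos_const[OF s, of "s * int n"] by (simp add: G_def q_def ss \<epsilon>_def)
    have "(\<lambda>m. prob (\<Union>n\<in>{m..}. G n)) \<longlonglongrightarrow> prob T"
      unfolding T_def by (intro finite_Lim_measure_decseq) (auto simp: decseq_def intro: order_trans)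
    moreover have "\<epsilon> \<le> prob (\<Union>n\<in>{m..}. G n)" for m
      unfolding \<epsilon>[of m, symmetric] by (intro finite_measure_mono) auto
    ultimately have "\<epsilon> \<le> prob T" by (intro LIMSEQ_le_const) auto
    then have \<epsilon>0: "\<epsilon> = 0" using T0 by (simp add: \<epsilon>_def measure_le_0_iff)
    have "AE \<omega> in E. measure (quenched_law \<omega> x) (stays_above s (s * x)) = 0" for x
    proof -
      have "prob {\<omega>\<in>space E. measure (quenched_law \<omega> x) (stays_above s (s * x)) > 0} = 0"
        using prob_staying_pos_const[OF s, of x] \<epsilon>0 by (simp add: \<epsilon>_def)
      moreover have "{\<omega>\<in>space E. measure (quenched_law \<omega> x) (stays_above s (s * x)) > 0} \<in> events"
        by measurable
      ultimately have "AE \<omega> in E. \<omega> \<notin> {\<omega>\<in>space E. measure (quenched_law \<omega> x) (stays_above s (s * x)) > 0}"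
        by (simp only: prob_eq_0)
      with AE_space show ?thesis
        by eventually_elim (auto simp: zero_less_measure_iff)
    qed
    then show ?thesis by blast
  qed
qed

end

section \<open>Transience from boundedness on one side\<close>

lemma shifted_bounded_side: "{X. (\<lambda>n. X n - d) \<in> bounded_side s} = bounded_side s"
proof -
  have "X \<in> bounded_side s" if "(\<lambda>n. X n - d) \<in> bounded_side s" for X d
  proof -
    from that obtain K where "\<And>n. s * (X n - d) \<ge> K" by (auto simp: bounded_side_def)
    then have "s * X n \<ge> K + s * d" for n by (simp add: algebra_simps)
    then show ?thesis by (auto simp: bounded_side_def)
  qed
  from this[of _ d] this[of "\<lambda>n. _ n - d" "- d"] show ?thesis by auto
qed

lemma stays_above_mono: "j' \<le> j \<Longrightarrow> stays_above s j \<subseteq> stays_above s j'"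
  by (auto simp: stays_above_def intro: order_trans)

lemma stays_above_subset:
  "stays_above s K \<subseteq> bounded_side s" "stays_above s K \<subseteq> eventually_above s K"
  by (auto simp: stays_above_def bounded_side_def eventually_above_def)

lemma shifted_stays_above: "{X. (\<lambda>n. X n - d) \<in> stays_above s (K - s * d)} = stays_above s K"
  by (auto simp: stays_above_def algebra_simps)

context stationary_environment
begin

text \<open>
  Let \<open>f z\<close> be the quenched probability, from \<open>z\<close>, that \<open>s X\<close> is bounded below. The walk from \<open>0\<close>
  reaches level \<open>N\<close> in direction \<open>-s\<close> with probability at least \<open>1 - f 0\<close>, and if \<open>f \<ge> \<epsilon>\<close> on the window
  that it enters, it then still has probability at least \<open>\<epsilon>\<close> to be bounded. The probability to be bounded
  and to reach level \<open>N\<close> vanishes as \<open>N\<close> grows, while the probability of a bad window is at most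
  \<open>B\<close> times that of \<open>f 0 < \<epsilon>\<close>, which by hypothesis vanishes with \<open>\<epsilon>\<close>.
\<close>

lemma bounded_side_certain:
  assumes s: "\<bar>s\<bar> = 1"
    and pos: "AE \<omega> in E. measure (quenched_law \<omega> 0) (bounded_side s) > 0"
  shows "AE \<omega> in E. measure (quenched_law \<omega> 0) (bounded_side s) = 1"
proof -
  let ?D = "bounded_side s"
  define f where "f x \<omega> = measure (quenched_law \<omega> x) ?D" for x \<omega>
  define H where "H N = {X :: nat \<Rightarrow> int. \<exists>k. - s * X k \<ge> N}" for N :: int
  define p where "p \<epsilon> = prob {\<omega>\<in>space E. f 0 \<omega> < \<epsilon>}" for \<epsilon> :: real
  have s': "\<bar>- s\<bar> = 1" using s by simp
  have H [measurable]: "H N \<in> sets trajectories" for N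
    unfolding H_def by (rule sets_trajectoriesI) measurable
  have H_antimono: "H N \<subseteq> H M" if "M \<le> N" for M N
    unfolding H_def using that order_trans by blast
  have f_meas [measurable]: "f x \<in> borel_measurable E" for x
    unfolding f_def by measurable
  have f_int: "integrable E (f x)" for x
    unfolding f_def by (rule walk_prob_integrable) measurable
  have f_le_1: "f x \<omega> \<le> 1" if "\<omega> \<in> space E" for x \<omega>
    using walk_prob_le_1 that unfolding f_def space_E by blast
  define bad where "bad \<epsilon> z = {\<omega>\<in>space E. f z \<omega> < \<epsilon>}" for \<epsilon> z
  have bad [measurable]: "bad \<epsilon> z \<in> events" for \<epsilon> z unfolding bad_def by measurable
  have prob_bad: "prob (bad \<epsilon> z) = p \<epsilon>" for \<epsilon> z
    using prob_walk_prob_shift[of ?D "\<lambda>t. t < \<epsilon>" 0 z]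
    unfolding bad_def p_def f_def shifted_bounded_side by simp
  \<comment> \<open>environments with a bad window are covered because the left-hand side is then not positive\<close>
  have pointwise: "\<epsilon> * (1 - f 0 \<omega> - (\<Sum>z\<in>window (- s) N. indicator (bad \<epsilon> z) \<omega>)) \<le>
      measure (quenched_law \<omega> 0) (?D \<inter> H N)"
    if \<omega>: "elliptic I \<omega>" and \<epsilon>: "\<epsilon> > 0" and N: "N \<ge> 1" for \<epsilon> :: real and N \<omega>
  proof (cases "\<exists>z\<in>window (- s) N. \<omega> \<in> bad \<epsilon> z")
    case True
    then obtain z where z: "z \<in> window (- s) N" "\<omega> \<in> bad \<epsilon> z" by blast
    have "indicator (bad \<epsilon> z) \<omega> \<le> (\<Sum>z\<in>window (- s) N. indicator (bad \<epsilon> z) \<omega> :: real)"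
      using z window_card(1)[OF s'] by (intro member_le_sum) auto
    moreover have "indicator (bad \<epsilon> z) \<omega> = (1::real)" "0 \<le> f 0 \<omega>" using z by (simp_all add: f_def)
    ultimately have "1 - f 0 \<omega> - (\<Sum>z\<in>window (- s) N. indicator (bad \<epsilon> z) \<omega>) \<le> 0"
      by linarith
    then have "\<epsilon> * (1 - f 0 \<omega> - (\<Sum>z\<in>window (- s) N. indicator (bad \<epsilon> z) \<omega>)) \<le> 0"
      using \<epsilon> by (simp add: mult_le_0_iff)
    then show ?thesis using measure_nonneg order_trans by blast
  next
    case False
    note \<omega>' = ellipticD(1)[OF \<omega>]
    interpret q: prob_space "quenched_law \<omega> 0" by (rule prob_space_quenched_law[OF \<omega>'])
    have "UNIV = ?D \<union> H N"
    proof -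
      have "X \<in> ?D" if "X \<notin> H N" for X
      proof -
        have "s * X k \<ge> 1 - N" for k using that by (auto simp: H_def not_le dest!: spec[of _ k])
        then show ?thesis by (auto simp: bounded_side_def)
      qed
      then show ?thesis by blast
    qed
    then have "1 \<le> q.prob ?D + q.prob (H N)"
      using measure_Un_le[of ?D "quenched_law \<omega> 0" "H N"] walk_prob_space[OF \<omega>', of 0]
      by (simp add: sets_quenched_law[OF \<omega>'])
    then have "\<epsilon> * (1 - f 0 \<omega>) \<le> \<epsilon> * q.prob (H N)"
      using \<epsilon> by (intro mult_left_mono) (auto simp: f_def)
    also have "\<dots> \<le> q.prob (?D \<inter> H N)"
      unfolding H_def
    proof (rule hitting_lower_bound[OF \<omega> shift_invariant_bounded_side s'])
      show "0 \<le> \<epsilon>" "- s * 0 < N + B" using \<epsilon> N B_pos by auto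
      fix z assume "N \<le> - s * z" "- s * z < N + B"
      then have "z \<in> window (- s) N" by (simp add: window_def)
      then have "\<omega> \<notin> bad \<epsilon> z" using False by blast
      then show "\<epsilon> \<le> measure (quenched_law \<omega> z) ?D"
        using \<omega>' by (simp add: bad_def f_def space_E not_less)
    qed
    also have "(\<Sum>z\<in>window (- s) N. indicator (bad \<epsilon> z) \<omega>) = (0::real)"
      using False by (intro sum.neutral) auto
    ultimately show ?thesis by simp
  qed
  have integrated: "\<epsilon> * (1 - expectation (f 0) - B * p \<epsilon>) \<le> measure (annealed_law E 0) (?D \<inter> H N)"
    if \<epsilon>: "\<epsilon> > 0" and N: "N \<ge> 1" for \<epsilon> :: real and N
  proof -
    have "expectation (\<lambda>\<omega>. \<epsilon> * (1 - f 0 \<omega> - (\<Sum>z\<in>window (- s) N. indicator (bad \<epsilon> z) \<omega>))) \<le>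
        expectation (\<lambda>\<omega>. measure (quenched_law \<omega> 0) (?D \<inter> H N))"
      using f_int by (intro integral_mono_AE eventually_mono[OF AE_elliptic pointwise] \<epsilon> N walk_prob_integrable
          integrable_mult_right Bochner_Integration.integrable_diff Bochner_Integration.integrable_sum
          integrable_real_indicator)
        (auto simp: emeasure_eq_measure)
    also have "expectation (\<lambda>\<omega>. \<epsilon> * (1 - f 0 \<omega> - (\<Sum>z\<in>window (- s) N. indicator (bad \<epsilon> z) \<omega>))) =
        \<epsilon> * (1 - expectation (f 0) - (\<Sum>z\<in>window (- s) N. prob (bad \<epsilon> z)))"
      using f_int
      by (simp add: Bochner_Integration.integral_diff Bochner_Integration.integral_sum integrable_real_indicator
          emeasure_eq_measure prob_space)
    also have "(\<Sum>z\<in>window (- s) N. prob (bad \<epsilon> z)) = B * p \<epsilon>"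
      using window_card[OF s'] B_pos by (simp add: prob_bad)
    finally show ?thesis by (subst annealed_prob) auto
  qed
  have bound: "1 - expectation (f 0) \<le> B * p \<epsilon>" if \<epsilon>: "\<epsilon> > 0" for \<epsilon>
  proof -
    interpret a: prob_space "annealed_law E 0" by (rule annealed_law_space)
    have "(\<lambda>n. a.prob (?D \<inter> H (int n))) \<longlonglongrightarrow> a.prob (\<Inter>n. ?D \<inter> H (int n))"
    proof (rule a.finite_Lim_measure_decseq)
      show "decseq (\<lambda>n. ?D \<inter> H (int n))"
        by (intro antimonoI Int_mono subset_refl H_antimono) simp
    qed (auto simp: annealed_law_space)
    also have "(\<Inter>n. ?D \<inter> H (int n)) = {}"
    proof -
      have "\<exists>n. X \<notin> H (int n)" if "X \<in> ?D" for X
      proof -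
        from that obtain K where K: "\<And>n. s * X n \<ge> K" by (auto simp: bounded_side_def)
        have "\<not> - s * X k \<ge> int (nat (1 - K))" for k using K[of k] by simp
        then have "X \<notin> H (int (nat (1 - K)))" by (simp add: H_def)
        then show ?thesis ..
      qed
      then show ?thesis by blast
    qed
    finally have "(\<lambda>n. a.prob (?D \<inter> H (int n))) \<longlonglongrightarrow> 0" by simp
    then have "\<epsilon> * (1 - expectation (f 0) - B * p \<epsilon>) \<le> 0"
      by (rule LIMSEQ_le_const) (use integrated[OF \<epsilon>] in \<open>auto intro!: exI[of _ 1]\<close>)
    then show ?thesis using \<epsilon> by (simp add: mult_le_0_iff)
  qed
  have "(\<lambda>n. p (inverse (real (Suc n)))) \<longlonglongrightarrow> prob (\<Inter>n. bad (inverse (real (Suc n))) 0)"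
    unfolding p_def bad_def[symmetric]
  proof (rule finite_Lim_measure_decseq)
    show "decseq (\<lambda>n. bad (inverse (real (Suc n))) 0)"
    proof (rule antimonoI)
      fix m n :: nat assume "m \<le> n"
      then have le: "inverse (real (Suc n)) \<le> inverse (real (Suc m))" by (intro le_imp_inverse_le) auto
      show "bad (inverse (real (Suc n))) 0 \<subseteq> bad (inverse (real (Suc m))) 0"
        unfolding bad_def using order_less_le_trans[OF _ le] by blast
    qed
  qed auto
  also have "prob (\<Inter>n. bad (inverse (real (Suc n))) 0) = 0"
  proof -
    have "AE \<omega> in E. \<omega> \<notin> (\<Inter>n. bad (inverse (real (Suc n))) 0)"
      using pos
    proof eventually_elim
      case (elim \<omega>)
      then obtain n where "inverse (real (Suc n)) < f 0 \<omega>" using reals_Archimedean unfolding f_def by blast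
      then have "\<omega> \<notin> bad (inverse (real (Suc n))) 0" by (simp add: bad_def)
      then show ?case by blast
    qed
    then show ?thesis by (subst prob_eq_0) auto
  qed
  finally have "(\<lambda>n. B * p (inverse (real (Suc n)))) \<longlonglongrightarrow> real_of_int B * 0" by (rule tendsto_mult_left)
  then have "1 - expectation (f 0) \<le> real_of_int B * 0"
    by (rule LIMSEQ_le_const) (use bound in \<open>auto intro!: exI[of _ 0]\<close>)
  moreover have "expectation (\<lambda>\<omega>. 1 - f 0 \<omega>) = 1 - expectation (f 0)"
    using f_int by (simp add: Bochner_Integration.integral_diff prob_space)
  moreover have "expectation (\<lambda>\<omega>. 1 - f 0 \<omega>) \<ge> 0"
    using f_le_1 by (intro integral_nonneg_AE) auto
  ultimately have "expectation (\<lambda>\<omega>. 1 - f 0 \<omega>) = 0" by simp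
  moreover have "integrable E (\<lambda>\<omega>. 1 - f 0 \<omega>)" using f_int by simp
  moreover have "AE \<omega> in E. 0 \<le> 1 - f 0 \<omega>" using f_le_1 by auto
  ultimately have "AE \<omega> in E. 1 - f 0 \<omega> = 0" using integral_nonneg_eq_0_iff_AE by blast
  then show ?thesis by eventually_elim (simp add: f_def)
qed

text \<open>
  A walk with \<open>s X\<close> bounded below almost surely passes every level \<open>N\<close> in direction \<open>s\<close>. From there
  it stays above \<open>K\<close> with a probability that, by stationarity, is as close to one as desired
  once \<open>N - K\<close> is large.
\<close>

lemma bounded_side_imp_transient:
  assumes s: "\<bar>s\<bar> = 1"
    and pos: "AE \<omega> in E. measure (quenched_law \<omega> 0) (bounded_side s) > 0"
  shows "AE X in annealed_law E 0. \<forall>K. X \<in> eventually_above s K"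
proof -
  interpret a: prob_space "annealed_law E 0" by (rule annealed_law_space)
  note [simp] = annealed_law_space(2)
  have one: "AE \<omega> in E. measure (quenched_law \<omega> 0) (bounded_side s) = 1"
    by (rule bounded_side_certain[OF s pos])
  define b where "b j = a.prob (stays_above s j)" for j
  have b_mono: "b j \<le> b j'" if "j' \<le> j" for j j'
    unfolding b_def using that by (intro a.finite_measure_mono stays_above_mono) auto
  have "AE X in annealed_law E 0. X \<in> eventually_above s K" for K
  proof -
    define \<beta> where "\<beta> \<omega> = measure (quenched_law \<omega> 0) (eventually_above s K)" for \<omega>
    define \<sigma> where "\<sigma> z \<omega> = measure (quenched_law \<omega> z) (stays_above s K)" for z \<omega>
    have int: "integrable E \<beta>" "integrable E (\<sigma> z)" for z
      unfolding \<beta>_def \<sigma>_def by (intro walk_prob_integrable; measurable)+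
    have E\<beta>: "expectation \<beta> = a.prob (eventually_above s K)"
      unfolding \<beta>_def by (simp add: annealed_prob)
    have E\<sigma>: "expectation (\<sigma> z) = b (K - s * z)" for z
      using expectation_walk_prob_shift[OF sets_stays_above[of s "K - s * z"], of 0 z]
      unfolding \<sigma>_def b_def shifted_stays_above by (simp add: annealed_prob)
    have pointwise: "1 - \<beta> \<omega> \<le> (\<Sum>z\<in>window s N. 1 - \<sigma> z \<omega>)"
      if \<omega>: "elliptic I \<omega>" and q1: "measure (quenched_law \<omega> 0) (bounded_side s) = 1" and N: "N \<ge> 1" for \<omega> N
    proof -
      note \<omega>' = ellipticD(1)[OF \<omega>]
      interpret q: prob_space "quenched_law \<omega> 0" by (rule prob_space_quenched_law[OF \<omega>'])
      have "AE X in quenched_law \<omega> 0. X \<in> bounded_side s"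
        by (rule q.AE_prob_1[OF q1])
      with AE_unbounded[OF \<omega>, of 0] have "AE X in quenched_law \<omega> 0. \<exists>k. s * X k \<ge> N"
      proof eventually_elim
        case (elim X)
        then obtain k where k: "\<And>n. s * X n \<ge> k" by (auto simp: bounded_side_def)
        from s consider "s = 1" | "s = - 1" by linarith
        then show ?case
        proof cases
          case 1
          from elim obtain n where "X n < k \<or> X n > N" by blast
          then show ?thesis using 1 k[of n] by (intro exI[of _ n]) auto
        next
          case 2
          from elim obtain n where "X n < - N \<or> X n > - k" by blast
          then show ?thesis using 2 k[of n] by (intro exI[of _ n]) auto
        qed
      qed
      then have hit: "q.prob {X. \<exists>k. s * X k \<ge> N} = 1"
        using sets_trajectoriesI[of "\<lambda>X. \<exists>k. s * X k \<ge> N"] by (subst q.prob_eq_1) (auto simp: sets_quenched_law[OF \<omega>'])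
      have \<sigma>_le_1: "\<sigma> z \<omega> \<le> 1" for z unfolding \<sigma>_def by (rule walk_prob_le_1[OF \<omega>'])
      \<comment> \<open>a common lower bound on the window; if it is negative, the claim is trivial\<close>
      define m where "m = 1 - (\<Sum>z\<in>window s N. 1 - \<sigma> z \<omega>)"
      show ?thesis
      proof (cases "m \<ge> 0")
        case False
        moreover have "0 \<le> \<beta> \<omega>" by (simp add: \<beta>_def)
        ultimately show ?thesis unfolding m_def by linarith
      next
        case True
        have "m * q.prob {X. \<exists>k. s * X k \<ge> N} \<le> q.prob (eventually_above s K \<inter> {X. \<exists>k. s * X k \<ge> N})"
        proof (rule hitting_lower_bound[OF \<omega> shift_invariant_eventually_above s True])
          fix z assume "N \<le> s * z" "s * z < N + B"
          then have z: "z \<in> window s N" by (simp add: window_def)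
          have "1 - \<sigma> z \<omega> \<le> (\<Sum>z\<in>window s N. 1 - \<sigma> z \<omega>)"
            using z window_card(1)[OF s] \<sigma>_le_1 by (intro member_le_sum) auto
          then have "m \<le> \<sigma> z \<omega>" by (simp add: m_def)
          also have "\<dots> \<le> measure (quenched_law \<omega> z) (eventually_above s K)"
            unfolding \<sigma>_def
            by (intro finite_measure.finite_measure_mono prob_space.finite_measure prob_space_quenched_law[OF \<omega>'])
              (auto simp: sets_quenched_law[OF \<omega>'] stays_above_subset)
          finally show "m \<le> measure (quenched_law \<omega> z) (eventually_above s K)" .
        next
          show "s * 0 < N + B" using N B_pos by simp
        qed
        also have "\<dots> \<le> \<beta> \<omega>"
          unfolding \<beta>_def by (intro q.finite_measure_mono) (auto simp: sets_quenched_law[OF \<omega>'])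
        finally show ?thesis by (simp add: hit m_def)
      qed
    qed
    have bound: "1 - expectation \<beta> \<le> B * (1 - b (K - N))" if N: "N \<ge> 1" for N
    proof -
      have "1 - expectation \<beta> = expectation (\<lambda>\<omega>. 1 - \<beta> \<omega>)"
        using int by (simp add: Bochner_Integration.integral_diff prob_space)
      also have "\<dots> \<le> expectation (\<lambda>\<omega>. \<Sum>z\<in>window s N. 1 - \<sigma> z \<omega>)"
      proof (rule integral_mono_AE)
        show "AE \<omega> in E. 1 - \<beta> \<omega> \<le> (\<Sum>z\<in>window s N. 1 - \<sigma> z \<omega>)"
          using AE_elliptic one by eventually_elim (rule pointwise[OF _ _ N])
      qed (use int in auto)
      also have "\<dots> = (\<Sum>z\<in>window s N. 1 - b (K - s * z))"
        using int by (simp add: Bochner_Integration.integral_diff Bochner_Integration.integral_sum prob_space E\<sigma>)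
      also have "\<dots> \<le> (\<Sum>z\<in>window s N. 1 - b (K - N))"
        by (intro sum_mono diff_left_mono b_mono) (auto simp: window_def)
      also have "\<dots> = B * (1 - b (K - N))"
        using window_card[OF s] B_pos by simp
      finally show ?thesis .
    qed
    have lim: "(\<lambda>n. b (K - int n)) \<longlonglongrightarrow> a.prob (\<Union>n. stays_above s (K - int n))"
      unfolding b_def
    proof (rule a.finite_Lim_measure_incseq)
      show "incseq (\<lambda>n. stays_above s (K - int n))"
        by (intro monoI stays_above_mono) simp
    qed auto
    have un: "(\<Union>n. stays_above s (K - int n)) = bounded_side s"
    proof -
      have "\<exists>n. X \<in> stays_above s (K - int n)" if "X \<in> bounded_side s" for X
      proof -
        from that obtain k where k: "\<And>n. k \<le> s * X n" by (auto simp: bounded_side_def)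
        have "X \<in> stays_above s (K - int (nat (K - k)))"
          unfolding stays_above_def mem_Collect_eq by (intro allI order_trans[OF _ k]) simp
        then show ?thesis ..
      qed
      moreover have "stays_above s (K - int n) \<subseteq> bounded_side s" for n
        by (rule stays_above_subset)
      ultimately show ?thesis by blast
    qed
    have "a.prob (bounded_side s) = expectation (\<lambda>_. 1)"
      unfolding annealed_prob[OF sets_bounded_side] using one by (intro integral_cong_AE) auto
    then have "(\<lambda>n. b (K - int n)) \<longlonglongrightarrow> 1" using lim by (simp add: un prob_space)
    then have "(\<lambda>n. B * (1 - b (K - int n))) \<longlonglongrightarrow> real_of_int B * (1 - 1)"
      by (intro tendsto_intros)
    then have "1 - expectation \<beta> \<le> real_of_int B * (1 - 1)"
      by (rule LIMSEQ_le_const) (use bound in \<open>auto intro!: exI[of _ 1]\<close>)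
    then have "a.prob (eventually_above s K) = 1"
      using a.prob_le_1[of "eventually_above s K"] by (simp add: E\<beta>)
    then show ?thesis by (rule a.AE_prob_1)
  qed
  then show ?thesis by (simp add: AE_all_countable)
qed

lemma no_minimum_imp_unbounded_side:
  assumes s: "\<bar>s\<bar> = 1"
    and "\<And>x. AE \<omega> in E. measure (quenched_law \<omega> x) (stays_above s (s * x)) = 0"
  shows "AE X in annealed_law E y. X \<notin> bounded_side s"
proof -
  have "AE \<omega> in E. \<forall>x. measure (quenched_law \<omega> x) (stays_above s (s * x)) = 0"
    using assms(2) by (simp add: AE_all_countable)
  with AE_elliptic have "AE \<omega> in E. AE X in quenched_law \<omega> y. X \<notin> bounded_side s"
    by eventually_elim
      (auto simp: bounded_side_def stays_above_def intro!: no_minimum_imp_unbounded[OF _ _ s, simplified])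
  then show ?thesis by (subst AE_annealed_iff) auto
qed

lemma staying_null_imp_unbounded_side:
  assumes s: "\<bar>s\<bar> = 1" and null: "measure (annealed_law E x) (stays_above s (s * x)) = 0"
  shows "AE X in annealed_law E y. X \<notin> bounded_side s"
proof (rule no_minimum_imp_unbounded_side[OF s])
  have "AE \<omega> in E. measure (quenched_law \<omega> x) (stays_above s (s * x)) = 0"
    using null integral_nonneg_eq_0_iff_AE[OF walk_prob_integrable[OF sets_stays_above]]
    by (simp add: annealed_prob)
  then have x: "prob {\<omega>\<in>space E. measure (quenched_law \<omega> x) (stays_above s (s * x)) > 0} = 0"
    by (subst prob_eq_0) auto
  fix z
  have "prob {\<omega>\<in>space E. measure (quenched_law \<omega> z) (stays_above s (s * z)) > 0} = 0"
    using x unfolding prob_staying_pos_const[OF s] .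
  then have "AE \<omega> in E. \<omega> \<notin> {\<omega>\<in>space E. measure (quenched_law \<omega> z) (stays_above s (s * z)) > 0}"
    by (subst (asm) prob_eq_0) auto
  with AE_space show "AE \<omega> in E. measure (quenched_law \<omega> z) (stays_above s (s * z)) = 0"
    by eventually_elim (auto simp: zero_less_measure_iff)
qed

text \<open>
  The first alternative arises when minima are possible, as a minimum at any site gives, by
  irreducibility, positive probability of being bounded from the origin.
\<close>

theorem side_dichotomy:
  assumes s: "\<bar>s\<bar> = 1"
  shows "(AE X in annealed_law E 0. \<forall>K. X \<in> eventually_above s K) \<or>
         (\<forall>x. AE X in annealed_law E x. X \<notin> bounded_side s)"
  using minimum_zero_one[OF s]
proof
  assume "AE \<omega> in E. \<exists>x. measure (quenched_law \<omega> x) (stays_above s (s * x)) > 0"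
  with AE_elliptic have "AE \<omega> in E. measure (quenched_law \<omega> 0) (bounded_side s) > 0"
  proof eventually_elim
    case (elim \<omega>)
    note \<omega>' = ellipticD(1)[OF elim(1)]
    from elim(2) obtain x where "0 < measure (quenched_law \<omega> x) (stays_above s (s * x))" by blast
    also have "\<dots> \<le> measure (quenched_law \<omega> x) (bounded_side s)"
      by (intro finite_measure.finite_measure_mono prob_space.finite_measure prob_space_quenched_law[OF \<omega>'])
        (auto simp: sets_quenched_law[OF \<omega>'] stays_above_subset)
    finally show ?case by (rule invariant_pos_everywhere[OF elim(1) shift_invariant_bounded_side])
  qed
  from bounded_side_imp_transient[OF s this] show ?thesis ..
next
  assume "\<forall>x. AE \<omega> in E. measure (quenched_law \<omega> x) (stays_above s (s * x)) = 0"
  then show ?thesis using no_minimum_imp_unbounded_side[OF s] by blast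
qed

end

section \<open>Dirichlet moments and weights of paths\<close>

text \<open>
  Multiplying by a monomial shifts the parameters of the density; only the normalising constant
  changes.
\<close>

lemma dirichlet_density_moments:
  fixes I :: "'i set"
  assumes I: "finite I" and a: "\<And>i. i \<in> I \<Longrightarrow> a i > 0" and p: "\<And>i. i \<in> I \<Longrightarrow> p i > 0"
    and ne: "I \<noteq> {}"
  shows "dirichlet_density I a p * (\<Prod>i\<in>I. p i ^ n i) =
    (\<Prod>i\<in>I. pochhammer (a i) (n i)) / pochhammer (sum a I) (sum n I) *
      dirichlet_density I (\<lambda>i. a i + real (n i)) p"
proof -
  have G: "Gamma (x + real k) = pochhammer x k * Gamma x" if "x > 0" for x :: real and k
  proof -
    have "x \<notin> \<int>\<^sub>\<le>\<^sub>0" using that by (auto elim!: nonpos_Ints_cases)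
    then show ?thesis using Gamma_real_pos[OF that] by (simp add: pochhammer_Gamma)
  qed
  have sa: "sum a I > 0" using I ne a by (intro sum_pos) auto
  have "(\<Prod>i\<in>I. p i powr (a i - 1)) * (\<Prod>i\<in>I. p i ^ n i) = (\<Prod>i\<in>I. p i powr (a i + real (n i) - 1))"
    unfolding prod.distrib[symmetric]
  proof (rule prod.cong[OF refl])
    fix i assume "i \<in> I"
    then have "p i powr (a i - 1) * p i ^ n i = p i powr (a i - 1) * p i powr real (n i)"
      using p by (simp add: powr_realpow)
    then show "p i powr (a i - 1) * p i ^ n i = p i powr (a i + real (n i) - 1)"
      by (simp add: powr_add[symmetric] algebra_simps)
  qed
  moreover have "(\<Prod>i\<in>I. Gamma (a i + real (n i))) = (\<Prod>i\<in>I. pochhammer (a i) (n i)) * (\<Prod>i\<in>I. Gamma (a i))"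
    unfolding prod.distrib[symmetric] using a by (intro prod.cong) (auto simp: G)
  moreover have "Gamma (\<Sum>i\<in>I. a i + real (n i)) = pochhammer (sum a I) (sum n I) * Gamma (sum a I)"
    using G[OF sa, of "sum n I"] by (simp add: sum.distrib)
  moreover have "pochhammer (sum a I) (sum n I) > 0" "(\<Prod>i\<in>I. pochhammer (a i) (n i)) > 0"
    using sa a by (auto intro!: pochhammer_pos prod_pos)
  ultimately show ?thesis
    unfolding dirichlet_density_def by (simp add: field_simps)
qed

lemma nn_integral_dirichlet_moments:
  fixes I :: "'i::linorder set"
  assumes I: "finite I" "I \<noteq> {}" and a: "\<And>i. i \<in> I \<Longrightarrow> a i > 0"
  shows "(\<integral>\<^sup>+p. (\<Prod>i\<in>I. ennreal (p i) ^ n i) \<partial>dirichlet I a) =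
    ennreal ((\<Prod>i\<in>I. pochhammer (a i) (n i)) / pochhammer (sum a I) (sum n I))"
proof -
  let ?m = "Max I" and ?J = "I - {Max I}"
  let ?R = "restrict_space (PiM ?J (\<lambda>_. lborel)) (open_corner ?J)"
  let ?T = "restrict_space (PiM I (\<lambda>_. borel :: real measure)) (open_simplex I)"
  let ?K = "(\<Prod>i\<in>I. pochhammer (a i) (n i)) / pochhammer (sum a I) (sum n I)"
  note fill = measurable_fill_last[OF I]
  have dens: "(\<lambda>u. ennreal (dirichlet_density I b (fill_last I u))) \<in> borel_measurable ?R" for b
  proof (rule measurable_compose[OF fill])
    have "(\<lambda>p. ennreal (dirichlet_density I b p)) \<in> borel_measurable (PiM I (\<lambda>_. borel))"
      unfolding dirichlet_density_def by measurable
    then show "(\<lambda>p. ennreal (dirichlet_density I b p)) \<in> borel_measurable ?T"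
      by (rule measurable_restrict_space1)
  qed
  have mono: "(\<lambda>p. \<Prod>i\<in>I. ennreal (p i) ^ n i) \<in> borel_measurable ?T"
    by (rule measurable_restrict_space1) measurable
  have K: "?K \<ge> 0"
    using a by (intro divide_nonneg_nonneg prod_nonneg pochhammer_nonneg sum_nonneg sum_pos I) auto
  have "(\<integral>\<^sup>+p. (\<Prod>i\<in>I. ennreal (p i) ^ n i) \<partial>dirichlet I a) =
      (\<integral>\<^sup>+u. ennreal (dirichlet_density I a (fill_last I u)) * (\<Prod>i\<in>I. ennreal (fill_last I u i) ^ n i) \<partial>?R)"
    unfolding dirichlet_def using fill mono dens
    by (subst nn_integral_distr) (auto simp: nn_integral_density measurable_compose[OF fill mono])
  also have "\<dots> = (\<integral>\<^sup>+u. ennreal ?K * ennreal (dirichlet_density I (\<lambda>i. a i + real (n i)) (fill_last I u)) \<partial>?R)"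
  proof (rule nn_integral_cong)
    fix u assume u: "u \<in> space ?R"
    have "fill_last I u \<in> open_simplex I"
      using measurable_space[OF fill u] by (simp add: space_restrict_space)
    then have pos: "fill_last I u i > 0" if "i \<in> I" for i
      using that by (auto simp: open_simplex_def)
    have "(\<Prod>i\<in>I. ennreal (fill_last I u i) ^ n i) = ennreal (\<Prod>i\<in>I. fill_last I u i ^ n i)"
      using pos by (simp add: ennreal_power prod_ennreal less_imp_le)
    then show "ennreal (dirichlet_density I a (fill_last I u)) * (\<Prod>i\<in>I. ennreal (fill_last I u i) ^ n i) =
       ennreal ?K * ennreal (dirichlet_density I (\<lambda>i. a i + real (n i)) (fill_last I u))"
      using dirichlet_density_moments[of I a "fill_last I u" n, OF I(1) a pos I(2)] K pos
      by (simp add: ennreal_mult''[symmetric] ennreal_mult'[symmetric] prod_nonneg less_imp_le)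
  qed
  also have "\<dots> = ennreal ?K * (\<integral>\<^sup>+u. ennreal (dirichlet_density I (\<lambda>i. a i + real (n i)) (fill_last I u)) \<partial>?R)"
    by (rule nn_integral_cmult[OF dens])
  also have "(\<integral>\<^sup>+u. ennreal (dirichlet_density I (\<lambda>i. a i + real (n i)) (fill_last I u)) \<partial>?R) = 1"
  proof -
    have "prob_space (dirichlet I (\<lambda>i. a i + real (n i)))"
      using a by (intro prob_space_dirichlet I) (simp add: add_pos_nonneg)
    then have "1 = (\<integral>\<^sup>+p. 1 \<partial>dirichlet I (\<lambda>i. a i + real (n i)))"
      by (simp add: prob_space.emeasure_space_1)
    also have "\<dots> = (\<integral>\<^sup>+u. ennreal (dirichlet_density I (\<lambda>i. a i + real (n i)) (fill_last I u)) \<partial>?R)"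
      unfolding dirichlet_def using fill dens
      by (subst nn_integral_distr) (auto simp: nn_integral_density simp del: nn_integral_const)
    finally show ?thesis ..
  qed
  finally show ?thesis by simp
qed

lemma prod_list_map_eq_prod_power_count:
  fixes f :: "'a \<Rightarrow> 'b::comm_monoid_mult"
  assumes "finite S" "set xs \<subseteq> S"
  shows "prod_list (map f xs) = (\<Prod>x\<in>S. f x ^ count_list xs x)"
  using assms(2)
proof (induction xs)
  case (Cons y ys)
  have "(\<Prod>x\<in>S. f x ^ count_list (y # ys) x) = (\<Prod>x\<in>S. (if x = y then f x else 1) * f x ^ count_list ys x)"
    by (intro prod.cong) auto
  also have "\<dots> = f y * (\<Prod>x\<in>S. f x ^ count_list ys x)"
    using Cons.prems assms(1) by (simp add: prod.distrib prod.delta)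
  finally show ?case using Cons by simp
qed simp

lemma sum_count_list_pairs:
  assumes "finite Y" "snd ` set es \<subseteq> Y"
  shows "(\<Sum>y\<in>Y. count_list es (v, y)) = count_list (map fst es) v"
  using assms(2)
proof (induction es)
  case (Cons e es)
  have "(\<Sum>y\<in>Y. count_list (e # es) (v, y)) = (\<Sum>y\<in>Y. (if (v, y) = e then 1 else 0) + count_list es (v, y))"
    by (intro sum.cong) auto
  also have "\<dots> = (\<Sum>y\<in>Y. (if y = snd e then (if v = fst e then 1 else 0) else 0)) + (\<Sum>y\<in>Y. count_list es (v, y))"
    unfolding sum.distrib by (intro arg_cong2[where f = "(+)"] sum.cong) (auto simp: prod_eq_iff)
  also have "\<dots> = (if v = fst e then 1 else 0) + (\<Sum>y\<in>Y. count_list es (v, y))"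
    using Cons.prems assms(1) by (simp add: sum.delta)
  finally show ?case using Cons by auto
qed simp

lemma count_list_map_inj: "inj f \<Longrightarrow> count_list (map f xs) (f x) = count_list xs x"
  by (induction xs) (auto simp: inj_eq)

text \<open>
  With \<open>c\<close> the Dirichlet parameters and \<open>A\<close> their sum, this is the annealed probability of the steps
  between the sites of \<open>xs\<close>, except that the denominator already counts the exit from the last site.
  Every ordered pair of visited sites appears in the numerator, used as an edge or not, which makes
  the symmetry under reversal visible.
\<close>

definition path_weight :: "(int \<Rightarrow> real) \<Rightarrow> real \<Rightarrow> int list \<Rightarrow> real" where
  "path_weight c A xs =
    (\<Prod>v\<in>set xs. \<Prod>y\<in>set xs. pochhammer (c (y - v)) (count_list (zip xs (tl xs)) (v, y))) /
    (\<Prod>v\<in>set xs. pochhammer A (count_list xs v))"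

lemma zip_tl_append: "xs \<noteq> [] \<Longrightarrow> zip (xs @ [b]) (tl (xs @ [b])) = zip xs (tl xs) @ [(last xs, b)]"
proof (induction xs)
  case (Cons x xs)
  then show ?case by (cases xs) auto
qed simp

lemma zip_tl_snoc: "xs \<noteq> [] \<Longrightarrow> zip xs (tl xs @ [b]) = zip xs (tl xs) @ [(last xs, b)]"
proof (induction xs)
  case (Cons x xs)
  then show ?case by (cases xs) auto
qed simp

lemma zip_rev_tl: "zip (rev xs) (tl (rev xs)) = map prod.swap (rev (zip xs (tl xs)))"
proof (induction xs)
  case (Cons x xs)
  show ?case
  proof (cases xs)
    case (Cons y ys)
    have "zip (rev (x # xs)) (tl (rev (x # xs))) = zip (rev xs) (tl (rev xs)) @ [(last (rev xs), x)]"
      using zip_tl_append[of "rev xs" x] Cons by (simp del: zip_rev)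
    moreover have "map prod.swap (rev (zip (x # xs) (tl (x # xs)))) = map prod.swap (rev (zip xs (tl xs))) @ [(y, x)]"
      by (simp add: Cons)
    moreover have "last (rev xs) = y" by (simp add: Cons)
    ultimately show ?thesis by (simp only: Cons.IH)
  qed simp
qed simp

text \<open>
  Reversal keeps the number of visits to each site and reverses each edge; the reflection restores
  the sign of each jump.
\<close>

lemma path_weight_reverse: "path_weight c A (map uminus (rev xs)) = path_weight c A xs"
proof -
  let ?ys = "map uminus (rev xs)"
  have inj: "inj (uminus :: int \<Rightarrow> int)" by simp
  have zip: "zip ?ys (tl ?ys) = map (\<lambda>(v, y). (- y, - v)) (rev (zip xs (tl xs)))"
  proof -
    have "zip ?ys (tl ?ys) = map (map_prod uminus uminus) (zip (rev xs) (tl (rev xs)))"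
      by (simp add: map_tl[symmetric] zip_map_map map_prod_def)
    then show ?thesis unfolding zip_rev_tl by (simp add: comp_def case_prod_beta map_prod_def prod.swap_def)
  qed
  have cnt: "count_list (zip ?ys (tl ?ys)) (- y, - v) = count_list (zip xs (tl xs)) (v, y)" for v y
  proof -
    have "inj (\<lambda>(v :: int, y :: int). (- y, - v))" by (auto simp: inj_def)
    from count_list_map_inj[OF this, of "rev (zip xs (tl xs))" "(v, y)"]
    show ?thesis by (simp add: zip)
  qed
  have "(\<Prod>v\<in>set ?ys. \<Prod>y\<in>set ?ys. pochhammer (c (y - v)) (count_list (zip ?ys (tl ?ys)) (v, y))) =
    (\<Prod>v\<in>set xs. \<Prod>y\<in>set xs. pochhammer (c (- y - - v)) (count_list (zip ?ys (tl ?ys)) (- v, - y)))"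
    by (simp add: prod.reindex inj_on_subset[OF inj])
  also have "\<dots> = (\<Prod>v\<in>set xs. \<Prod>y\<in>set xs. pochhammer (c (v - y)) (count_list (zip xs (tl xs)) (y, v)))"
    by (simp add: cnt algebra_simps)
  also have "\<dots> = (\<Prod>v\<in>set xs. \<Prod>y\<in>set xs. pochhammer (c (y - v)) (count_list (zip xs (tl xs)) (v, y)))"
    by (rule prod.swap)
  finally have num: "(\<Prod>v\<in>set ?ys. \<Prod>y\<in>set ?ys. pochhammer (c (y - v)) (count_list (zip ?ys (tl ?ys)) (v, y))) =
     (\<Prod>v\<in>set xs. \<Prod>y\<in>set xs. pochhammer (c (y - v)) (count_list (zip xs (tl xs)) (v, y)))" .
  have "(\<Prod>v\<in>set ?ys. pochhammer A (count_list ?ys v)) = (\<Prod>v\<in>set xs. pochhammer A (count_list ?ys (- v)))"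
    by (simp add: prod.reindex inj_on_subset[OF inj])
  also have "\<dots> = (\<Prod>v\<in>set xs. pochhammer A (count_list xs v))"
    by (simp add: count_list_map_inj[OF inj])
  finally show ?thesis unfolding path_weight_def num by simp
qed

section \<open>The Dirichlet environment\<close>

locale dirichlet_model =
  fixes L R :: nat and \<alpha> :: "int \<Rightarrow> real"
  assumes L_pos: "L > 0" and R_pos: "R > 0"
    and \<alpha>_nonneg: "\<And>i. i \<in> {- int L..int R} \<Longrightarrow> \<alpha> i \<ge> 0"
    and \<alpha>_left: "\<alpha> (- int L) > 0" and \<alpha>_right: "\<alpha> (int R) > 0"
    and \<alpha>_Gcd: "Gcd {i \<in> {- int L..int R}. \<alpha> i > 0} = 1"
begin

abbreviation "J \<equiv> jump_range L R \<alpha>"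
abbreviation "E \<equiv> dirichlet_environment L R \<alpha>"

text \<open>
  The parameters \<open>\<alpha>\<close> are unconstrained outside the range of jumps, where the weight has to vanish.
\<close>

definition weight :: "int \<Rightarrow> real" where
  "weight i = (if i \<in> J then \<alpha> i else 0)"

definition total :: real where "total = sum \<alpha> J"

definition site :: "int \<Rightarrow> int measure measure" where
  "site x = distr (dirichlet J \<alpha>) (prob_algebra (count_space UNIV)) (jump_measure J x)"

lemma E_def: "E = PiM UNIV site"
  unfolding dirichlet_environment_def site_def ..

lemma J: "finite J" "J \<noteq> {}" "\<And>i. i \<in> J \<Longrightarrow> \<alpha> i > 0"
  using \<alpha>_left by (auto simp: jump_range_def intro: finite_subset[of _ "{- int L..int R}"])

lemma sets_dirichlet_J:
  "sets (dirichlet J \<alpha>) = sets (restrict_space (PiM J (\<lambda>_. borel)) (open_simplex J))"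
  by (simp add: dirichlet_def)

lemma space_dirichlet_J: "p \<in> space (dirichlet J \<alpha>) \<longleftrightarrow> p \<in> open_simplex J"
  unfolding sets_eq_imp_space_eq[OF sets_dirichlet_J]
  by (auto simp: space_restrict_space space_PiM open_simplex_def PiE_iff)

lemma measurable_jump_measure_J:
  "jump_measure J x \<in> dirichlet J \<alpha> \<rightarrow>\<^sub>M prob_algebra (count_space UNIV)"
  using measurable_cong_sets[OF sets_dirichlet_J refl] measurable_jump_measure[OF J(1)] by blast

lemma prob_space_site: "prob_space (site x)"
  unfolding site_def
  by (rule prob_space.prob_space_distr[OF prob_space_dirichlet[OF J] measurable_jump_measure_J])

lemma sets_site [measurable_cong, simp]: "sets (site x) = sets (prob_algebra (count_space UNIV))"
  by (simp add: site_def)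

lemma prob_space_E: "prob_space E"
  unfolding E_def by (rule prob_space_PiM[OF prob_space_site])

lemma sets_E': "sets E = sets environments"
  unfolding E_def environments_def by (intro sets_PiM_cong) simp_all

lemma distr_site: "distr E (prob_algebra (count_space UNIV)) (\<lambda>\<omega>. \<omega> x) = site x"
proof -
  have "distr E (prob_algebra (count_space UNIV)) (\<lambda>\<omega>. \<omega> x) = distr E (site x) (\<lambda>\<omega>. \<omega> x)"
    by (rule distr_cong) simp_all
  also have "\<dots> = site x"
    unfolding E_def by (rule distr_PiM_component[OF prob_space_site]) simp
  finally show ?thesis .
qed

lemma measurable_site_E: "(\<lambda>\<omega>. \<omega> x) \<in> E \<rightarrow>\<^sub>M prob_algebra (count_space UNIV)"
  using measurable_site by (simp add: measurable_cong_sets[OF sets_E' refl])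

lemma indep_sites_E:
  "prob_space.indep_vars E (\<lambda>_. prob_algebra (count_space UNIV)) (\<lambda>x \<omega>. \<omega> x) UNIV"
proof -
  interpret prob_space E by (rule prob_space_E)
  have "distr E (PiM UNIV (\<lambda>_. prob_algebra (count_space UNIV))) (\<lambda>\<omega>. \<lambda>i\<in>UNIV. \<omega> i) = distr E E (\<lambda>\<omega>. \<omega>)"
    using sets_E' by (intro distr_cong) (auto simp: environments_def)
  also have "\<dots> = PiM UNIV (\<lambda>x. distr E (prob_algebra (count_space UNIV)) (\<lambda>\<omega>. \<omega> x))"
    by (simp add: distr_site E_def[symmetric])
  finally show ?thesis
    by (subst indep_vars_iff_distr_eq_PiM) (auto simp: measurable_site_E)
qed

lemma AE_elliptic_E: "AE \<omega> in E. elliptic J \<omega>"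
proof -
  interpret prob_space E by (rule prob_space_E)
  define P where "P x \<mu> \<longleftrightarrow> (\<forall>i\<in>J. measure \<mu> {x + i} > 0) \<and> (\<Sum>i\<in>J. measure \<mu> {x + i}) = 1"
    for x :: int and \<mu> :: "int measure"
  have "AE \<mu> in site x. P x \<mu>" for x
    unfolding site_def
  proof (subst AE_distr_iff[OF measurable_jump_measure_J])
    show "{\<mu> \<in> space (prob_algebra (count_space UNIV)). P x \<mu>} \<in> sets (prob_algebra (count_space UNIV))"
      unfolding P_def using J(1) by measurable
    have "P x (jump_measure J x p)" if "p \<in> space (dirichlet J \<alpha>)" for p
      using that measure_jump_measure[OF J(1), of p x]
      by (auto simp: P_def space_dirichlet_J open_simplex_def)
    then show "AE p in dirichlet J \<alpha>. P x (jump_measure J x p)" by (intro AE_I2)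
  qed
  then have "AE \<omega> in E. P x (\<omega> x)" for x
    unfolding E_def by (intro AE_PiM_component[OF prob_space_site]) simp_all
  then have "AE \<omega> in E. \<forall>x. P x (\<omega> x)" by (simp add: AE_all_countable)
  with AE_space show ?thesis
    by eventually_elim (use sets_eq_imp_space_eq[OF sets_E'] in \<open>auto simp: elliptic_def P_def\<close>)
qed

lemma distr_jump_measure:
  "distr (jump_measure J x p) (count_space UNIV) (\<lambda>y. y - d) = jump_measure J (x - d) p"
proof -
  have "(\<lambda>y. y - d) \<circ> (\<lambda>i. x + i) = (\<lambda>i. x - d + i)" by (auto simp: fun_eq_iff)
  then show ?thesis unfolding jump_measure_def by (subst distr_distr) simp_all
qed

text \<open>
  The coordinates of the shifted environment are independent, and each has the law prescribed at its
  site.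
\<close>

lemma stationary_E: "distr E environments (shift_environment d) = E"
proof -
  interpret prob_space E by (rule prob_space_E)
  let ?S = "prob_algebra (count_space (UNIV :: int set))"
  let ?t = "\<lambda>\<mu>. distr \<mu> (count_space UNIV) (\<lambda>y::int. y - d)"
  have t: "?t \<in> ?S \<rightarrow>\<^sub>M ?S" by (rule measurable_distr_prob_algebra) simp
  have indep: "indep_vars (\<lambda>_. ?S) (\<lambda>x \<omega>. ?t (\<omega> (x + d))) UNIV"
  proof (rule indep_vars_compose2[of "\<lambda>_. ?S" "\<lambda>x \<omega>. \<omega> (x + d)" UNIV, OF _ t])
    have "indep_sets (\<lambda>y. sigma_sets (space E) {(\<lambda>\<omega>. \<omega> y) -` A \<inter> space E |A. A \<in> sets ?S}) UNIV"
      using indep_sites_E unfolding indep_vars_def by blast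
    from indep_sets_reindex[OF this, of "\<lambda>x. x + d"]
    show "indep_vars (\<lambda>_. ?S) (\<lambda>x \<omega>. \<omega> (x + d)) UNIV"
      unfolding indep_vars_def using measurable_site_E by (simp add: inj_def)
  qed
  have comp: "distr E ?S (\<lambda>\<omega>. ?t (\<omega> (x + d))) = site x" for x
  proof -
    have "distr E ?S (\<lambda>\<omega>. ?t (\<omega> (x + d))) = distr (distr E ?S (\<lambda>\<omega>. \<omega> (x + d))) ?S ?t"
      by (subst distr_distr[OF t measurable_site_E]) (simp add: comp_def)
    also have "\<dots> = distr (dirichlet J \<alpha>) ?S (\<lambda>p. ?t (jump_measure J (x + d) p))"
      unfolding distr_site unfolding site_def
      by (subst distr_distr[OF t measurable_jump_measure_J]) (simp add: comp_def)
    also have "\<dots> = site x" by (simp add: distr_jump_measure site_def cong: distr_cong)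
    finally show ?thesis .
  qed
  have "distr E (PiM UNIV (\<lambda>_. ?S)) (\<lambda>\<omega>. \<lambda>x\<in>UNIV. ?t (\<omega> (x + d))) = PiM UNIV site"
    using indep measurable_compose[OF measurable_site_E t]
    by (subst (asm) indep_vars_iff_distr_eq_PiM) (auto simp: comp)
  moreover have "shift_environment d = (\<lambda>\<omega>. \<lambda>x\<in>UNIV. ?t (\<omega> (x + d)))"
    by (simp add: shift_environment_def fun_eq_iff)
  ultimately show ?thesis
    by (simp add: E_def environments_def)
qed

sublocale jump_set J "int (max L R)"
proof
  show "\<exists>i\<in>J. i > 0" using R_pos \<alpha>_right by (intro bexI[of _ "int R"]) (auto simp: jump_range_def)
  show "\<exists>i\<in>J. i < 0" using L_pos \<alpha>_left by (intro bexI[of _ "- int L"]) (auto simp: jump_range_def)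
  show "Gcd J = 1" using \<alpha>_Gcd by (simp add: jump_range_def)
  show "finite J" by (rule J)
qed (auto simp: jump_range_def)

sublocale stationary_environment J "int (max L R)" E
  by (intro stationary_environment.intro jump_set_axioms prob_space_E stationary_environment_axioms.intro
      sets_E' AE_elliptic_E indep_sites_E stationary_E)

lemma total_pos: "total > 0"
  unfolding total_def using J by (intro sum_pos) auto

lemma weight_nonneg: "weight i \<ge> 0"
  using J(3) by (simp add: weight_def less_imp_le)

text \<open>
  A target that is not at the distance of a jump contributes a factor \<open>pochhammer 0 k\<close>, which is
  zero for positive \<open>k\<close>, exactly as the transition probability.
\<close>

lemma site_moments:
  assumes Y: "finite Y"
  shows "(\<integral>\<^sup>+\<mu>. (\<Prod>y\<in>Y. emeasure \<mu> {y} ^ n y) \<partial>site x) =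
    ennreal ((\<Prod>y\<in>Y. pochhammer (weight (y - x)) (n y)) / pochhammer total (sum n Y))"
proof -
  have meas: "(\<lambda>\<mu>. \<Prod>y\<in>Y. emeasure \<mu> {y} ^ n y) \<in> borel_measurable (prob_algebra (count_space UNIV))"
    by measurable
  have em: "emeasure (jump_measure J x p) {y} = (if y - x \<in> J then ennreal (p (y - x)) else 0)" for p y
  proof -
    have "{i \<in> J. x + i \<in> {y}} = (if y - x \<in> J then {y - x} else {})" by auto
    then show ?thesis by (simp add: emeasure_jump_measure[OF J(1)])
  qed
  have int: "(\<integral>\<^sup>+\<mu>. (\<Prod>y\<in>Y. emeasure \<mu> {y} ^ n y) \<partial>site x) =
      (\<integral>\<^sup>+p. (\<Prod>y\<in>Y. (if y - x \<in> J then ennreal (p (y - x)) else 0) ^ n y) \<partial>dirichlet J \<alpha>)"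
    unfolding site_def by (subst nn_integral_distr[OF measurable_jump_measure_J]) (simp_all add: em meas)
  show ?thesis
  proof (cases "\<exists>y\<in>Y. n y > 0 \<and> y - x \<notin> J")
    case True
    then obtain y where y: "y \<in> Y" "n y > 0" "y - x \<notin> J" by blast
    then have "(\<Prod>y\<in>Y. (if y - x \<in> J then ennreal (p (y - x)) else 0) ^ n y) = 0" for p
      using Y by (auto intro!: prod_zero bexI[of _ y])
    moreover have "(\<Prod>y\<in>Y. pochhammer (weight (y - x)) (n y)) = 0"
      using Y y by (auto intro!: prod_zero bexI[of _ y] simp: weight_def pochhammer_0_left)
    ultimately show ?thesis by (simp only: int) simp
  next
    case False
    \<comment> \<open>the exponents as a function of the jump instead of the target\<close>
    define k where "k i = (if x + i \<in> Y then n (x + i) else 0)" for i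
    have inj: "inj_on (\<lambda>y. y - x) A" for A by (auto simp: inj_on_def)
    let ?Z = "{y\<in>Y. n y > 0}"
    have Z: "finite ?Z" "(\<lambda>y. y - x) ` ?Z \<subseteq> J" using Y False by auto
    have notZ: "k i = 0" if "i \<in> J - (\<lambda>y. y - x) ` ?Z" for i
      using that by (force simp: k_def)
    have red: "(\<Prod>y\<in>Y. f (y - x) (n y)) = (\<Prod>i\<in>J. f i (k i))"
      if f0: "\<And>i. f i 0 = 1" for f :: "int \<Rightarrow> nat \<Rightarrow> 'b::comm_monoid_mult"
    proof -
      have "(\<Prod>y\<in>Y. f (y - x) (n y)) = (\<Prod>y\<in>?Z. f (y - x) (n y))"
        using Y f0 by (intro prod.mono_neutral_right) auto
      also have "\<dots> = (\<Prod>i\<in>(\<lambda>y. y - x) ` ?Z. f i (k i))"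
        by (subst prod.reindex[OF inj]) (auto simp: k_def)
      also have "\<dots> = (\<Prod>i\<in>J. f i (k i))"
        using Z J(1) notZ f0 by (intro prod.mono_neutral_left) auto
      finally show ?thesis .
    qed
    have red_sum: "sum n Y = sum k J"
    proof -
      have "sum n Y = sum n ?Z" using Y by (intro sum.mono_neutral_right) auto
      also have "\<dots> = sum k ((\<lambda>y. y - x) ` ?Z)"
        by (subst sum.reindex[OF inj]) (auto simp: k_def)
      also have "\<dots> = sum k J"
        using Z J(1) notZ by (intro sum.mono_neutral_left) auto
      finally show ?thesis .
    qed
    have "(\<Prod>y\<in>Y. (if y - x \<in> J then ennreal (p (y - x)) else 0) ^ n y) = (\<Prod>i\<in>J. ennreal (p i) ^ k i)" for p
      using red[of "\<lambda>i m. (if i \<in> J then ennreal (p i) else 0) ^ m"] by simp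
    moreover have "(\<Prod>y\<in>Y. pochhammer (weight (y - x)) (n y)) = (\<Prod>i\<in>J. pochhammer (\<alpha> i) (k i))"
      using red[of "\<lambda>i m. pochhammer (weight i) m"] by (simp add: weight_def)
    ultimately show ?thesis
      using nn_integral_dirichlet_moments[OF J, where n = k] by (simp only: int red_sum total_def)
  qed
qed

text \<open>
  The transition probabilities are grouped by site. The end point \<open>b\<close> is visited for the first time
  at the end, so its edge is used once and contributes the bare weight.
\<close>

lemma annealed_prefix:
  assumes xs: "xs \<noteq> []" and b: "b \<notin> set xs"
  shows "emeasure (annealed_law E (hd xs)) {X. \<forall>k<length (xs @ [b]). X k = (xs @ [b]) ! k} =
    ennreal (path_weight weight total xs * weight (b - last xs))"
proof -
  let ?es = "zip xs (tl xs) @ [(last xs, b)]"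
  let ?V = "set xs" and ?Y = "insert b (set xs)"
  have es: "?es = zip xs (tl xs @ [b])"
    by (rule zip_tl_snoc[OF xs, symmetric])
  have fst_es: "map fst ?es = xs"
    unfolding es using xs by simp
  have es_sub: "set ?es \<subseteq> ?V \<times> ?Y"
  proof -
    have "set ?es \<subseteq> set xs \<times> set (tl xs @ [b])" unfolding es by (auto elim: in_set_zipE)
    also have "\<dots> \<subseteq> ?V \<times> ?Y" using list.set_sel(2)[OF xs] by auto
    finally show ?thesis .
  qed
  have quenched: "emeasure (quenched_law \<omega> (hd xs)) {X. \<forall>k<length (xs @ [b]). X k = (xs @ [b]) ! k} =
      (\<Prod>v\<in>?V. \<Prod>y\<in>?Y. emeasure (\<omega> v) {y} ^ count_list ?es (v, y))"
    if \<omega>: "\<omega> \<in> space environments" for \<omega>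
  proof -
    have "emeasure (quenched_law \<omega> (hd xs)) {X. \<forall>k<length (xs @ [b]). X k = (xs @ [b]) ! k} =
        (\<Prod>k<length xs. emeasure (\<omega> (xs ! k)) {(tl xs @ [b]) ! k})"
      unfolding quenched_law_prefix[OF \<omega>, of _ _ "\<lambda>k. (xs @ [b]) ! k"]
      using xs by (cases xs)
        (auto simp: prod.lessThan_Suc_shift step_kernel_def nth_append simp del: prod.lessThan_Suc intro!: prod.cong)
    also have "\<dots> = prod_list (map (\<lambda>(v, y). emeasure (\<omega> v) {y}) ?es)"
      unfolding es using xs by (subst prod.list_conv_set_nth) (auto simp: lessThan_atLeast0)
    also have "\<dots> = (\<Prod>e\<in>?V \<times> ?Y. (case e of (v, y) \<Rightarrow> emeasure (\<omega> v) {y}) ^ count_list ?es e)"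
      using es_sub by (intro prod_list_map_eq_prod_power_count) auto
    also have "\<dots> = (\<Prod>v\<in>?V. \<Prod>y\<in>?Y. emeasure (\<omega> v) {y} ^ count_list ?es (v, y))"
      by (subst prod.cartesian_product) (auto intro!: prod.cong)
    finally show ?thesis .
  qed
  have emeas: "(\<lambda>\<mu>. \<Prod>y\<in>?Y. emeasure \<mu> {y} ^ k y) \<in> borel_measurable (prob_algebra (count_space UNIV))" for k
    by measurable
  have "emeasure (annealed_law E (hd xs)) {X. \<forall>k<length (xs @ [b]). X k = (xs @ [b]) ! k} =
    (\<integral>\<^sup>+\<omega>. emeasure (quenched_law \<omega> (hd xs)) {X. \<forall>k<length (xs @ [b]). X k = (xs @ [b]) ! k} \<partial>E)"
    unfolding annealed_law_def using measurable_quenched_law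
    by (intro emeasure_bind_prob_algebra[OF E_prob_algebra _ prefix_set]) 
  also have "\<dots> = (\<integral>\<^sup>+\<omega>. (\<Prod>v\<in>?V. \<Prod>y\<in>?Y. emeasure (\<omega> v) {y} ^ count_list ?es (v, y)) \<partial>E)"
    by (intro nn_integral_cong quenched) (simp add: space_E)
  also have "\<dots> = (\<Prod>v\<in>?V. \<integral>\<^sup>+\<omega>. (\<Prod>y\<in>?Y. emeasure (\<omega> v) {y} ^ count_list ?es (v, y)) \<partial>E)"
  proof (rule indep_vars_nn_integral)
    show "indep_vars (\<lambda>_. borel) (\<lambda>v \<omega>. \<Prod>y\<in>?Y. emeasure (\<omega> v) {y} ^ count_list ?es (v, y)) ?V"
      by (rule indep_vars_compose2[OF indep_vars_subset[OF indep_sites]]) (auto intro!: emeas)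
  qed auto
  also have "\<dots> = (\<Prod>v\<in>?V. \<integral>\<^sup>+\<mu>. (\<Prod>y\<in>?Y. emeasure \<mu> {y} ^ count_list ?es (v, y)) \<partial>site v)"
    unfolding distr_site[symmetric]
    by (intro prod.cong refl nn_integral_distr[symmetric] measurable_site_E)
      (simp only: measurable_distr_eq1 emeas)
  also have "\<dots> = (\<Prod>v\<in>?V. ennreal ((\<Prod>y\<in>?Y. pochhammer (weight (y - v)) (count_list ?es (v, y))) /
      pochhammer total (count_list xs v)))"
  proof (rule prod.cong[OF refl])
    fix v
    have "(\<Sum>y\<in>?Y. count_list ?es (v, y)) = count_list (map fst ?es) v"
      using es_sub by (intro sum_count_list_pairs) auto
    then show "(\<integral>\<^sup>+\<mu>. (\<Prod>y\<in>?Y. emeasure \<mu> {y} ^ count_list ?es (v, y)) \<partial>site v) =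
      ennreal ((\<Prod>y\<in>?Y. pochhammer (weight (y - v)) (count_list ?es (v, y))) / pochhammer total (count_list xs v))"
      unfolding fst_es by (subst site_moments) simp_all
  qed
  also have "\<dots> = ennreal (\<Prod>v\<in>?V. (\<Prod>y\<in>?Y. pochhammer (weight (y - v)) (count_list ?es (v, y))) /
      pochhammer total (count_list xs v))"
  proof -
    have "pochhammer (weight i) k \<ge> 0" for i k
      using weight_nonneg[of i] pochhammer_pos[of "weight i" k]
      by (cases "weight i = 0") (auto simp: pochhammer_0_left less_imp_le)
    then show ?thesis
      using total_pos by (intro prod_ennreal divide_nonneg_nonneg prod_nonneg) (auto simp: pochhammer_pos less_imp_le)
  qed
  also have "(\<Prod>v\<in>?V. (\<Prod>y\<in>?Y. pochhammer (weight (y - v)) (count_list ?es (v, y))) / pochhammer total (count_list xs v))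
      = path_weight weight total xs * weight (b - last xs)"
  proof -
    let ?c = "count_list (zip xs (tl xs))"
    have b0: "?c (v, b) = 0" for v
      using b list.set_sel(2)[OF xs] by (auto simp: count_list_0_iff dest!: set_zip_rightD)
    \<comment> \<open>among the edges out of \<open>v\<close>, the one to \<open>b\<close> is used only if \<open>v\<close> is the last site\<close>
    have "(\<Prod>y\<in>?Y. pochhammer (weight (y - v)) (count_list ?es (v, y))) =
        (if v = last xs then weight (b - last xs) else 1) * (\<Prod>y\<in>?V. pochhammer (weight (y - v)) (?c (v, y)))" for v
    proof -
      have "(\<Prod>y\<in>?V. pochhammer (weight (y - v)) (count_list ?es (v, y))) = (\<Prod>y\<in>?V. pochhammer (weight (y - v)) (?c (v, y)))"
        using b by (intro prod.cong) auto
      then show ?thesis using b b0[of v] by (simp add: prod.insert)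
    qed
    then show ?thesis
      using xs by (simp add: path_weight_def prod_dividef prod.distrib prod.delta)
  qed
  finally show ?thesis .
qed

end

section \<open>Flux out of a half-line\<close>

context dirichlet_model
begin

text \<open>
  A path is split at its first visit \<open>b\<close> to the complement of the half-line; \<open>xs\<close> lists the earlier
  sites.
\<close>

definition excursions :: "int \<Rightarrow> int \<Rightarrow> (int list \<times> int) set" where
  "excursions s x = {(xs, b). xs \<noteq> [] \<and> hd xs = x \<and> (\<forall>y\<in>set xs. s * y \<ge> 1) \<and> s * b \<le> 0}"

definition excursion_weight :: "int list \<times> int \<Rightarrow> real" where
  "excursion_weight t = path_weight weight total (fst t) * weight (snd t - last (fst t))"

lemma annealed_hitting:
  assumes x: "s * x \<ge> 1"
  shows "emeasure (annealed_law E x) {X. \<exists>n. s * X n \<le> 0} =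
    (\<integral>\<^sup>+t. ennreal (excursion_weight t) * indicator (excursions s x) t \<partial>count_space UNIV)"
proof -
  let ?pre = "\<lambda>(xs, b). {X. \<forall>k<length (xs @ [b]). X k = (xs @ [b]) ! k}"
  have preD: "xs = map X [0..<length xs]" "b = X (length xs)" "X 0 = x"
      "\<forall>k<length xs. s * X k \<ge> 1" "s * X (length xs) \<le> 0"
    if "(xs, b) \<in> excursions s x" "X \<in> ?pre (xs, b)" for xs b X
  proof -
    have X: "X k = (xs @ [b]) ! k" if "k < Suc (length xs)" for k
      using \<open>X \<in> ?pre (xs, b)\<close> that by simp
    show 1: "xs = map X [0..<length xs]"
      by (rule nth_equalityI) (auto simp: X nth_append)
    show 2: "b = X (length xs)" using X[of "length xs"] by simp
    show "X 0 = x" using X[of 0] that(1) by (auto simp: excursions_def nth_append hd_conv_nth)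
    show "\<forall>k<length xs. s * X k \<ge> 1" using X that(1) by (auto simp: excursions_def nth_append)
    show "s * X (length xs) \<le> 0" using 2 that(1) by (auto simp: excursions_def)
  qed
  have union: "(\<Union>t\<in>excursions s x. ?pre t) = {X. X 0 = x \<and> (\<exists>n. s * X n \<le> 0)}"
  proof (intro subset_antisym subsetI)
    fix X assume "X \<in> (\<Union>t\<in>excursions s x. ?pre t)"
    then obtain xs b where "(xs, b) \<in> excursions s x" "X \<in> ?pre (xs, b)" by auto
    from preD(3,5)[OF this] show "X \<in> {X. X 0 = x \<and> (\<exists>n. s * X n \<le> 0)}" by blast
  next
    fix X :: "nat \<Rightarrow> int" assume "X \<in> {X. X 0 = x \<and> (\<exists>n. s * X n \<le> 0)}"
    then have X0: "X 0 = x" and ex: "\<exists>n. s * X n \<le> 0" by auto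
    define n where "n = (LEAST n. s * X n \<le> 0)"
    have n: "s * X n \<le> 0" unfolding n_def using ex by (rule LeastI_ex)
    have least: "s * X k \<ge> 1" if "k < n" for k
      using not_less_Least[of k "\<lambda>n. s * X n \<le> 0"] that by (simp add: n_def)
    have "n \<noteq> 0" using n x X0 by (cases n) auto
    then have "(map X [0..<n], X n) \<in> excursions s x"
      using least n X0 by (auto simp: excursions_def hd_map)
    moreover have "X \<in> ?pre (map X [0..<n], X n)" by (auto simp: nth_append less_Suc_eq)
    ultimately show "X \<in> (\<Union>t\<in>excursions s x. ?pre t)" by blast
  qed
  have disj: "disjoint_family_on ?pre (excursions s x)"
  proof -
    have "t = t'" if t: "t \<in> excursions s x" "t' \<in> excursions s x" "X \<in> ?pre t" "X \<in> ?pre t'" for t t' X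
    proof -
      obtain xs b xs' b' where tt: "t = (xs, b)" "t' = (xs', b')" by (cases t, cases t')
      note p = preD[OF t(1)[unfolded tt] t(3)[unfolded tt]] and p' = preD[OF t(2)[unfolded tt] t(4)[unfolded tt]]
      have "length xs = length xs'"
      proof (rule linorder_cases[of "length xs" "length xs'"])
        assume "length xs < length xs'"
        then have "1 \<le> s * X (length xs)" using p'(4) by blast
        then show ?thesis using p(5) by linarith
      next
        assume "length xs' < length xs"
        then have "1 \<le> s * X (length xs')" using p(4) by blast
        then show ?thesis using p'(5) by linarith
      qed
      then show ?thesis using p(1,2) p'(1,2) tt by simp
    qed
    then show ?thesis unfolding disjoint_family_on_def by blast
  qed
  have meas: "?pre t \<in> sets (annealed_law E x)" for t
    using prefix_set[of "fst t @ [snd t]"] by (simp add: annealed_law_space case_prod_beta)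
  have "emeasure (annealed_law E x) {X. \<exists>n. s * X n \<le> 0} = emeasure (annealed_law E x) (\<Union>t\<in>excursions s x. ?pre t)"
    unfolding union
  proof (rule emeasure_eq_AE)
    have "AE X in annealed_law E x. X 0 = x"
      using AE_E_environment by (subst AE_annealed_iff) (auto elim!: eventually_mono intro: AE_start)
    then show "AE X in annealed_law E x. X \<in> {X. \<exists>n. s * X n \<le> 0} \<longleftrightarrow> X \<in> {X. X 0 = x \<and> (\<exists>n. s * X n \<le> 0)}"
      by eventually_elim auto
    show "{X. \<exists>n. s * X n \<le> 0} \<in> sets (annealed_law E x)"
      "{X. X 0 = x \<and> (\<exists>n. s * X n \<le> 0)} \<in> sets (annealed_law E x)"
      unfolding annealed_law_space by (rule sets_trajectoriesI; measurable)+
  qed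
  also have "\<dots> = (\<integral>\<^sup>+t. emeasure (annealed_law E x) (?pre t) \<partial>count_space (excursions s x))"
    by (intro emeasure_UN_countable meas disj) simp
  also have "\<dots> = (\<integral>\<^sup>+t. ennreal (excursion_weight t) \<partial>count_space (excursions s x))"
  proof (rule nn_integral_cong)
    fix t assume "t \<in> space (count_space (excursions s x))"
    then obtain xs b where t: "t = (xs, b)" "xs \<noteq> []" "hd xs = x" "b \<notin> set xs"
      by (cases t) (fastforce simp: excursions_def)
    from annealed_prefix[OF t(2,4)] t(3)
    show "emeasure (annealed_law E x) (?pre t) = ennreal (excursion_weight t)"
      by (simp only: t(1) excursion_weight_def prod.case fst_conv snd_conv)
  qed
  also have "\<dots> = (\<integral>\<^sup>+t. ennreal (excursion_weight t) * indicator (excursions s x) t \<partial>count_space UNIV)"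
    by (rule nn_integral_count_space_indicator) simp
  finally show ?thesis .
qed

text \<open>
  The weight with which the walk is injected from the outer site \<open>a\<close> into the site \<open>x\<close> of the
  half-line \<open>s x \<ge> 1\<close>: outside the half-line nothing is random, and a jump \<open>i\<close> occurs at rate \<open>\<alpha>\<^sub>i\<close>.
\<close>

definition entry :: "int \<Rightarrow> int \<Rightarrow> int \<Rightarrow> ennreal" where
  "entry s a x = (if s * a \<le> 0 \<and> s * x \<ge> 1 then ennreal (weight (x - a)) else 0)"

definition flux :: "int \<Rightarrow> (int \<Rightarrow> ennreal) \<Rightarrow> ennreal" where
  "flux s g = (\<integral>\<^sup>+a. \<integral>\<^sup>+x. entry s a x * g x \<partial>count_space UNIV \<partial>count_space UNIV)"

lemma swap_count_space:
  fixes f :: "'a \<Rightarrow> 'b \<Rightarrow> ennreal"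
  shows "(\<integral>\<^sup>+x. \<integral>\<^sup>+y. f x y \<partial>count_space UNIV \<partial>count_space UNIV) =
         (\<integral>\<^sup>+y. \<integral>\<^sup>+x. f x y \<partial>count_space UNIV \<partial>count_space UNIV)"
  using nn_integral_fst_count_space[of "\<lambda>(x, y). f x y"] nn_integral_snd_count_space[of "\<lambda>(x, y). f x y"]
  by simp

definition path_flow :: "int \<Rightarrow> int \<times> int list \<times> int \<Rightarrow> ennreal" where
  "path_flow s = (\<lambda>(a, xs, b).
     if xs \<noteq> [] \<and> s * a \<le> 0 \<and> (\<forall>y\<in>set xs. s * y \<ge> 1) \<and> s * b \<le> 0
     then ennreal (weight (hd xs - a)) * ennreal (excursion_weight (xs, b)) else 0)"

lemma flux_hitting:
  "flux s (\<lambda>x. emeasure (annealed_law E x) {X. \<exists>n. s * X n \<le> 0}) =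
   (\<integral>\<^sup>+u. path_flow s u \<partial>count_space UNIV)"
proof -
  have "flux s (\<lambda>x. emeasure (annealed_law E x) {X. \<exists>n. s * X n \<le> 0}) =
    (\<integral>\<^sup>+a. \<integral>\<^sup>+x. \<integral>\<^sup>+t. entry s a x * (ennreal (excursion_weight t) * indicator (excursions s x) t)
      \<partial>count_space UNIV \<partial>count_space UNIV \<partial>count_space UNIV)"
    unfolding flux_def
  proof (intro nn_integral_cong)
    fix a x
    show "entry s a x * emeasure (annealed_law E x) {X. \<exists>n. s * X n \<le> 0} =
      (\<integral>\<^sup>+t. entry s a x * (ennreal (excursion_weight t) * indicator (excursions s x) t) \<partial>count_space UNIV)"
      using annealed_hitting[of s x] by (subst nn_integral_cmult) (auto simp: entry_def)
  qed
  also have "\<dots> = (\<integral>\<^sup>+a. \<integral>\<^sup>+t. path_flow s (a, t) \<partial>count_space UNIV \<partial>count_space UNIV)"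
  proof (rule nn_integral_cong)
    fix a
    have "(\<integral>\<^sup>+x. entry s a x * (ennreal (excursion_weight t) * indicator (excursions s x) t) \<partial>count_space UNIV) =
        path_flow s (a, t)" for t
    proof -
      obtain xs b where t: "t = (xs, b)" by (cases t)
      have "(\<integral>\<^sup>+x. entry s a x * (ennreal (excursion_weight t) * indicator (excursions s x) t) \<partial>count_space UNIV) =
        (\<Sum>x\<in>{hd xs}. entry s a x * (ennreal (excursion_weight t) * indicator (excursions s x) t))"
        by (rule nn_integral_count_space') (auto simp: t excursions_def)
      also have "\<dots> = path_flow s (a, t)"
        by (auto simp: t path_flow_def excursions_def entry_def indicator_def)
      finally show ?thesis .
    qed
    then show "(\<integral>\<^sup>+x. \<integral>\<^sup>+t. entry s a x * (ennreal (excursion_weight t) * indicator (excursions s x) t)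
      \<partial>count_space UNIV \<partial>count_space UNIV) = (\<integral>\<^sup>+t. path_flow s (a, t) \<partial>count_space UNIV)"
      by (subst swap_count_space) simp
  qed
  also have "\<dots> = (\<integral>\<^sup>+u. path_flow s u \<partial>count_space UNIV)"
    by (rule nn_integral_fst_count_space)
  finally show ?thesis .
qed

text \<open>
  Reversing and reflecting a path that enters from \<open>a\<close>, visits \<open>xs\<close> and leaves to \<open>b\<close> gives a path of
  the opposite half-line that enters from \<open>-b\<close> and leaves to \<open>-a\<close> with the same weight: entrance and
  exit jump exchange their roles and both count with their bare weight.
\<close>

lemma flux_hitting_reflect:
  "flux (- s) (\<lambda>x. emeasure (annealed_law E x) {X. \<exists>n. - s * X n \<le> 0}) =
   flux s (\<lambda>x. emeasure (annealed_law E x) {X. \<exists>n. s * X n \<le> 0})"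
proof -
  define g :: "int \<times> int list \<times> int \<Rightarrow> int \<times> int list \<times> int"
    where "g = (\<lambda>(a, xs, b). (- b, map uminus (rev xs), - a))"
  have "bij_betw g UNIV UNIV"
    by (rule bij_betwI[where g = g]) (auto simp: g_def rev_map comp_def)
  then have "(\<integral>\<^sup>+u. path_flow s u \<partial>count_space UNIV) = (\<integral>\<^sup>+u. path_flow s (g u) \<partial>count_space UNIV)"
    by (rule nn_integral_bij_count_space[symmetric])
  also have "\<dots> = (\<integral>\<^sup>+u. path_flow (- s) u \<partial>count_space UNIV)"
  proof (rule nn_integral_cong)
    fix u :: "int \<times> int list \<times> int"
    obtain a xs b where u: "u = (a, xs, b)" by (cases u)
    show "path_flow s (g u) = path_flow (- s) u"
    proof (cases "xs = []")
      case False
      then have "hd (map uminus (rev xs)) = - last xs" "last (map uminus (rev xs)) = - hd xs"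
        by (simp_all add: hd_map last_map hd_rev last_rev)
      then show ?thesis
        using False by (auto simp: u g_def path_flow_def excursion_weight_def path_weight_reverse[folded rev_map]
            ennreal_mult'[symmetric] weight_nonneg mult_ac ennreal_mult''[symmetric] simp flip: rev_map)
    qed (simp add: u g_def path_flow_def)
  qed
  finally show ?thesis by (simp only: flux_hitting)
qed

definition escape :: "int \<Rightarrow> ennreal" where
  "escape s = flux s (\<lambda>x. emeasure (annealed_law E x) (stays_above s 1))"

lemma flux_split:
  "flux s (\<lambda>_. 1) = escape s + flux s (\<lambda>x. emeasure (annealed_law E x) {X. \<exists>n. s * X n \<le> 0})"
proof -
  have "emeasure (annealed_law E x) (stays_above s 1) + emeasure (annealed_law E x) {X. \<exists>n. s * X n \<le> 0} = 1" for x
  proof -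
    interpret a: prob_space "annealed_law E x" by (rule annealed_law_space)
    have "{X. \<exists>n. s * X n \<le> 0} = space (annealed_law E x) - stays_above s 1"
      using sets_eq_imp_space_eq[OF annealed_law_space(2), of x]
      by (auto simp: stays_above_def not_le) (metis int_one_le_iff_zero_less not_le)+
    then show ?thesis
      using a.emeasure_space_1 emeasure_compl[of "stays_above s 1" "annealed_law E x"]
        a.emeasure_le_1[of "stays_above s 1"]
      by (simp add: annealed_law_space(2) a.emeasure_finite)
  qed
  then have "entry s a x * 1 = entry s a x * emeasure (annealed_law E x) (stays_above s 1) +
      entry s a x * emeasure (annealed_law E x) {X. \<exists>n. s * X n \<le> 0}" for a x
    by (simp only: distrib_left[symmetric])
  then show ?thesis
    unfolding escape_def flux_def by (subst nn_integral_add[symmetric], simp, simp) (subst nn_integral_add[symmetric], simp_all)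
qed

definition drift_side :: "int \<Rightarrow> real" where
  "drift_side s = (\<Sum>i\<in>J. \<alpha> i * max 0 (real_of_int (s * i)))"

text \<open>
  A jump \<open>i\<close> with \<open>s i > 0\<close> enters the half-line from exactly \<open>s i\<close> outer sites.
\<close>

lemma flux_one:
  assumes s: "\<bar>s\<bar> = 1"
  shows "flux s (\<lambda>_. 1) = ennreal (drift_side s)"
proof -
  have ss: "s * (s * z) = z" for z using s by (auto simp: abs_if split: if_splits)
  have "flux s (\<lambda>_. 1) = (\<integral>\<^sup>+a. \<integral>\<^sup>+i. entry s a (a + i) \<partial>count_space UNIV \<partial>count_space UNIV)"
    unfolding flux_def mult_1_right
  proof (rule nn_integral_cong)
    fix a
    have "bij_betw (\<lambda>i. a + i) UNIV (UNIV :: int set)"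
      by (rule bij_betwI[where g = "\<lambda>x. x - a"]) auto
    then show "(\<integral>\<^sup>+x. entry s a x \<partial>count_space UNIV) = (\<integral>\<^sup>+i. entry s a (a + i) \<partial>count_space UNIV)"
      by (rule nn_integral_bij_count_space[symmetric])
  qed
  also have "\<dots> = (\<integral>\<^sup>+i. \<integral>\<^sup>+a. entry s a (a + i) \<partial>count_space UNIV \<partial>count_space UNIV)"
    by (rule swap_count_space)
  also have "\<dots> = (\<integral>\<^sup>+i. ennreal (weight i * max 0 (real_of_int (s * i))) \<partial>count_space UNIV)"
  proof (rule nn_integral_cong)
    fix i
    let ?S = "{a. s * a \<le> 0 \<and> s * (a + i) \<ge> 1}"
    have "bij_betw (\<lambda>a. s * a) {1 - s * i..0} ?S"
      by (rule bij_betwI[where g = "\<lambda>a. s * a"])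
        (use s in \<open>auto simp: abs_if algebra_simps split: if_splits\<close>)
    then have S: "finite ?S" "card ?S = nat (s * i)"
      using bij_betw_finite bij_betw_same_card by fastforce+
    have "(\<integral>\<^sup>+a. entry s a (a + i) \<partial>count_space UNIV) = (\<integral>\<^sup>+a. ennreal (weight i) * indicator ?S a \<partial>count_space UNIV)"
      by (intro nn_integral_cong) (simp add: entry_def indicator_def)
    also have "\<dots> = ennreal (weight i) * of_nat (card ?S)"
      using S(1) by (subst nn_integral_cmult_indicator) simp_all
    also have "(of_nat (card ?S) :: ennreal) = ennreal (max 0 (real_of_int (s * i)))"
    proof -
      have "real (nat z) = max 0 (real_of_int z)" for z by (auto simp: max_def)
      then show ?thesis by (simp only: S(2) ennreal_of_nat_eq_real_of_nat)
    qed
    finally show "(\<integral>\<^sup>+a. entry s a (a + i) \<partial>count_space UNIV) = ennreal (weight i * max 0 (real_of_int (s * i)))"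
      by (simp add: ennreal_mult weight_nonneg)
  qed
  also have "\<dots> = (\<Sum>i\<in>J. ennreal (weight i * max 0 (real_of_int (s * i))))"
    by (rule nn_integral_count_space') (auto simp: J weight_def)
  also have "\<dots> = ennreal (drift_side s)"
    using J(3) by (subst sum_ennreal) (auto simp: drift_side_def weight_def less_imp_le)
  finally show ?thesis .
qed

text \<open>
  Both half-lines have the same flux of returning walks, so the remaining fluxes satisfy
  \<open>\<kappa>\<^sup>+ - escape 1 = \<kappa>\<^sup>- - escape (-1)\<close>, where \<open>\<kappa>\<^sup>+\<close> and \<open>\<kappa>\<^sup>-\<close> are the entering fluxes; adding up avoids
  subtraction of extended reals.
\<close>

lemma escape_balance:
  assumes "\<bar>s\<bar> = 1"
  shows "ennreal (drift_side s) + escape (- s) = ennreal (drift_side (- s)) + escape s"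
proof -
  have s': "\<bar>- s\<bar> = 1" using assms by simp
  show ?thesis
    unfolding flux_one[OF assms, symmetric] flux_one[OF s', symmetric] flux_split[of s] flux_split[of "- s"]
      flux_hitting_reflect by (simp add: ac_simps)
qed

lemma drift_side_diff: "drift_side s - drift_side (- s) = s * kappa1 L R \<alpha>"
proof -
  have "kappa1 L R \<alpha> = (\<Sum>i\<in>J. real_of_int i * \<alpha> i)"
    unfolding kappa1_def
  proof (rule sum.mono_neutral_right)
    have "\<alpha> i = 0" if "i \<in> {- int L..int R} - J" for i
      using that \<alpha>_nonneg[of i] by (auto simp: jump_range_def)
    then show "\<forall>i\<in>{- int L..int R} - J. real_of_int i * \<alpha> i = 0" by simp
  qed (auto simp: jump_range_def)
  moreover have "drift_side s - drift_side (- s) = (\<Sum>i\<in>J. s * (real_of_int i * \<alpha> i))"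
    unfolding drift_side_def sum_subtractf[symmetric]
    by (intro sum.cong) (auto simp: max_def algebra_simps)
  ultimately show ?thesis by (simp add: sum_distrib_left)
qed

lemma escape_imp_transient:
  assumes s: "\<bar>s\<bar> = 1" and e: "escape s \<noteq> 0"
  shows "AE X in annealed_law E 0. \<forall>K. X \<in> eventually_above s K"
proof -
  have "\<exists>x. emeasure (annealed_law E x) (stays_above s 1) \<noteq> 0"
  proof (rule ccontr)
    assume "\<not> ?thesis"
    then have "escape s = 0" by (simp add: escape_def flux_def)
    with e show False ..
  qed
  then obtain x where x: "emeasure (annealed_law E x) (stays_above s 1) \<noteq> 0" by blast
  have "\<not> (AE X in annealed_law E x. X \<notin> bounded_side s)"
  proof
    assume "AE X in annealed_law E x. X \<notin> bounded_side s"
    then have "AE X in annealed_law E x. X \<notin> stays_above s 1"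
      by eventually_elim (use stays_above_subset(1) in blast)
    then have "emeasure (annealed_law E x) (stays_above s 1) = 0"
      by (subst (asm) AE_iff_measurable[OF _ refl])
        (auto simp: annealed_law_space(2) sets_eq_imp_space_eq[OF annealed_law_space(2)])
    with x show False ..
  qed
  with side_dichotomy[OF s] show ?thesis by blast
qed

text \<open>
  Some jump in direction \<open>s\<close> enters the half-line at its first site \<open>s\<close>, so walks from there
  almost surely leave the half-line.
\<close>

lemma no_escape_imp_unbounded_side:
  assumes s: "\<bar>s\<bar> = 1" and e: "escape s = 0"
  shows "AE X in annealed_law E y. X \<notin> bounded_side s"
proof (rule staying_null_imp_unbounded_side[OF s])
  have "\<exists>i\<in>J. s * i > 0"
  proof -
    from s consider "s = 1" | "s = -1" by linarith
    then show ?thesis using jump_pos jump_neg by cases auto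
  qed
  then obtain i where i: "i \<in> J" "s * i > 0" by blast
  have ss: "s * s = 1" using s by (auto simp: abs_if split: if_splits)
  have "AE a in count_space UNIV. AE x in count_space UNIV. entry s a x * emeasure (annealed_law E x) (stays_above s 1) = 0"
    using e unfolding escape_def flux_def by (simp add: nn_integral_0_iff_AE)
  then have "entry s (s - i) s * emeasure (annealed_law E s) (stays_above s 1) = 0"
    by (simp add: AE_count_space)
  moreover have "entry s (s - i) s > 0"
    using i J(3)[OF i(1)] ss by (simp add: entry_def weight_def algebra_simps)
  ultimately show "measure (annealed_law E s) (stays_above s (s * s)) = 0"
    using ss by (auto simp: measure_def)
qed

lemma transient_if_drift:
  assumes s: "\<bar>s\<bar> = 1" and k: "s * kappa1 L R \<alpha> > 0"
  shows "AE X in annealed_law E 0. \<forall>K. X \<in> eventually_above s K"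
proof (rule escape_imp_transient[OF s])
  have "drift_side (- s) \<ge> 0"
    unfolding drift_side_def using J(3) by (intro sum_nonneg) (auto simp: less_imp_le)
  then have lt: "ennreal (drift_side (- s)) < ennreal (drift_side s)"
    using k drift_side_diff[of s] by (simp add: ennreal_less_iff)
  show "escape s \<noteq> 0"
  proof
    assume "escape s = 0"
    then have "ennreal (drift_side s) \<le> ennreal (drift_side (- s))"
      using escape_balance[OF s] by (metis add.right_neutral le_iff_add)
    with lt show False by simp
  qed
qed

text \<open>
  Without drift the two escaping fluxes agree; if they were positive, the walk would tend to both
  infinities.
\<close>

lemma unbounded_if_no_drift:
  assumes s: "\<bar>s\<bar> = 1" and k: "kappa1 L R \<alpha> = 0"
  shows "AE X in annealed_law E 0. X \<notin> bounded_side s"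
proof (rule no_escape_imp_unbounded_side[OF s], rule ccontr)
  interpret a: prob_space "annealed_law E 0" by (rule annealed_law_space)
  assume e: "escape s \<noteq> 0"
  have s': "\<bar>- s\<bar> = 1" using s by simp
  have "drift_side s = drift_side (- s)" using drift_side_diff[of s] k by simp
  then have "escape (- s) = escape s"
    using escape_balance[OF s] by (simp add: ennreal_add_left_cancel)
  then have e': "escape (- s) \<noteq> 0" using e by simp
  have "AE X in annealed_law E 0. False"
    using escape_imp_transient[OF s e] escape_imp_transient[OF s' e']
  proof eventually_elim
    case (elim X)
    then obtain m m' where "\<forall>n\<ge>m. s * X n \<ge> 1" "\<forall>n\<ge>m'. - s * X n \<ge> 1"
      unfolding eventually_above_def by blast
    then have "s * X (max m m') \<ge> 1" "- s * X (max m m') \<ge> 1" by auto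
    then show False by simp
  qed
  then show False by simp
qed

end

section \<open>Limits of the walk\<close>

lemma bounded_below_of_tail:
  fixes X :: "nat \<Rightarrow> int"
  assumes "\<forall>n\<ge>m. s * X n \<ge> K"
  shows "X \<in> bounded_side s"
proof -
  have "s * X n \<ge> min K (Min ((\<lambda>n. s * X n) ` {..m}))" for n
  proof (cases "n \<le> m")
    case True
    then have "Min ((\<lambda>n. s * X n) ` {..m}) \<le> s * X n" by (intro Min_le) auto
    then show ?thesis by simp
  next
    case False
    then show ?thesis using assms by (simp add: min_le_iff_disj)
  qed
  then show ?thesis unfolding bounded_side_def by blast
qed

lemma unbounded_imp_liminf:
  assumes "X \<notin> bounded_side 1"
  shows "liminf (\<lambda>n. ereal (real_of_int (X n))) = - \<infinity>"
proof (rule ccontr)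
  assume "liminf (\<lambda>n. ereal (real_of_int (X n))) \<noteq> - \<infinity>"
  then obtain c where "ereal c < liminf (\<lambda>n. ereal (real_of_int (X n)))"
    using ereal_dense2[of "- \<infinity>"] by (metis ereal_infty_less(2) ereal_less_eq(2) order_le_less)
  from less_LiminfD[OF this] obtain m where "\<forall>n\<ge>m. c < real_of_int (X n)"
    by (auto simp: eventually_sequentially)
  then have "\<forall>n\<ge>m. 1 * X n \<ge> \<lfloor>c\<rfloor>" by (auto simp: floor_le_iff)
  from bounded_below_of_tail[OF this] assms show False by simp
qed

lemma unbounded_imp_limsup:
  assumes "X \<notin> bounded_side (- 1)"
  shows "limsup (\<lambda>n. ereal (real_of_int (X n))) = \<infinity>"
proof (rule ccontr)
  assume "limsup (\<lambda>n. ereal (real_of_int (X n))) \<noteq> \<infinity>"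
  then obtain c where "limsup (\<lambda>n. ereal (real_of_int (X n))) < ereal c"
    using ereal_dense2[of _ "\<infinity>"] by (metis ereal_infty_less(1))
  from Limsup_lessD[OF this] obtain m where "\<forall>n\<ge>m. real_of_int (X n) < c"
    by (auto simp: eventually_sequentially)
  then have "\<forall>n\<ge>m. - 1 * X n \<ge> - \<lceil>c\<rceil>" by (auto simp: le_ceiling_iff)
  from bounded_below_of_tail[OF this] assms show False by simp
qed

theorem theorem1p1:
  fixes L R :: nat and \<alpha> :: "int \<Rightarrow> real"
  assumes "L > 0" and "R > 0"
    and "\<And>i. i \<in> {- int L..int R} \<Longrightarrow> \<alpha> i \<ge> 0"
    and "\<alpha> (- int L) > 0" and "\<alpha> (int R) > 0"
    and "Gcd {i \<in> {- int L..int R}. \<alpha> i > 0} = 1"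
  shows "(kappa1 L R \<alpha> > 0 \<longrightarrow>
            (AE X in annealed_law (dirichlet_environment L R \<alpha>) 0.
               filterlim X at_top sequentially)) \<and>
         (kappa1 L R \<alpha> < 0 \<longrightarrow>
            (AE X in annealed_law (dirichlet_environment L R \<alpha>) 0.
               filterlim X at_bot sequentially)) \<and>
         (kappa1 L R \<alpha> = 0 \<longrightarrow>
            (AE X in annealed_law (dirichlet_environment L R \<alpha>) 0.
               - \<infinity> = liminf (\<lambda>n. ereal (real_of_int (X n))) \<and>
               liminf (\<lambda>n. ereal (real_of_int (X n))) < limsup (\<lambda>n. ereal (real_of_int (X n))) \<and>
               limsup (\<lambda>n. ereal (real_of_int (X n))) = \<infinity>))"
proof -
  interpret dirichlet_model L R \<alpha> by (rule dirichlet_model.intro; fact)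
  show ?thesis
  proof (intro conjI impI)
    assume "kappa1 L R \<alpha> > 0"
    then have "AE X in annealed_law E 0. \<forall>K. X \<in> eventually_above 1 K"
      by (intro transient_if_drift) simp_all
    then show "AE X in annealed_law E 0. filterlim X at_top sequentially"
      by eventually_elim (simp add: filterlim_at_top eventually_above_def eventually_sequentially)
  next
    assume "kappa1 L R \<alpha> < 0"
    then have "AE X in annealed_law E 0. \<forall>K. X \<in> eventually_above (- 1) K"
      by (intro transient_if_drift) simp_all
    then show "AE X in annealed_law E 0. filterlim X at_bot sequentially"
    proof eventually_elim
      case (elim X)
      have "\<exists>m. \<forall>n\<ge>m. X n \<le> Z" for Z
        using elim[rule_format, of "- Z"] by (simp add: eventually_above_def)
      then show ?case by (simp add: filterlim_at_bot eventually_sequentially)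
    qed
  next
    assume k: "kappa1 L R \<alpha> = 0"
    have "AE X in annealed_law E 0. X \<notin> bounded_side 1" "AE X in annealed_law E 0. X \<notin> bounded_side (- 1)"
      by (intro unbounded_if_no_drift k; simp)+
    then show "AE X in annealed_law E 0.
       - \<infinity> = liminf (\<lambda>n. ereal (real_of_int (X n))) \<and>
       liminf (\<lambda>n. ereal (real_of_int (X n))) < limsup (\<lambda>n. ereal (real_of_int (X n))) \<and>
       limsup (\<lambda>n. ereal (real_of_int (X n))) = \<infinity>"
      by eventually_elim (simp add: unbounded_imp_liminf unbounded_imp_limsup)
  qed
qed

end
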